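(* Let $\mathbf{X}$ be a locally small restriction category, and put $\mathbf{C}=\mathcal{M}\mathsf{Total}(\mathsf{K}_r(\mathbf{X}))$. Then there is an equivalence of restriction categories $$\mathsf{PSh}_r(\mathbf{X})\simeq\mathsf{Par}(\mathsf{PSh}_{\mathcal{M}}(\mathcal{M}\mathsf{Total}(\mathsf{K}_r(\mathbf{X})))),$$ and it can be given by an equivalence $E\colon\mathsf{Par}(\mathsf{PSh}_{\mathcal{M}}(\mathbf{C}))\to\mathsf{PSh}_r(\mathbf{X})$ such that $E\circ\Lambda\cong\mathbf{y}_r$, where $\mathbf{y}_r\colon\mathbf{X}\to\mathsf{PSh}_r(\mathbf{X})$ is the Yoneda embedding and $\Lambda$ is the Cockett--Lack embedding $$\Lambda\colon \mathbf{X} \xrightarrow{J} \mathsf{K}_r(\mathbf{X}) \xrightarrow{\Phi} \mathsf{Par}(\mathbf{C}) \xrightarrow{\mathsf{Par}(\mathbf{y})} \mathsf{Par}(\mathsf{PSh}_{\mathcal{M}}(\mathbf{C})).$$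
   Context: A restriction category is a category $\mathbf{X}$ with an assignment $f\mapsto\bar f$, $\mathbf{X}(A,B)\to\mathbf{X}(A,A)$, such that (R1) $f\bar f=f$; (R2) $\bar g\bar f=\bar f\bar g$ for $f\colon A\to B$, $g\colon A\to C$; (R3) $\overline{g\bar f}=\bar g\bar f$ for $f\colon A\to B$, $g\colon A\to C$; (R4) $\bar h f=f\,\overline{hf}$ for $f\colon A\to B$, $h\colon B\to C$. It is locally small if its underlying category is. A map $f$ is a restriction idempotent if $f=\bar f$, and total if $\bar f=1$; objects and total maps form a subcategory $\mathsf{Total}(\mathbf{X})$. A restriction functor is a functor $F$ with $F(\bar f)=\overline{F(f)}$; a restriction transformation is a natural transformation with total components. An equivalence of restriction categories is an equivalence in the 2-category $\mathbf{rCat}$ of restriction categories, restriction functors and restriction transformations. A restriction category is split if every restriction idempotent $e$ splits ($e=mr$ with $rm=1$); such maps $m$ are called restriction monics. $\mathsf{K}_r(\mathbf{X})$ is the split restriction category with objects pairs $(A,e)$, $e$ a restriction idempotent on $A$; morphisms $(A,e)\to(A',e')$ are maps $f\colon A\to A'$ in $\mathbf{X}$ with $e'fe=f$; the restriction of $f$ is $\bar f$. $J\colon\mathbf{X}\to\mathsf{K}_r(\mathbf{X})$ sends $A$ to $(A,1_A)$ and $f$ to $f$. A stable system of monics $\mathcal{M}_{\mathbf{C}}$ in a category $\mathbf{C}$ is a collection of monics containing all isomorphisms, closed under composition, and such that the pullback of any $m\in\mathcal{M}_{\mathbf{C}}$ along any map exists and lies in $\mathcal{M}_{\mathbf{C}}$.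 An $\mathcal{M}$-category is a category with a stable system of monics. An $\mathcal{M}$-functor is a functor preserving the chosen monics and pullbacks of chosen monics. For a split restriction category $\mathbf{Y}$, $\mathcal{M}\mathsf{Total}(\mathbf{Y})$ is the $\mathcal{M}$-category $\mathsf{Total}(\mathbf{Y})$ whose chosen monics are the restriction monics of $\mathbf{Y}$. For an $\mathcal{M}$-category $\mathbf{C}$, $\mathsf{Par}(\mathbf{C})$ is the split restriction category with the objects of $\mathbf{C}$, whose morphisms $X\to Y$ are isomorphism classes $(m,f)$ of spans $X\xleftarrow{m}Z\xrightarrow{f}Y$ with $m\in\mathcal{M}_{\mathbf{C}}$; composition is by pullback, identities are $(1,1)$, and $\overline{(m,f)}=(m,m)$. For an $\mathcal{M}$-functor $F$, $\mathsf{Par}(F)$ sends $A\mapsto FA$ and $(m,f)\mapsto(Fm,Ff)$. For a split restriction category $\mathbf{Y}$, $\Phi\colon\mathbf{Y}\to\mathsf{Par}(\mathcal{M}\mathsf{Total}(\mathbf{Y}))$ is the isomorphism with $\Phi(A)=A$ and $\Phi(f)=(m,fm)$, where $\bar f=mr$, $rm=1$; above, $\Phi$ is taken for $\mathbf{Y}=\mathsf{K}_r(\mathbf{X})$. $\mathsf{PSh}_{\mathcal{M}}(\mathbf{C})$ is the $\mathcal{M}$-category of presheaves $\mathsf{PSh}(\mathbf{C})=[\mathbf{C}^{\mathrm{op}},\mathbf{Set}]$, with $\mu\colon P\Rightarrow Q$ a chosen monic iff for every $\gamma\colon\mathbf{y}D\Rightarrow Q$ there is $m\colon C\to D$ in $\mathcal{M}_{\mathbf{C}}$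 such that $\mathbf{y}m$ is a pullback of $\mu$ along $\gamma$; $\mathbf{y}$ is the Yoneda embedding, an $\mathcal{M}$-functor $\mathbf{C}\to\mathsf{PSh}_{\mathcal{M}}(\mathbf{C})$. For a presheaf $P$, $x\in PA$ and $g\colon B\to A$, write $x\cdot g=P(g)(x)$. A restriction presheaf on $\mathbf{X}$ is a presheaf $P\colon\mathbf{X}^{\mathrm{op}}\to\mathbf{Set}$ with assignments $PA\to\mathbf{X}(A,A)$, $x\mapsto\bar x$, where $\bar x$ is a restriction idempotent and: (A1) $x\cdot\bar x=x$; (A2) $\overline{x\cdot\bar f}=\bar x\circ\bar f$ for every restriction idempotent $\bar f\colon A\to A$; (A3) $\bar x\circ g=g\circ\overline{x\cdot g}$ for every $g\colon B\to A$. $\mathsf{PSh}_r(\mathbf{X})$ is the restriction category of restriction presheaves and arbitrary natural transformations, where the restriction of $\alpha\colon P\Rightarrow Q$ is $\bar\alpha\colon P\Rightarrow P$, $\bar\alpha_A(x)=x\cdot\overline{\alpha_A(x)}$. Each representable $\mathbf{X}(-,A)$ is a restriction presheaf via $f\mapsto\bar f$, so the Yoneda embedding factors through a restriction functor $\mathbf{y}_r\colon\mathbf{X}\to\mathsf{PSh}_r(\mathbf{X})$. *)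

theory Defs
  imports "HOL-Library.FuncSet" "HOL-Library.Equipollence"
begin

section \<open>The ambient universe of sets\<close>

text \<open>
  ``Set'' is the category of small subsets of a type \<open>'u\<close>, for a notion of smallness with the
  closure properties below. The small sets of any Grothendieck universe satisfy them (see
  \<open>set_universeI_powers\<close>); so do all the subsets of any infinite type, and its finite subsets.
  Replacement is a consequence of pairing and union.
\<close>

locale set_universe =
  fixes small :: "'u set \<Rightarrow> bool"
  assumes small_subset: "small A \<Longrightarrow> B \<subseteq> A \<Longrightarrow> small B"
    and small_pair: "small {x, y}"
    and small_Union: "small I \<Longrightarrow> (\<And>i. i \<in> I \<Longrightarrow> small (F i)) \<Longrightarrow> small (\<Union>i\<in>I. F i)"
    and small_product: "small A \<Longrightarrow> small B \<Longrightarrow> \<exists>P. small P \<and> P \<approx> A \<times> B"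

lemma small_copy_if_lepoll:
  assumes "\<And>A B :: 'u set. small A \<Longrightarrow> B \<subseteq> A \<Longrightarrow> small B" and "small Q" and "S \<lesssim> Q"
  shows "\<exists>P. small P \<and> P \<approx> S"
proof -
  from \<open>S \<lesssim> Q\<close> obtain f where "inj_on f S" "f ` S \<subseteq> Q" unfolding lepoll_def by blast
  then have "S \<approx> f ` S" unfolding eqpoll_def bij_betw_def by blast
  with \<open>f ` S \<subseteq> Q\<close> assms(1)[OF \<open>small Q\<close>] show ?thesis using eqpoll_sym by blast
qed

lemma set_universeI_powers:
  fixes small :: "'u set \<Rightarrow> bool"
  assumes sub: "\<And>A B. small A \<Longrightarrow> B \<subseteq> A \<Longrightarrow> small B"
    and pair: "\<And>x y. small {x, y}"
    and un: "\<And>I F. small I \<Longrightarrow> (\<And>i. i \<in> I \<Longrightarrow> small (F i)) \<Longrightarrow> small (\<Union>i\<in>I. F i)"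
    and pow: "\<And>A. small A \<Longrightarrow> \<exists>P. small P \<and> P \<approx> Pow A"
  shows "set_universe small"
proof
  fix A B :: "'u set"
  assume A: "small A" and B: "small B"
  obtain T where T: "small T" "T \<approx> Pow {undefined :: 'u}"
    using pow[OF pair[of undefined undefined]] by auto
  from eqpoll_sym[OF T(2)] obtain h where h: "bij_betw h (Pow {undefined :: 'u}) T"
    unfolding eqpoll_def by blast
  define x y where "x = h {}" and "y = h {undefined}"
  have xy: "x \<noteq> y"
    using inj_on_eq_iff[OF bij_betw_imp_inj_on[OF h], of "{}" "{undefined}"]
    unfolding x_def y_def by simp
  have "small (\<Union>i\<in>{x, y}. if i = x then A else B)"
    by (rule un) (auto simp: A B pair)
  moreover have "(\<Union>i\<in>{x, y}. if i = x then A else B) = A \<union> B"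
    using xy by auto
  ultimately have "small (A \<union> B)" by simp
  then obtain P where P: "small P" "P \<approx> Pow (A \<union> B)" using pow by blast
  then obtain Q where Q: "small Q" "Q \<approx> Pow P" using pow by blast
  let ?pr = "\<lambda>(a, b). {{a}, {a, b}}"
  have "inj_on ?pr (A \<times> B)"
  proof (intro inj_onI, clarify)
    fix a b c d
    assume *: "{{a}, {a, b}} = {{c}, {c, d}}"
    from arg_cong[OF *, of Inter] have "a = c" by simp
    moreover from arg_cong[OF *, of Union] have "{a, b} = {c, d}" by auto
    ultimately show "a = c \<and> b = d" by (auto simp: doubleton_eq_iff)
  qed
  moreover have "?pr ` (A \<times> B) \<subseteq> Pow (Pow (A \<union> B))" by auto
  ultimately have "A \<times> B \<lesssim> Pow (Pow (A \<union> B))" unfolding lepoll_def by blast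
  also have "Pow (Pow (A \<union> B)) \<approx> Pow P"
    using eqpoll_sym[OF P(2)] unfolding eqpoll_def by (blast intro: bij_betw_Pow)
  also have "Pow P \<approx> Q" using Q(2) eqpoll_sym by blast
  finally show "\<exists>P. small P \<and> P \<approx> A \<times> B"
    by (rule small_copy_if_lepoll[where small = small, OF _ Q(1), rotated]) (fact sub)
qed (fact sub pair un)+

lemma set_universe_UNIV:
  assumes "infinite (UNIV :: 'u set)"
  shows "set_universe (\<lambda>_ :: 'u set. True)"
proof
  fix A B :: "'u set"
  have "A \<times> B \<lesssim> (UNIV :: 'u set) \<times> (UNIV :: 'u set)"
    by (rule subset_imp_lepoll) auto
  also have "(UNIV :: 'u set) \<times> (UNIV :: 'u set) \<approx> (UNIV :: 'u set)"
    using card_of_Times_same_infinite[OF assms] unfolding eqpoll_def card_of_ordIso .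
  finally show "\<exists>P :: 'u set. True \<and> P \<approx> A \<times> B"
    using small_copy_if_lepoll[of "\<lambda>_. True"] by blast
qed auto


section \<open>Categories, functors and natural transformations\<close>

text \<open>
  A category is presented by its class of objects and its family of hom-sets, which need not be
  disjoint. Composition is indexed by objects: for \<open>f : A \<rightarrow> B\<close> and \<open>g : B \<rightarrow> D\<close>, the composite
  ``g after f'' is \<open>Comp C A B D g f\<close>.
\<close>

record ('o, 'a) category =
  Ob :: "'o set"
  Hom :: "'o \<Rightarrow> 'o \<Rightarrow> 'a set"
  Id :: "'o \<Rightarrow> 'a"
  Comp :: "'o \<Rightarrow> 'o \<Rightarrow> 'o \<Rightarrow> 'a \<Rightarrow> 'a \<Rightarrow> 'a"

locale category =
  fixes C :: "('o, 'a, 'm) category_scheme"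
  assumes Id_in_Hom: "A \<in> Ob C \<Longrightarrow> Id C A \<in> Hom C A A"
    and Comp_in_Hom: "\<lbrakk>A \<in> Ob C; B \<in> Ob C; D \<in> Ob C; f \<in> Hom C A B; g \<in> Hom C B D\<rbrakk>
      \<Longrightarrow> Comp C A B D g f \<in> Hom C A D"
    and Comp_Id_right: "\<lbrakk>A \<in> Ob C; B \<in> Ob C; f \<in> Hom C A B\<rbrakk> \<Longrightarrow> Comp C A A B f (Id C A) = f"
    and Comp_Id_left: "\<lbrakk>A \<in> Ob C; B \<in> Ob C; f \<in> Hom C A B\<rbrakk> \<Longrightarrow> Comp C A B B (Id C B) f = f"
    and Comp_assoc: "\<lbrakk>A \<in> Ob C; B \<in> Ob C; D \<in> Ob C; E \<in> Ob C;
        f \<in> Hom C A B; g \<in> Hom C B D; h \<in> Hom C D E\<rbrakk>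
      \<Longrightarrow> Comp C A D E h (Comp C A B D g f) = Comp C A B E (Comp C B D E h g) f"

text \<open>The hom-sets are themselves sets of the universe, as in \<open>X(A, B) \<in> Set\<close>.\<close>

definition locally_small :: "('u set \<Rightarrow> bool) \<Rightarrow> ('o, 'u, 'm) category_scheme \<Rightarrow> bool" where
  "locally_small small C \<longleftrightarrow> (\<forall>A\<in>Ob C. \<forall>B\<in>Ob C. small (Hom C A B))"

definition is_iso :: "('o, 'a, 'm) category_scheme \<Rightarrow> 'o \<Rightarrow> 'o \<Rightarrow> 'a \<Rightarrow> bool" where
  "is_iso C A B f \<longleftrightarrow> f \<in> Hom C A B \<and>
    (\<exists>g\<in>Hom C B A. Comp C A B A g f = Id C A \<and> Comp C B A B f g = Id C B)"

text \<open>\<open>p : P \<rightarrow> A\<close> and \<open>q : P \<rightarrow> B\<close> form a pullback of \<open>f : A \<rightarrow> D\<close> and \<open>g : B \<rightarrow> D\<close>.\<close>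

definition is_pullback ::
  "('o, 'a, 'm) category_scheme \<Rightarrow> 'o \<Rightarrow> 'o \<Rightarrow> 'o \<Rightarrow> 'a \<Rightarrow> 'a \<Rightarrow> 'o \<Rightarrow> 'a \<Rightarrow> 'a \<Rightarrow> bool" where
  "is_pullback C A B D f g P p q \<longleftrightarrow>
    A \<in> Ob C \<and> B \<in> Ob C \<and> D \<in> Ob C \<and> P \<in> Ob C \<and>
    f \<in> Hom C A D \<and> g \<in> Hom C B D \<and> p \<in> Hom C P A \<and> q \<in> Hom C P B \<and>
    Comp C P A D f p = Comp C P B D g q \<and>
    (\<forall>Q\<in>Ob C. \<forall>a\<in>Hom C Q A. \<forall>b\<in>Hom C Q B. Comp C Q A D f a = Comp C Q B D g b \<longrightarrow>
      (\<exists>!u. u \<in> Hom C Q P \<and> Comp C Q P A p u = a \<and> Comp C Q P B q u = b))"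

definition op_category :: "('o, 'a, 'm) category_scheme \<Rightarrow> ('o, 'a) category" where
  "op_category C = \<lparr>Ob = Ob C, Hom = (\<lambda>A B. Hom C B A), Id = Id C,
    Comp = (\<lambda>A B D g f. Comp C D B A f g)\<rparr>"

definition Set_category :: "('u set \<Rightarrow> bool) \<Rightarrow> ('u set, 'u \<Rightarrow> 'u) category" where
  "Set_category small = \<lparr>Ob = {A. small A}, Hom = (\<lambda>A B. A \<rightarrow>\<^sub>E B), Id = (\<lambda>A. \<lambda>x\<in>A. x),
    Comp = (\<lambda>A B D g f. compose A g f)\<rparr>"

record ('o, 'a, 'p, 'b) func =
  FOb :: "'o \<Rightarrow> 'p"
  FMap :: "'o \<Rightarrow> 'o \<Rightarrow> 'a \<Rightarrow> 'b"

locale is_functor = C: category C + D: category D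
  for C :: "('o, 'a, 'm) category_scheme" and D :: "('p, 'b, 'n) category_scheme" +
  fixes F :: "('o, 'a, 'p, 'b) func"
  assumes FOb_in_Ob: "A \<in> Ob C \<Longrightarrow> FOb F A \<in> Ob D"
    and FMap_in_Hom: "\<lbrakk>A \<in> Ob C; B \<in> Ob C; f \<in> Hom C A B\<rbrakk>
      \<Longrightarrow> FMap F A B f \<in> Hom D (FOb F A) (FOb F B)"
    and FMap_Id: "A \<in> Ob C \<Longrightarrow> FMap F A A (Id C A) = Id D (FOb F A)"
    and FMap_Comp: "\<lbrakk>A \<in> Ob C; B \<in> Ob C; E \<in> Ob C; f \<in> Hom C A B; g \<in> Hom C B E\<rbrakk>
      \<Longrightarrow> FMap F A E (Comp C A B E g f) =
          Comp D (FOb F A) (FOb F B) (FOb F E) (FMap F B E g) (FMap F A B f)"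

definition id_func :: "('o, 'a, 'o, 'a) func" where
  "id_func = \<lparr>FOb = (\<lambda>A. A), FMap = (\<lambda>A B f. f)\<rparr>"

definition comp_func ::
  "('p, 'b, 'q, 'c) func \<Rightarrow> ('o, 'a, 'p, 'b) func \<Rightarrow> ('o, 'a, 'q, 'c) func" (infixl "\<circ>\<^sub>F" 55) where
  "G \<circ>\<^sub>F F = \<lparr>FOb = (\<lambda>A. FOb G (FOb F A)),
    FMap = (\<lambda>A B f. FMap G (FOb F A) (FOb F B) (FMap F A B f))\<rparr>"

locale natural_transformation = F: is_functor C D F + G: is_functor C D G
  for C :: "('o, 'a, 'm) category_scheme" and D :: "('p, 'b, 'n) category_scheme" and F G +
  fixes \<alpha> :: "'o \<Rightarrow> 'b"
  assumes component_in_Hom: "A \<in> Ob C \<Longrightarrow> \<alpha> A \<in> Hom D (FOb F A) (FOb G A)"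
    and naturality: "\<lbrakk>A \<in> Ob C; B \<in> Ob C; f \<in> Hom C A B\<rbrakk>
      \<Longrightarrow> Comp D (FOb F A) (FOb F B) (FOb G B) (\<alpha> B) (FMap F A B f) =
          Comp D (FOb F A) (FOb G A) (FOb G B) (FMap G A B f) (\<alpha> A)"

text \<open>
  Functors and transformations that are objects or morphisms of a functor category are made
  extensional (\<open>undefined\<close> outside their domain), so that HOL equality is equality of functors
  and of transformations.
\<close>

definition extensional_func :: "('o, 'a, 'm) category_scheme \<Rightarrow> ('o, 'a, 'p, 'b) func \<Rightarrow> bool" where
  "extensional_func C F \<longleftrightarrow> (\<forall>A. A \<notin> Ob C \<longrightarrow> FOb F A = undefined) \<and>
    (\<forall>A B f. \<not> (A \<in> Ob C \<and> B \<in> Ob C \<and> f \<in> Hom C A B) \<longrightarrow> FMap F A B f = undefined)"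

definition functor_category ::
  "('o, 'a, 'm) category_scheme \<Rightarrow> ('p, 'b, 'n) category_scheme
    \<Rightarrow> (('o, 'a, 'p, 'b) func, 'o \<Rightarrow> 'b) category" where
  "functor_category C D = \<lparr>
    Ob = {F. is_functor C D F \<and> extensional_func C F},
    Hom = (\<lambda>F G. {\<alpha> \<in> extensional (Ob C). natural_transformation C D F G \<alpha>}),
    Id = (\<lambda>F. \<lambda>A\<in>Ob C. Id D (FOb F A)),
    Comp = (\<lambda>F G H \<beta> \<alpha>. \<lambda>A\<in>Ob C. Comp D (FOb F A) (FOb G A) (FOb H A) (\<beta> A) (\<alpha> A))\<rparr>"

type_synonym ('o, 'u) presheaf = "('o, 'u, 'u set, 'u \<Rightarrow> 'u) func"

definition PSh :: "('u set \<Rightarrow> bool) \<Rightarrow> ('o, 'u, 'm) category_scheme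
    \<Rightarrow> (('o, 'u) presheaf, 'o \<Rightarrow> 'u \<Rightarrow> 'u) category" where
  "PSh small C = functor_category (op_category C) (Set_category small)"

text \<open>\<open>act P B A x g\<close> is the element \<open>x \<cdot> g = P(g)(x)\<close> of \<open>P B\<close>, for \<open>x \<in> P A\<close> and \<open>g : B \<rightarrow> A\<close>.\<close>

abbreviation act :: "('o, 'u) presheaf \<Rightarrow> 'o \<Rightarrow> 'o \<Rightarrow> 'u \<Rightarrow> 'u \<Rightarrow> 'u" where
  "act P B A x g \<equiv> FMap P A B g x"

definition representable :: "('o, 'u, 'm) category_scheme \<Rightarrow> 'o \<Rightarrow> ('o, 'u) presheaf" where
  "representable C A = \<lparr>
    FOb = (\<lambda>B\<in>Ob C. Hom C B A),
    FMap = (\<lambda>B D g. if B \<in> Ob C \<and> D \<in> Ob C \<and> g \<in> Hom C D B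
              then (\<lambda>x\<in>Hom C B A. Comp C D B A x g) else undefined)\<rparr>"

definition yoneda ::
  "('o, 'u, 'm) category_scheme \<Rightarrow> ('o, 'u, ('o, 'u) presheaf, 'o \<Rightarrow> 'u \<Rightarrow> 'u) func" where
  "yoneda C = \<lparr>FOb = representable C,
    FMap = (\<lambda>A B f. \<lambda>D\<in>Ob C. \<lambda>x\<in>Hom C D A. Comp C D A B f x)\<rparr>"


section \<open>The 2-category of restriction categories\<close>

record ('o, 'a) rcategory = "('o, 'a) category" +
  Rst :: "'o \<Rightarrow> 'o \<Rightarrow> 'a \<Rightarrow> 'a"

locale restriction_category = category X for X :: "('o, 'a, 'm) rcategory_scheme" +
  assumes Rst_in_Hom: "\<lbrakk>A \<in> Ob X; B \<in> Ob X; f \<in> Hom X A B\<rbrakk> \<Longrightarrow> Rst X A B f \<in> Hom X A A"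
    and R1: "\<lbrakk>A \<in> Ob X; B \<in> Ob X; f \<in> Hom X A B\<rbrakk> \<Longrightarrow> Comp X A A B f (Rst X A B f) = f"
    and R2: "\<lbrakk>A \<in> Ob X; B \<in> Ob X; D \<in> Ob X; f \<in> Hom X A B; g \<in> Hom X A D\<rbrakk>
      \<Longrightarrow> Comp X A A A (Rst X A D g) (Rst X A B f) = Comp X A A A (Rst X A B f) (Rst X A D g)"
    and R3: "\<lbrakk>A \<in> Ob X; B \<in> Ob X; D \<in> Ob X; f \<in> Hom X A B; g \<in> Hom X A D\<rbrakk>
      \<Longrightarrow> Rst X A D (Comp X A A D g (Rst X A B f)) = Comp X A A A (Rst X A D g) (Rst X A B f)"
    and R4: "\<lbrakk>A \<in> Ob X; B \<in> Ob X; D \<in> Ob X; f \<in> Hom X A B; h \<in> Hom X B D\<rbrakk>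
      \<Longrightarrow> Comp X A B B (Rst X B D h) f = Comp X A A B f (Rst X A D (Comp X A B D h f))"

definition restriction_idempotent :: "('o, 'a, 'm) rcategory_scheme \<Rightarrow> 'o \<Rightarrow> 'a \<Rightarrow> bool" where
  "restriction_idempotent X A e \<longleftrightarrow> e \<in> Hom X A A \<and> Rst X A A e = e"

definition total_map :: "('o, 'a, 'm) rcategory_scheme \<Rightarrow> 'o \<Rightarrow> 'o \<Rightarrow> 'a \<Rightarrow> bool" where
  "total_map X A B f \<longleftrightarrow> f \<in> Hom X A B \<and> Rst X A B f = Id X A"

locale restriction_functor =
  X: restriction_category X + Y: restriction_category Y + is_functor X Y F
  for X :: "('o, 'a, 'm) rcategory_scheme" and Y :: "('p, 'b, 'n) rcategory_scheme" and F +
  assumes FMap_Rst: "\<lbrakk>A \<in> Ob X; B \<in> Ob X; f \<in> Hom X A B\<rbrakk>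
    \<Longrightarrow> FMap F A A (Rst X A B f) = Rst Y (FOb F A) (FOb F B) (FMap F A B f)"

locale restriction_transformation =
  F: restriction_functor X Y F + G: restriction_functor X Y G + natural_transformation X Y F G \<alpha>
  for X :: "('o, 'a, 'm) rcategory_scheme" and Y :: "('p, 'b, 'n) rcategory_scheme" and F G \<alpha> +
  assumes component_total: "A \<in> Ob X \<Longrightarrow> total_map Y (FOb F A) (FOb G A) (\<alpha> A)"

text \<open>There is an invertible 2-cell between the 1-cells \<open>F, G : X \<rightarrow> Y\<close>.\<close>

definition restriction_iso :: "('o, 'a, 'm) rcategory_scheme \<Rightarrow> ('p, 'b, 'n) rcategory_scheme
    \<Rightarrow> ('o, 'a, 'p, 'b) func \<Rightarrow> ('o, 'a, 'p, 'b) func \<Rightarrow> bool" where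
  "restriction_iso X Y F G \<longleftrightarrow> (\<exists>\<alpha> \<beta>.
    restriction_transformation X Y F G \<alpha> \<and> restriction_transformation X Y G F \<beta> \<and>
    (\<forall>A\<in>Ob X. Comp Y (FOb F A) (FOb G A) (FOb F A) (\<beta> A) (\<alpha> A) = Id Y (FOb F A) \<and>
              Comp Y (FOb G A) (FOb F A) (FOb G A) (\<alpha> A) (\<beta> A) = Id Y (FOb G A)))"

definition restriction_equivalence :: "('o, 'a, 'm) rcategory_scheme
    \<Rightarrow> ('p, 'b, 'n) rcategory_scheme \<Rightarrow> ('o, 'a, 'p, 'b) func \<Rightarrow> bool" where
  "restriction_equivalence X Y F \<longleftrightarrow> restriction_functor X Y F \<and>
    (\<exists>G. restriction_functor Y X G \<and>
         restriction_iso X X id_func (G \<circ>\<^sub>F F) \<and> restriction_iso Y Y (F \<circ>\<^sub>F G) id_func)"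

definition restriction_equivalent ::
  "('o, 'a, 'm) rcategory_scheme \<Rightarrow> ('p, 'b, 'n) rcategory_scheme \<Rightarrow> bool" where
  "restriction_equivalent X Y \<longleftrightarrow> (\<exists>F. restriction_equivalence X Y F)"

definition K\<^sub>r :: "('o, 'a, 'm) rcategory_scheme \<Rightarrow> ('o \<times> 'a, 'a) rcategory" where
  "K\<^sub>r X = \<lparr>
    Ob = {(A, e). A \<in> Ob X \<and> restriction_idempotent X A e},
    Hom = (\<lambda>(A, e) (A', e'). {f \<in> Hom X A A'. Comp X A A' A' e' (Comp X A A A' f e) = f}),
    Id = (\<lambda>(A, e). e),
    Comp = (\<lambda>(A, _) (B, _) (D, _) g f. Comp X A B D g f),
    Rst = (\<lambda>(A, _) (B, _) f. Rst X A B f)\<rparr>"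

definition J_func :: "('o, 'a, 'm) rcategory_scheme \<Rightarrow> ('o, 'a, 'o \<times> 'a, 'a) func" where
  "J_func X = \<lparr>FOb = (\<lambda>A. (A, Id X A)), FMap = (\<lambda>A B f. f)\<rparr>"


section \<open>Partial maps\<close>

text \<open>\<open>Mon C A B\<close> is the set of chosen monics from \<open>A\<close> to \<open>B\<close>.\<close>

record ('o, 'a) mcategory = "('o, 'a) category" +
  Mon :: "'o \<Rightarrow> 'o \<Rightarrow> 'a set"

definition splitting ::
  "('o, 'a, 'm) rcategory_scheme \<Rightarrow> 'o \<Rightarrow> 'a \<Rightarrow> 'o \<Rightarrow> 'a \<Rightarrow> 'a \<Rightarrow> bool" where
  "splitting Y A e Z m r \<longleftrightarrow> Z \<in> Ob Y \<and> m \<in> Hom Y Z A \<and> r \<in> Hom Y A Z \<and>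
    Comp Y A Z A m r = e \<and> Comp Y Z A Z r m = Id Y Z"

definition restriction_monic :: "('o, 'a, 'm) rcategory_scheme \<Rightarrow> 'o \<Rightarrow> 'o \<Rightarrow> 'a \<Rightarrow> bool" where
  "restriction_monic Y Z A m \<longleftrightarrow> (\<exists>e r. restriction_idempotent Y A e \<and> splitting Y A e Z m r)"

definition MTotal :: "('o, 'a, 'm) rcategory_scheme \<Rightarrow> ('o, 'a) mcategory" where
  "MTotal Y = \<lparr>Ob = Ob Y, Hom = (\<lambda>A B. {f. total_map Y A B f}), Id = Id Y, Comp = Comp Y,
    Mon = (\<lambda>Z A. {m. restriction_monic Y Z A m})\<rparr>"

text \<open>A span from \<open>A\<close> to \<open>B\<close> with vertex \<open>Z\<close>, left leg \<open>m\<close> and right leg \<open>f\<close> is the triple \<open>(Z, m, f)\<close>.\<close>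

definition spans :: "('o, 'a, 'm) mcategory_scheme \<Rightarrow> 'o \<Rightarrow> 'o \<Rightarrow> ('o \<times> 'a \<times> 'a) set" where
  "spans C A B = {(Z, m, f). Z \<in> Ob C \<and> m \<in> Mon C Z A \<and> f \<in> Hom C Z B}"

definition span_iso :: "('o, 'a, 'm) mcategory_scheme \<Rightarrow> 'o \<Rightarrow> 'o
    \<Rightarrow> (('o \<times> 'a \<times> 'a) \<times> ('o \<times> 'a \<times> 'a)) set" where
  "span_iso C A B = {((Z, m, f), (Z', m', f')).
    (Z, m, f) \<in> spans C A B \<and> (Z', m', f') \<in> spans C A B \<and>
    (\<exists>\<phi>. is_iso C Z Z' \<phi> \<and> Comp C Z Z' A m' \<phi> = m \<and> Comp C Z Z' B f' \<phi> = f)}"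

definition Par :: "('o, 'a, 'm) mcategory_scheme \<Rightarrow> ('o, ('o \<times> 'a \<times> 'a) set) rcategory" where
  "Par C = \<lparr>
    Ob = Ob C,
    Hom = (\<lambda>A B. spans C A B // span_iso C A B),
    Id = (\<lambda>A. span_iso C A A `` {(A, Id C A, Id C A)}),
    Comp = (\<lambda>A B D T S. span_iso C A D ``
      {(P, Comp C P Z A m p, Comp C P W D g q) | Z m f W n g P p q.
        (Z, m, f) \<in> S \<and> (W, n, g) \<in> T \<and> is_pullback C Z W B f n P p q}),
    Rst = (\<lambda>A B S. span_iso C A A `` {(Z, m, m) | Z m f. (Z, m, f) \<in> S})\<rparr>"

text \<open>For an M-functor \<open>F\<close> with codomain \<open>D\<close>.\<close>

definition Par_func :: "('p, 'b, 'm) mcategory_scheme \<Rightarrow> ('o, 'a, 'p, 'b) func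
    \<Rightarrow> ('o, ('o \<times> 'a \<times> 'a) set, 'p, ('p \<times> 'b \<times> 'b) set) func" where
  "Par_func D F = \<lparr>FOb = FOb F,
    FMap = (\<lambda>A B S. span_iso D (FOb F A) (FOb F B) ``
      {(FOb F Z, FMap F Z A m, FMap F Z B f) | Z m f. (Z, m, f) \<in> S})\<rparr>"

text \<open>The class of the span does not depend on the splitting that is chosen.\<close>

definition Phi_func :: "('o, 'a, 'm) rcategory_scheme
    \<Rightarrow> ('o, 'a, 'o, ('o \<times> 'a \<times> 'a) set) func" where
  "Phi_func Y = \<lparr>FOb = (\<lambda>A. A),
    FMap = (\<lambda>A B f. let (Z, m, r) = (SOME (Z, m, r). splitting Y A (Rst Y A B f) Z m r)
      in span_iso (MTotal Y) A B `` {(Z, m, Comp Y Z A B f m)})\<rparr>"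

definition PSh\<^sub>M :: "('u set \<Rightarrow> bool) \<Rightarrow> ('o, 'u, 'm) mcategory_scheme
    \<Rightarrow> (('o, 'u) presheaf, 'o \<Rightarrow> 'u \<Rightarrow> 'u) mcategory" where
  "PSh\<^sub>M small C = category.extend (PSh small C) \<lparr>Mon = (\<lambda>P Q. {\<mu> \<in> Hom (PSh small C) P Q.
    \<forall>D\<in>Ob C. \<forall>\<gamma>\<in>Hom (PSh small C) (representable C D) Q.
      \<exists>B\<in>Ob C. \<exists>m\<in>Mon C B D. \<exists>\<delta>. is_pullback (PSh small C) (representable C D) P Q \<gamma> \<mu>
        (representable C B) (FMap (yoneda C) B D m) \<delta>})\<rparr>"

definition Lambda :: "('u set \<Rightarrow> bool) \<Rightarrow> ('o, 'u, 'm) rcategory_scheme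
    \<Rightarrow> ('o, 'u, ('o \<times> 'u, 'u) presheaf,
        (('o \<times> 'u, 'u) presheaf \<times> ('o \<times> 'u \<Rightarrow> 'u \<Rightarrow> 'u) \<times> ('o \<times> 'u \<Rightarrow> 'u \<Rightarrow> 'u)) set) func" where
  "Lambda small X =
    Par_func (PSh\<^sub>M small (MTotal (K\<^sub>r X))) (yoneda (MTotal (K\<^sub>r X))) \<circ>\<^sub>F Phi_func (K\<^sub>r X) \<circ>\<^sub>F J_func X"


section \<open>Restriction presheaves\<close>

text \<open>A restriction presheaf is a presheaf \<open>P\<close> with an assignment \<open>\<rho>\<close> of \<open>\<rho> A x\<close> to \<open>x \<in> P A\<close>.\<close>

type_synonym ('o, 'u) rpresheaf = "('o, 'u) presheaf \<times> ('o \<Rightarrow> 'u \<Rightarrow> 'u)"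

definition restriction_presheaf ::
  "('u set \<Rightarrow> bool) \<Rightarrow> ('o, 'u, 'm) rcategory_scheme \<Rightarrow> ('o, 'u) rpresheaf \<Rightarrow> bool" where
  "restriction_presheaf small X = (\<lambda>(P, \<rho>).
    P \<in> Ob (PSh small X) \<and> \<rho> \<in> (\<Pi>\<^sub>E A\<in>Ob X. FOb P A \<rightarrow>\<^sub>E Hom X A A) \<and>
    (\<forall>A\<in>Ob X. \<forall>x\<in>FOb P A. restriction_idempotent X A (\<rho> A x)) \<and>
    (\<forall>A\<in>Ob X. \<forall>x\<in>FOb P A. act P A A x (\<rho> A x) = x) \<and>
    (\<forall>A\<in>Ob X. \<forall>x\<in>FOb P A. \<forall>e. restriction_idempotent X A e \<longrightarrow>
      \<rho> A (act P A A x e) = Comp X A A A (\<rho> A x) e) \<and>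
    (\<forall>A\<in>Ob X. \<forall>B\<in>Ob X. \<forall>x\<in>FOb P A. \<forall>g\<in>Hom X B A.
      Comp X B A A (\<rho> A x) g = Comp X B B A g (\<rho> B (act P B A x g))))"

definition PSh\<^sub>r :: "('u set \<Rightarrow> bool) \<Rightarrow> ('o, 'u, 'm) rcategory_scheme
    \<Rightarrow> (('o, 'u) rpresheaf, 'o \<Rightarrow> 'u \<Rightarrow> 'u) rcategory" where
  "PSh\<^sub>r small X = \<lparr>
    Ob = {P. restriction_presheaf small X P},
    Hom = (\<lambda>P Q. Hom (PSh small X) (fst P) (fst Q)),
    Id = (\<lambda>P. Id (PSh small X) (fst P)),
    Comp = (\<lambda>P Q R. Comp (PSh small X) (fst P) (fst Q) (fst R)),
    Rst = (\<lambda>P Q \<alpha>. \<lambda>A\<in>Ob X. \<lambda>x\<in>FOb (fst P) A. act (fst P) A A x (snd Q A (\<alpha> A x)))\<rparr>"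

definition yoneda\<^sub>r ::
  "('o, 'u, 'm) rcategory_scheme \<Rightarrow> ('o, 'u, ('o, 'u) rpresheaf, 'o \<Rightarrow> 'u \<Rightarrow> 'u) func" where
  "yoneda\<^sub>r X = \<lparr>
    FOb = (\<lambda>A. (representable X A, \<lambda>B\<in>Ob X. \<lambda>f\<in>Hom X B A. Rst X B A f)),
    FMap = FMap (yoneda X)\<rparr>"

end

theory Submission
  imports Defs
begin

text \<open>
  Write \<open>\<T>\<close> for the category of total maps between the restriction idempotents of \<open>X\<close>. Its objects
  are the pairs \<open>(A, e)\<close>, and a map from \<open>(B, d)\<close> to \<open>(A, e)\<close> is a map \<open>g\<close> of \<open>X\<close> with restriction \<open>d\<close>
  and with \<open>e g = g\<close>. Presheaves on \<open>\<T>\<close> and restriction presheaves on \<open>X\<close> are two ways to organise the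
  same data. The elements of a restriction presheaf have domains, and collecting those over \<open>A\<close> with
  domain \<open>e\<close> gives a presheaf on \<open>\<T>\<close> (\<open>fibres\<close>). Conversely a presheaf \<open>P\<close> on \<open>\<T>\<close> has partial elements
  over \<open>A\<close>, namely the pairs of an idempotent \<open>e\<close> on \<open>A\<close> and an element \<open>x\<close> of \<open>P (A, e)\<close>. They form a
  restriction presheaf \<open>\<E> P\<close> in which the restriction of \<open>(e, x)\<close> is \<open>e\<close> (\<open>partial_elements\<close>). The
  functor \<open>\<E>\<close> is the equivalence of the theorem.

  What makes \<open>\<E>\<close> act on partial maps is the shape of the chosen monics. Pullbacks of presheaves are
  computed pointwise, and the restriction monics into \<open>(A, e)\<close> are, up to isomorphism, the idempotents
  \<open>e'\<close> below \<open>e\<close>. Hence a transformation is a chosen monic if and only if it is injective and, for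
  every element \<open>x\<close> of its target at \<open>(A, e)\<close>, some \<open>e'\<close> below \<open>e\<close> classifies the maps along which \<open>x\<close>
  falls into the image (\<open>Mon_PM_iff\<close>); in particular \<open>e'\<close> is the largest restriction of \<open>x\<close> that lies in
  the image. A partial map from \<open>P\<close> to \<open>Q\<close> thus sends a partial element \<open>(e, x)\<close> to \<open>(e', y)\<close>, where \<open>y\<close>
  is its value at the restriction of \<open>x\<close> to \<open>e'\<close>.

  Isomorphism classes of spans with injective left leg are the same as their graphs
  (\<open>span_iso_iff_graph\<close>), and the graph can be read off from the action on partial elements: \<open>x\<close> is
  related to \<open>y\<close> when \<open>(e, x)\<close> is sent to \<open>(e, y)\<close>. This gives faithfulness. For fullness, a natural
  transformation from \<open>\<E> P\<close> to \<open>\<E> Q\<close> comes from a span whose vertex consists of the elements \<open>x\<close> for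
  which it keeps the domain of \<open>(e, x)\<close> (\<open>on_partial_elements_full\<close>).

  The axioms of a restriction category are never checked for spans. Since \<open>\<E>\<close> is bijective on hom-sets
  and respects the operations, these axioms are inherited from restriction presheaves
  (\<open>restriction_transport\<close>), and a pseudo-inverse exists because \<open>\<E>\<close> is essentially surjective. In
  the same spirit, the composite of \<open>\<E>\<close> with the Cockett--Lack embedding is computed on a map \<open>f\<close> as
  the conjugate of the Yoneda embedding at \<open>f\<close> by the isomorphisms that send \<open>g\<close> to the pair of its
  restriction and itself (\<open>on_partial_elements_Lambda\<close>). This makes the composite a restriction functor
  that is isomorphic to the Yoneda embedding (\<open>restriction_functor_conjugate\<close>).
\<close>

section \<open>Restriction categories\<close>

context category
begin

lemmas hom_intros [simp] = Id_in_Hom Comp_in_Hom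
lemmas id_rules [simp] = Comp_Id_left Comp_Id_right

end

context restriction_category
begin

declare Rst_in_Hom [simp]
declare R1 [simp]

lemma Rst_Id [simp]: "A \<in> Ob X \<Longrightarrow> Rst X A A (Id X A) = Id X A"
  using R1[of A A "Id X A"] Comp_Id_left[of A A "Rst X A A (Id X A)"] by simp

lemma Rst_Rst [simp]:
  "\<lbrakk>A \<in> Ob X; B \<in> Ob X; f \<in> Hom X A B\<rbrakk> \<Longrightarrow> Rst X A A (Rst X A B f) = Rst X A B f"
  using R3[of A B A f "Id X A"] by simp

lemma restriction_idempotent_Rst:
  "\<lbrakk>A \<in> Ob X; B \<in> Ob X; f \<in> Hom X A B\<rbrakk> \<Longrightarrow> restriction_idempotent X A (Rst X A B f)"
  by (simp add: restriction_idempotent_def)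

lemma Rst_Comp_Rst:
  assumes "A \<in> Ob X" "B \<in> Ob X" "D \<in> Ob X" "f \<in> Hom X A B" "h \<in> Hom X B D"
  shows "Comp X A A A (Rst X A D (Comp X A B D h f)) (Rst X A B f) = Rst X A D (Comp X A B D h f)"
  using R3[of A B D f "Comp X A B D h f"] assms Comp_assoc[of A A B D "Rst X A B f" f h] by simp

lemma Rst_Rst_Comp:
  assumes "A \<in> Ob X" "B \<in> Ob X" "D \<in> Ob X" "f \<in> Hom X A B" "h \<in> Hom X B D"
  shows "Rst X A B (Comp X A B B (Rst X B D h) f) = Rst X A D (Comp X A B D h f)"
  using R4[of A B D f h] R3[of A D B "Comp X A B D h f" f] R2[of A B D f "Comp X A B D h f"]
    Rst_Comp_Rst[OF assms] assms by simp

lemma Rst_Comp_total: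
  assumes "A \<in> Ob X" "B \<in> Ob X" "D \<in> Ob X" "f \<in> Hom X A B" "total_map X B D h"
  shows "Rst X A D (Comp X A B D h f) = Rst X A B f"
  using Rst_Rst_Comp[of A B D f h] assms by (simp add: total_map_def)

lemma section_total:
  assumes "A \<in> Ob X" "B \<in> Ob X" "f \<in> Hom X A B" "g \<in> Hom X B A"
    and "Comp X A B A g f = Id X A"
  shows "total_map X A B f"
  using Rst_Comp_Rst[of A B A f g] assms by (simp add: total_map_def)

lemma restriction_idempotentD [simp]:
  assumes "restriction_idempotent X A e"
  shows "e \<in> Hom X A A" "Rst X A A e = e"
  using assms by (auto simp: restriction_idempotent_def)

lemma restriction_idempotent_idem [simp]:
  "\<lbrakk>A \<in> Ob X; restriction_idempotent X A e\<rbrakk> \<Longrightarrow> Comp X A A A e e = e"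
  using R1[of A A e] by simp

lemma restriction_idempotent_commute:
  "\<lbrakk>A \<in> Ob X; restriction_idempotent X A e; restriction_idempotent X A d\<rbrakk>
    \<Longrightarrow> Comp X A A A e d = Comp X A A A d e"
  using R2[of A A A d e] by simp

lemma restriction_idempotent_Comp:
  "\<lbrakk>A \<in> Ob X; restriction_idempotent X A e; restriction_idempotent X A d\<rbrakk>
    \<Longrightarrow> restriction_idempotent X A (Comp X A A A e d)"
  using R3[of A A A d e] restriction_idempotent_Rst[of A A "Comp X A A A e d"] by simp

lemma Rst_Comp_idempotent:
  "\<lbrakk>A \<in> Ob X; B \<in> Ob X; f \<in> Hom X A B; restriction_idempotent X A e\<rbrakk>
    \<Longrightarrow> Rst X A B (Comp X A A B f e) = Comp X A A A (Rst X A B f) e"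
  using R3[of A A B e f] by simp

lemma idempotent_Comp:
  "\<lbrakk>A \<in> Ob X; B \<in> Ob X; f \<in> Hom X A B; restriction_idempotent X B e\<rbrakk>
    \<Longrightarrow> Comp X A B B e f = Comp X A A B f (Rst X A B (Comp X A B B e f))"
  using R4[of A B B f e] by simp

lemma restriction_idempotent_Id: "A \<in> Ob X \<Longrightarrow> restriction_idempotent X A (Id X A)"
  using restriction_idempotent_Rst[of A A "Id X A"] by simp

text \<open>
  By (R4) the composite \<open>e g\<close> is the restriction of \<open>g\<close> to the domain of \<open>e g\<close>.
\<close>

lemma idempotent_Comp_eq_iff:
  assumes "A \<in> Ob X" "B \<in> Ob X" "g \<in> Hom X A B" "restriction_idempotent X B e"
  shows "Comp X A B B e g = g \<longleftrightarrow> Rst X A B (Comp X A B B e g) = Rst X A B g"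
  using idempotent_Comp[OF assms] assms by (metis R1)

lemma restriction_idempotentI: "e \<in> Hom X A A \<Longrightarrow> Rst X A A e = e \<Longrightarrow> restriction_idempotent X A e"
  unfolding restriction_idempotent_def by simp

lemma idempotent_absorb:
  assumes "A \<in> Ob X" "restriction_idempotent X A e" "restriction_idempotent X A d"
  shows "Comp X A A A e (Comp X A A A d e) = Comp X A A A d e"
proof -
  have "Comp X A A A e (Comp X A A A d e) = Comp X A A A (Comp X A A A d e) e"
    using assms Comp_assoc[of A A A A e d e] restriction_idempotent_commute[of A e d] by simp
  also have "\<dots> = Comp X A A A d (Comp X A A A e e)"
    using assms by (intro Comp_assoc[symmetric]) simp_all
  finally show ?thesis using assms by simp
qed

text \<open>
  Both equations say that the domain of \<open>k\<close> is contained in the domain of \<open>e h k\<close>. This is how a domain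
  of definition is pulled back along a map.
\<close>

lemma idempotent_fixes_Comp_iff:
  assumes "A \<in> Ob X" "B \<in> Ob X" "D \<in> Ob X" "restriction_idempotent X A e" "h \<in> Hom X B A" "k \<in> Hom X D B"
    and "Comp X D B B (Rst X B A h) k = k"
  shows "Comp X D A A e (Comp X D B A h k) = Comp X D B A h k
    \<longleftrightarrow> Comp X D B B (Rst X B A (Comp X B A A e h)) k = k"
proof -
  let ?d = "Rst X B A (Comp X B A A e h)"
  have d: "restriction_idempotent X B ?d" using assms by (simp add: restriction_idempotent_Rst)
  have "Rst X D A (Comp X D B A h k) = Rst X D B k"
    using Rst_Rst_Comp[of D B A k h] assms by simp
  moreover have "Rst X D A (Comp X D A A e (Comp X D B A h k)) = Rst X D B (Comp X D B B ?d k)"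
    using Rst_Rst_Comp[of D B A k "Comp X B A A e h"] assms by (simp add: Comp_assoc)
  ultimately show ?thesis
    using idempotent_Comp_eq_iff[of D A "Comp X D B A h k" e] idempotent_Comp_eq_iff[of D B k ?d] assms d
    by simp
qed

lemma Rst_conjugate:
  assumes ob: "A \<in> Ob X" "B \<in> Ob X" "A' \<in> Ob X" "B' \<in> Ob X"
    and i: "i \<in> Hom X A' A" "j \<in> Hom X A A'" "Comp X A' A A' j i = Id X A'"
      "Comp X A A' A i j = Id X A"
    and t: "total_map X B B' t" and f: "f \<in> Hom X A B"
  shows "Rst X A' B' (Comp X A' B B' t (Comp X A' A B f i))
    = Comp X A' A A' j (Comp X A' A A (Rst X A B f) i)"
proof -
  have "Rst X A' B' (Comp X A' B B' t (Comp X A' A B f i)) = Rst X A' B (Comp X A' A B f i)"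
    using Rst_Comp_total[OF _ _ _ _ t] assms by simp
  moreover have "Comp X A' A A (Rst X A B f) i = Comp X A' A' A i (Rst X A' B (Comp X A' A B f i))"
    by (rule R4) (use assms in auto)
  ultimately show ?thesis
    using assms Comp_assoc[of A' A' A A' "Rst X A' B (Comp X A' A B f i)" i j] by simp
qed

lemma restriction_functor_id_func: "restriction_functor X X id_func"
  by unfold_locales (auto simp: id_func_def)

end

lemma restriction_iso_sym: "restriction_iso X Y F G \<Longrightarrow> restriction_iso X Y G F"
  unfolding restriction_iso_def by blast

section \<open>Transport along isomorphisms and along fully faithful functors\<close>

text \<open>
  A family of maps obtained from a restriction functor by conjugation with isomorphisms inherits all
  the axioms of a restriction functor. Nothing has to be known about \<open>F\<close> beyond its values, so that
  a composite of functors can be treated without studying its factors.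
\<close>

lemma restriction_functor_conjugate:
  fixes X :: "('o, 'a, 'm) rcategory_scheme" and Y :: "('p, 'b, 'n) rcategory_scheme"
  assumes H: "restriction_functor X Y H"
    and ob: "\<And>A. A \<in> Ob X \<Longrightarrow> FOb F A \<in> Ob Y"
    and i: "\<And>A. A \<in> Ob X \<Longrightarrow> i A \<in> Hom Y (FOb F A) (FOb H A)"
    and j: "\<And>A. A \<in> Ob X \<Longrightarrow> j A \<in> Hom Y (FOb H A) (FOb F A)"
    and ji: "\<And>A. A \<in> Ob X \<Longrightarrow> Comp Y (FOb F A) (FOb H A) (FOb F A) (j A) (i A) = Id Y (FOb F A)"
    and ij: "\<And>A. A \<in> Ob X \<Longrightarrow> Comp Y (FOb H A) (FOb F A) (FOb H A) (i A) (j A) = Id Y (FOb H A)"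
    and F: "\<And>A B f. \<lbrakk>A \<in> Ob X; B \<in> Ob X; f \<in> Hom X A B\<rbrakk> \<Longrightarrow> FMap F A B f =
      Comp Y (FOb F A) (FOb H B) (FOb F B) (j B)
        (Comp Y (FOb F A) (FOb H A) (FOb H B) (FMap H A B f) (i A))"
  shows "restriction_functor X Y F \<and> restriction_iso X Y F H"
proof -
  interpret H: restriction_functor X Y H by (fact H)
  note [simp] = ob H.FOb_in_Ob H.FMap_in_Hom i j ji ij
  have total: "total_map Y (FOb F A) (FOb H A) (i A)" "total_map Y (FOb H A) (FOb F A) (j A)"
    if "A \<in> Ob X" for A
    using that H.Y.section_total[of "FOb F A" "FOb H A" "i A" "j A"]
      H.Y.section_total[of "FOb H A" "FOb F A" "j A" "i A"] by simp_all
  have nat_i: "Comp Y (FOb F A) (FOb F B) (FOb H B) (i B) (FMap F A B f) =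
      Comp Y (FOb F A) (FOb H A) (FOb H B) (FMap H A B f) (i A)"
    if "A \<in> Ob X" "B \<in> Ob X" "f \<in> Hom X A B" for A B f
    using that by (simp add: F H.Y.Comp_assoc)
  have nat_j: "Comp Y (FOb H A) (FOb H B) (FOb F B) (j B) (FMap H A B f) =
      Comp Y (FOb H A) (FOb F A) (FOb F B) (FMap F A B f) (j A)"
    if "A \<in> Ob X" "B \<in> Ob X" "f \<in> Hom X A B" for A B f
    using that by (simp add: F flip: H.Y.Comp_assoc)
  have FF: "restriction_functor X Y F"
  proof unfold_locales
    show "FMap F A B f \<in> Hom Y (FOb F A) (FOb F B)"
      if "A \<in> Ob X" "B \<in> Ob X" "f \<in> Hom X A B" for A B f
      using that by (simp add: F)
    show "FMap F A A (Id X A) = Id Y (FOb F A)" if "A \<in> Ob X" for A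
      using that by (simp add: F H.FMap_Id)
    show "FMap F A E (Comp X A B E g f) = Comp Y (FOb F A) (FOb F B) (FOb F E)
        (FMap F B E g) (FMap F A B f)"
      if "A \<in> Ob X" "B \<in> Ob X" "E \<in> Ob X" "f \<in> Hom X A B" "g \<in> Hom X B E" for A B E f g
    proof -
      have "Comp Y (FOb F A) (FOb F B) (FOb F E) (FMap F B E g) (FMap F A B f) =
        Comp Y (FOb F A) (FOb H E) (FOb F E) (j E) (Comp Y (FOb F A) (FOb H B) (FOb H E) (FMap H B E g)
          (Comp Y (FOb F A) (FOb F B) (FOb H B) (i B) (FMap F A B f)))"
        using that by (simp add: F[of B E g] F[of A B f] flip: H.Y.Comp_assoc)
      then show ?thesis
        using that by (simp add: nat_i) (simp add: F H.FMap_Comp H.Y.Comp_assoc)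
    qed
    show "FMap F A A (Rst X A B f) = Rst Y (FOb F A) (FOb F B) (FMap F A B f)"
      if "A \<in> Ob X" "B \<in> Ob X" "f \<in> Hom X A B" for A B f
      using that H.Y.Rst_conjugate[of "FOb H A" "FOb H B" "FOb F A" "FOb F B" "i A" "j A" "j B"] total
      by (simp add: F H.FMap_Rst)
  qed (use ob in auto)
  interpret F: restriction_functor X Y F by (fact FF)
  have "restriction_transformation X Y F H i"
    by unfold_locales (auto simp: nat_i total)
  moreover have "restriction_transformation X Y H F j"
    by unfold_locales (auto simp: nat_j total)
  ultimately have "restriction_iso X Y F H"
    unfolding restriction_iso_def by (intro exI[of _ i] exI[of _ j]) simp
  then show ?thesis using FF by blast
qed

text \<open>
  If \<open>E\<close> identifies the hom-sets of a structure \<open>Y\<close> with those of a restriction category and respects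
  the operations, then the equational axioms hold in \<open>Y\<close> because they hold after applying \<open>E\<close>. If \<open>E\<close>
  is moreover essentially surjective, a pseudo-inverse \<open>G\<close> is obtained by choosing an isomorphism
  \<open>B \<cong> E (G B)\<close> for each \<open>B\<close> and letting \<open>G f\<close> be the map that \<open>E\<close> sends to the conjugate of \<open>f\<close>.
\<close>

locale restriction_transport = Z: restriction_category Z
  for Y :: "('o, 'a, 'm) rcategory_scheme" and Z :: "('p, 'b, 'n) rcategory_scheme" +
  fixes E :: "('o, 'a, 'p, 'b) func"
  assumes E_Ob [simp]: "A \<in> Ob Y \<Longrightarrow> FOb E A \<in> Ob Z"
    and E_bij: "\<lbrakk>A \<in> Ob Y; B \<in> Ob Y\<rbrakk>
      \<Longrightarrow> bij_betw (FMap E A B) (Hom Y A B) (Hom Z (FOb E A) (FOb E B))"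
    and Id_closed [simp]: "A \<in> Ob Y \<Longrightarrow> Id Y A \<in> Hom Y A A"
    and Comp_closed [simp]: "\<lbrakk>A \<in> Ob Y; B \<in> Ob Y; D \<in> Ob Y; f \<in> Hom Y A B; g \<in> Hom Y B D\<rbrakk>
      \<Longrightarrow> Comp Y A B D g f \<in> Hom Y A D"
    and Rst_closed [simp]: "\<lbrakk>A \<in> Ob Y; B \<in> Ob Y; f \<in> Hom Y A B\<rbrakk> \<Longrightarrow> Rst Y A B f \<in> Hom Y A A"
    and E_Id [simp]: "A \<in> Ob Y \<Longrightarrow> FMap E A A (Id Y A) = Id Z (FOb E A)"
    and E_Comp [simp]: "\<lbrakk>A \<in> Ob Y; B \<in> Ob Y; D \<in> Ob Y; f \<in> Hom Y A B; g \<in> Hom Y B D\<rbrakk>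
      \<Longrightarrow> FMap E A D (Comp Y A B D g f) =
          Comp Z (FOb E A) (FOb E B) (FOb E D) (FMap E B D g) (FMap E A B f)"
    and E_Rst [simp]: "\<lbrakk>A \<in> Ob Y; B \<in> Ob Y; f \<in> Hom Y A B\<rbrakk>
      \<Longrightarrow> FMap E A A (Rst Y A B f) = Rst Z (FOb E A) (FOb E B) (FMap E A B f)"
    and E_eso: "W \<in> Ob Z \<Longrightarrow> \<exists>A\<in>Ob Y. \<exists>i\<in>Hom Z W (FOb E A). \<exists>j\<in>Hom Z (FOb E A) W.
      Comp Z W (FOb E A) W j i = Id Z W \<and> Comp Z (FOb E A) W (FOb E A) i j = Id Z (FOb E A)"
begin

lemma E_Hom [simp]:
  "\<lbrakk>A \<in> Ob Y; B \<in> Ob Y; f \<in> Hom Y A B\<rbrakk> \<Longrightarrow> FMap E A B f \<in> Hom Z (FOb E A) (FOb E B)"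
  using E_bij bij_betwE by blast

lemma E_faithful:
  "\<lbrakk>A \<in> Ob Y; B \<in> Ob Y; f \<in> Hom Y A B; g \<in> Hom Y A B; FMap E A B f = FMap E A B g\<rbrakk> \<Longrightarrow> f = g"
  using bij_betw_imp_inj_on[OF E_bij[of A B]] by (auto dest: inj_onD)

lemma restriction_category_domain: "restriction_category Y"
proof unfold_locales
  fix A B D f g
  assume *: "A \<in> Ob Y" "B \<in> Ob Y" "D \<in> Ob Y" "f \<in> Hom Y A B" "g \<in> Hom Y A D"
  show "Comp Y A A A (Rst Y A D g) (Rst Y A B f) = Comp Y A A A (Rst Y A B f) (Rst Y A D g)"
    by (rule E_faithful[of A A]) (use * in \<open>simp_all add: Z.R2\<close>)
  show "Rst Y A D (Comp Y A A D g (Rst Y A B f)) = Comp Y A A A (Rst Y A D g) (Rst Y A B f)"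
    by (rule E_faithful[of A A]) (use * in \<open>simp_all add: Z.R3\<close>)
next
  fix A B D f h
  assume *: "A \<in> Ob Y" "B \<in> Ob Y" "D \<in> Ob Y" "f \<in> Hom Y A B" "h \<in> Hom Y B D"
  show "Comp Y A B B (Rst Y B D h) f = Comp Y A A B f (Rst Y A D (Comp Y A B D h f))"
    by (rule E_faithful[of A B]) (use * in \<open>simp_all add: Z.R4\<close>)
next
  fix A B D W f g h
  assume *: "A \<in> Ob Y" "B \<in> Ob Y" "D \<in> Ob Y" "W \<in> Ob Y"
    "f \<in> Hom Y A B" "g \<in> Hom Y B D" "h \<in> Hom Y D W"
  show "Comp Y A D W h (Comp Y A B D g f) = Comp Y A B W (Comp Y B D W h g) f"
    by (rule E_faithful[of A W]) (use * in \<open>simp_all add: Z.Comp_assoc\<close>)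
next
  fix A B f
  assume *: "A \<in> Ob Y" "B \<in> Ob Y" "f \<in> Hom Y A B"
  show "Comp Y A A B f (Id Y A) = f" "Comp Y A B B (Id Y B) f = f"
      "Comp Y A A B f (Rst Y A B f) = f"
    by (rule E_faithful[of A B]; use * in simp)+
qed simp_all

lemma restriction_functor_E: "restriction_functor Y Z E"
proof -
  interpret Y: restriction_category Y by (fact restriction_category_domain)
  show ?thesis by unfold_locales auto
qed

lemma equivalence:
  "restriction_equivalence Y Z E \<and> (\<exists>G. restriction_equivalence Z Y G)"
proof -
  interpret Y: restriction_category Y by (fact restriction_category_domain)
  interpret E: restriction_functor Y Z E by (fact restriction_functor_E)
  obtain G0 i j where G0 [simp]: "\<And>B. B \<in> Ob Z \<Longrightarrow> G0 B \<in> Ob Y"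
    and i [simp]: "\<And>B. B \<in> Ob Z \<Longrightarrow> i B \<in> Hom Z B (FOb E (G0 B))"
    and j [simp]: "\<And>B. B \<in> Ob Z \<Longrightarrow> j B \<in> Hom Z (FOb E (G0 B)) B"
    and ji [simp]: "\<And>B. B \<in> Ob Z \<Longrightarrow> Comp Z B (FOb E (G0 B)) B (j B) (i B) = Id Z B"
    and ij [simp]: "\<And>B. B \<in> Ob Z \<Longrightarrow>
      Comp Z (FOb E (G0 B)) B (FOb E (G0 B)) (i B) (j B) = Id Z (FOb E (G0 B))"
    using E_eso by metis
  define lift where "lift A B = the_inv_into (Hom Y A B) (FMap E A B)" for A B
  have lift [simp]: "lift A B h \<in> Hom Y A B" "FMap E A B (lift A B h) = h"
    if "A \<in> Ob Y" "B \<in> Ob Y" "h \<in> Hom Z (FOb E A) (FOb E B)" for A B h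
    using E_bij[OF that(1,2)] that(3) unfolding lift_def bij_betw_def
    by (auto intro: the_inv_into_into f_the_inv_into_f)
  define G where "G = \<lparr>FOb = G0, FMap = (\<lambda>A B f. lift (G0 A) (G0 B)
    (Comp Z (FOb E (G0 A)) B (FOb E (G0 B)) (i B) (Comp Z (FOb E (G0 A)) A B f (j A))))\<rparr>"
  have EG: "restriction_functor Z Z (E \<circ>\<^sub>F G) \<and> restriction_iso Z Z (E \<circ>\<^sub>F G) id_func"
    by (rule restriction_functor_conjugate[OF Z.restriction_functor_id_func, where i = j and j = i])
      (simp_all add: comp_func_def G_def id_func_def)
  then interpret EG: restriction_functor Z Z "E \<circ>\<^sub>F G" by blast
  have G_Hom [simp]: "FMap G A B f \<in> Hom Y (FOb G A) (FOb G B)"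
    if "A \<in> Ob Z" "B \<in> Ob Z" "f \<in> Hom Z A B" for A B f
    using that by (simp add: G_def)
  have G_Ob [simp]: "FOb G A \<in> Ob Y" if "A \<in> Ob Z" for A
    using that by (simp add: G_def)
  have G: "restriction_functor Z Y G"
  proof unfold_locales
    show "FMap G A A (Id Z A) = Id Y (FOb G A)" if "A \<in> Ob Z" for A
      by (rule E_faithful[of "FOb G A" "FOb G A"])
        (use that EG.FMap_Id[of A] in \<open>simp_all add: comp_func_def\<close>)
    show "FMap G A D (Comp Z A B D g f) =
        Comp Y (FOb G A) (FOb G B) (FOb G D) (FMap G B D g) (FMap G A B f)"
      if "A \<in> Ob Z" "B \<in> Ob Z" "D \<in> Ob Z" "f \<in> Hom Z A B" "g \<in> Hom Z B D" for A B D f g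
      by (rule E_faithful[of "FOb G A" "FOb G D"])
        (use that EG.FMap_Comp[of A B D f g] in \<open>simp_all add: comp_func_def\<close>)
    show "FMap G A A (Rst Z A B f) = Rst Y (FOb G A) (FOb G B) (FMap G A B f)"
      if "A \<in> Ob Z" "B \<in> Ob Z" "f \<in> Hom Z A B" for A B f
      by (rule E_faithful[of "FOb G A" "FOb G A"])
        (use that EG.FMap_Rst[of A B f] in \<open>simp_all add: comp_func_def\<close>)
  qed simp_all
  have GE: "restriction_functor Y Y (G \<circ>\<^sub>F E) \<and> restriction_iso Y Y (G \<circ>\<^sub>F E) id_func"
  proof (rule restriction_functor_conjugate[OF Y.restriction_functor_id_func,
        where i = "\<lambda>A. lift (G0 (FOb E A)) A (j (FOb E A))"
          and j = "\<lambda>A. lift A (G0 (FOb E A)) (i (FOb E A))"])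
    fix A assume A: "A \<in> Ob Y"
    show "FOb (G \<circ>\<^sub>F E) A \<in> Ob Y" using A by (simp add: comp_func_def)
    show "lift (G0 (FOb E A)) A (j (FOb E A)) \<in> Hom Y (FOb (G \<circ>\<^sub>F E) A) (FOb id_func A)"
      "lift A (G0 (FOb E A)) (i (FOb E A)) \<in> Hom Y (FOb id_func A) (FOb (G \<circ>\<^sub>F E) A)"
      using A by (simp_all add: comp_func_def id_func_def G_def)
    show "Comp Y (FOb (G \<circ>\<^sub>F E) A) (FOb id_func A) (FOb (G \<circ>\<^sub>F E) A)
        (lift A (G0 (FOb E A)) (i (FOb E A))) (lift (G0 (FOb E A)) A (j (FOb E A)))
        = Id Y (FOb (G \<circ>\<^sub>F E) A)"
      by (rule E_faithful[of "FOb (G \<circ>\<^sub>F E) A" "FOb (G \<circ>\<^sub>F E) A"])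
          (use A in \<open>simp_all add: comp_func_def id_func_def G_def\<close>)
    show "Comp Y (FOb id_func A) (FOb (G \<circ>\<^sub>F E) A) (FOb id_func A)
        (lift (G0 (FOb E A)) A (j (FOb E A))) (lift A (G0 (FOb E A)) (i (FOb E A)))
        = Id Y (FOb id_func A)"
      by (rule E_faithful[of A A]) (use A in \<open>simp_all add: comp_func_def id_func_def G_def\<close>)
    fix B f assume B: "B \<in> Ob Y" and f: "f \<in> Hom Y A B"
    show "FMap (G \<circ>\<^sub>F E) A B f = Comp Y (FOb (G \<circ>\<^sub>F E) A) (FOb id_func B) (FOb (G \<circ>\<^sub>F E) B)
        (lift B (G0 (FOb E B)) (i (FOb E B)))
        (Comp Y (FOb (G \<circ>\<^sub>F E) A) (FOb id_func A) (FOb id_func B) (FMap id_func A B f)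
          (lift (G0 (FOb E A)) A (j (FOb E A))))"
      by (rule E_faithful[of "FOb (G \<circ>\<^sub>F E) A" "FOb (G \<circ>\<^sub>F E) B"])
          (use A B f in \<open>simp_all add: comp_func_def id_func_def G_def\<close>)
  qed
  have "restriction_equivalence Y Z E"
    unfolding restriction_equivalence_def
    using G restriction_functor_E EG restriction_iso_sym[of Y Y "G \<circ>\<^sub>F E" id_func] GE by auto
  moreover have "restriction_equivalence Z Y G"
    unfolding restriction_equivalence_def
    using G restriction_functor_E GE restriction_iso_sym[of Z Z "E \<circ>\<^sub>F G" id_func] EG by auto
  ultimately show ?thesis by blast
qed

end

section \<open>Small sets\<close>

context set_universe
begin

lemma small_image: "small A \<Longrightarrow> small (f ` A)"
  using small_Union[of A "\<lambda>x. {f x}"] small_pair[of "f x" "f x" for x]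
  by (simp add: UNION_singleton_eq_range)

end

text \<open>
  Disjoint unions of small sets are formed below by coding pairs of elements of the universe as
  single elements. For an infinite type the coding is cardinal arithmetic. If the type is finite and
  has two elements then it is itself a small set, and the code is the one that the closure under
  products provides; if it has one element then so has its square.
\<close>

lemma (in set_universe) ex_pairing: "\<exists>pr :: 'u \<times> 'u \<Rightarrow> 'u. inj pr"
proof (cases "finite (UNIV :: 'u set)")
  case True
  have "small (\<Union>i\<in>{x, y}. if i = x then A else {y})" if "small A" for A :: "'u set" and x y
    by (rule small_Union) (use small_pair[of y y] small_pair[of x y] that in auto)
  moreover have "(\<Union>i\<in>{x, y}. if i = x then A else {y}) = insert y A" if "x \<noteq> y" for A :: "'u set" and x y
    using that by auto
  ultimately have ins: "small (insert y A)" if "small A" "x \<noteq> y" for A :: "'u set" and x y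
    using that by metis
  show ?thesis
  proof (cases "\<exists>x y :: 'u. x \<noteq> y")
    case True
    then have "\<exists>x. x \<noteq> y" for y :: 'u by metis
    then have ins': "small (insert y A)" if "small A" for A :: "'u set" and y using ins that by blast
    have "small A" if "finite A" for A :: "'u set"
      using that
    proof induction
      case empty
      show ?case using small_subset[OF small_pair] by blast
    qed (use ins' in blast)
    then have "small (UNIV :: 'u set)" using \<open>finite UNIV\<close> by blast
    then obtain P :: "'u set" where "P \<approx> (UNIV :: 'u set) \<times> (UNIV :: 'u set)"
      using small_product by blast
    then obtain f :: "'u \<times> 'u \<Rightarrow> 'u" where "bij_betw f (UNIV \<times> UNIV) P"
      using eqpoll_sym unfolding eqpoll_def by blast
    then show ?thesis unfolding bij_betw_def by auto
  next
    case False
    then have "inj (fst :: 'u \<times> 'u \<Rightarrow> 'u)" by (auto simp: inj_def)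
    then show ?thesis by blast
  qed
next
  case False
  then have "(UNIV :: 'u set) \<times> (UNIV :: 'u set) \<approx> (UNIV :: 'u set)"
    using card_of_Times_same_infinite unfolding eqpoll_def card_of_ordIso by blast
  then show ?thesis unfolding eqpoll_def bij_betw_def by auto
qed

definition (in set_universe) pairing :: "'u \<times> 'u \<Rightarrow> 'u" where
  "pairing = (SOME pr. inj pr)"

definition (in set_universe) fst_of :: "'u \<Rightarrow> 'u" where
  "fst_of t = fst (inv pairing t)"

definition (in set_universe) snd_of :: "'u \<Rightarrow> 'u" where
  "snd_of t = snd (inv pairing t)"

context set_universe
begin

lemma inj_pairing: "inj pairing"
  using someI_ex[OF ex_pairing] unfolding pairing_def .

lemma fst_of_pairing [simp]: "fst_of (pairing (a, b)) = a"
  and snd_of_pairing [simp]: "snd_of (pairing (a, b)) = b"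
  by (simp_all add: fst_of_def snd_of_def inj_pairing)

lemma pairing_eq_iff [simp]: "pairing (a, b) = pairing (c, d) \<longleftrightarrow> a = c \<and> b = d"
  using inj_pairing by (auto dest: injD)

lemma small_pairing_Sigma:
  assumes "small A" "\<And>a. a \<in> A \<Longrightarrow> small (B a)"
  shows "small (pairing ` (SIGMA a:A. B a))"
proof -
  obtain P where "small P" "P \<approx> A \<times> (\<Union>a\<in>A. B a)"
    using small_product[OF assms(1) small_Union[OF assms(1), of B]] assms(2) by blast
  then obtain f where "bij_betw f P (A \<times> (\<Union>a\<in>A. B a))" unfolding eqpoll_def by blast
  then have "pairing ` (A \<times> (\<Union>a\<in>A. B a)) = (pairing \<circ> f) ` P"
    by (metis bij_betw_imp_surj_on image_comp)
  then have "small (pairing ` (A \<times> (\<Union>a\<in>A. B a)))" using small_image[OF \<open>small P\<close>] by simp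
  then show ?thesis by (rule small_subset) auto
qed

end

section \<open>Presheaves\<close>

lemma op_category_simps [simp]:
  "Ob (op_category C) = Ob C" "Hom (op_category C) A B = Hom C B A"
  "Id (op_category C) = Id C" "Comp (op_category C) A B D g f = Comp C D B A f g"
  by (simp_all add: op_category_def)

lemma category_op: "category C \<Longrightarrow> category (op_category C)"
  unfolding category_def by simp

lemma Set_category_simps [simp]:
  "Ob (Set_category small) = {A. small A}" "Hom (Set_category small) A B = (A \<rightarrow>\<^sub>E B)"
  "Id (Set_category small) = (\<lambda>A. \<lambda>x\<in>A. x)"
  "Comp (Set_category small) A B D g f = compose A g f"
  by (simp_all add: Set_category_def)

lemma category_Set: "category (Set_category small)"
  by unfold_locales (auto simp: compose_def fun_eq_iff PiE_iff extensional_def Pi_iff)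

text \<open>
  All the presheaves below are built in this way, so that extensionality is dealt with only once.
\<close>

definition make_presheaf ::
  "('o, 'u, 'm) category_scheme \<Rightarrow> ('o \<Rightarrow> 'u set) \<Rightarrow> ('o \<Rightarrow> 'o \<Rightarrow> 'u \<Rightarrow> 'u \<Rightarrow> 'u)
    \<Rightarrow> ('o, 'u) presheaf" where
  "make_presheaf C F a = \<lparr>FOb = (\<lambda>A\<in>Ob C. F A),
    FMap = (\<lambda>A B g. if A \<in> Ob C \<and> B \<in> Ob C \<and> g \<in> Hom C B A
      then (\<lambda>x\<in>F A. a A B g x) else undefined)\<rparr>"

lemma make_presheaf_simps [simp]:
  "A \<in> Ob C \<Longrightarrow> FOb (make_presheaf C F a) A = F A"
  "\<lbrakk>A \<in> Ob C; B \<in> Ob C; g \<in> Hom C B A; x \<in> F A\<rbrakk> \<Longrightarrow> act (make_presheaf C F a) B A x g = a A B g x"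
  by (simp_all add: make_presheaf_def)

lemma representable_eq_make_presheaf:
  "representable C A = make_presheaf C (\<lambda>B. Hom C B A) (\<lambda>B D g x. Comp C D B A x g)"
  by (simp add: representable_def make_presheaf_def)

locale locally_small_category = category C + set_universe small
  for C :: "('o, 'u, 'm) category_scheme" and small :: "'u set \<Rightarrow> bool" +
  assumes locally_small: "locally_small small C"
begin

lemma small_Hom: "\<lbrakk>A \<in> Ob C; B \<in> Ob C\<rbrakk> \<Longrightarrow> small (Hom C A B)"
  using locally_small by (simp add: locally_small_def)

abbreviation Psh where "Psh \<equiv> PSh small C"

lemma presheaf_iff:
  "P \<in> Ob Psh \<longleftrightarrow> extensional_func (op_category C) P \<and> (\<forall>A\<in>Ob C. small (FOb P A)) \<and>
    (\<forall>A\<in>Ob C. \<forall>B\<in>Ob C. \<forall>g\<in>Hom C B A. FMap P A B g \<in> FOb P A \<rightarrow>\<^sub>E FOb P B) \<and>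
    (\<forall>A\<in>Ob C. \<forall>x\<in>FOb P A. act P A A x (Id C A) = x) \<and>
    (\<forall>A\<in>Ob C. \<forall>B\<in>Ob C. \<forall>D\<in>Ob C. \<forall>g\<in>Hom C B A. \<forall>h\<in>Hom C D B. \<forall>x\<in>FOb P A.
      act P D A x (Comp C D B A g h) = act P D B (act P B A x g) h)"
  (is "_ \<longleftrightarrow> ?R")
proof
  assume "P \<in> Ob Psh"
  then interpret is_functor "op_category C" "Set_category small" P
    by (simp add: PSh_def functor_category_def)
  have "FMap P A A (Id C A) x = x" if "A \<in> Ob C" "x \<in> FOb P A" for A x
    using FMap_Id[of A] that by simp
  moreover have "FMap P A D (Comp C D B A g h) x = FMap P B D h (FMap P A B g x)"
    if "A \<in> Ob C" "B \<in> Ob C" "D \<in> Ob C" "g \<in> Hom C B A" "h \<in> Hom C D B" "x \<in> FOb P A"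
    for A B D g h x
    using FMap_Comp[of A B D g h] that by (simp add: compose_def)
  ultimately show ?R
    using FOb_in_Ob FMap_in_Hom \<open>P \<in> Ob Psh\<close> by (simp add: PSh_def functor_category_def)
next
  assume R: ?R
  interpret O: category "op_category C" by (rule category_op) unfold_locales
  interpret S: category "Set_category small" by (rule category_Set)
  have "is_functor (op_category C) (Set_category small) P"
  proof unfold_locales
    show "FMap P A A (Id (op_category C) A) = Id (Set_category small) (FOb P A)"
      if "A \<in> Ob (op_category C)" for A
    proof (rule extensionalityI[where A = "FOb P A"])
      have "FMap P A A (Id C A) \<in> FOb P A \<rightarrow>\<^sub>E FOb P A" using that R by simp
      then show "FMap P A A (Id (op_category C) A) \<in> extensional (FOb P A)"
        by (auto simp: PiE_iff)
    qed (use R that in auto)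
    show "FMap P A E (Comp (op_category C) A B E g f) =
        Comp (Set_category small) (FOb P A) (FOb P B) (FOb P E) (FMap P B E g) (FMap P A B f)"
      if "A \<in> Ob (op_category C)" "B \<in> Ob (op_category C)" "E \<in> Ob (op_category C)"
        "f \<in> Hom (op_category C) A B" "g \<in> Hom (op_category C) B E" for A B E f g
    proof (rule extensionalityI[where A = "FOb P A"])
      have "FMap P A E (Comp C E B A f g) \<in> FOb P A \<rightarrow>\<^sub>E FOb P E" using that R by simp
      then show "FMap P A E (Comp (op_category C) A B E g f) \<in> extensional (FOb P A)"
        by (auto simp: PiE_iff)
    qed (use R that in \<open>auto simp: compose_def\<close>)
  qed (use R in auto)
  then show "P \<in> Ob Psh" using R by (simp add: PSh_def functor_category_def)
qed

lemma act_in [simp]: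
  "\<lbrakk>P \<in> Ob Psh; A \<in> Ob C; B \<in> Ob C; g \<in> Hom C B A; x \<in> FOb P A\<rbrakk> \<Longrightarrow> act P B A x g \<in> FOb P B"
  unfolding presheaf_iff by (meson PiE_mem)

lemma act_Id [simp]:
  "\<lbrakk>P \<in> Ob Psh; A \<in> Ob C; x \<in> FOb P A\<rbrakk> \<Longrightarrow> act P A A x (Id C A) = x"
  unfolding presheaf_iff by blast

lemma act_Comp:
  "\<lbrakk>P \<in> Ob Psh; A \<in> Ob C; B \<in> Ob C; D \<in> Ob C; g \<in> Hom C B A; h \<in> Hom C D B; x \<in> FOb P A\<rbrakk>
    \<Longrightarrow> act P D A x (Comp C D B A g h) = act P D B (act P B A x g) h"
  unfolding presheaf_iff by blast

lemma small_presheaf: "\<lbrakk>P \<in> Ob Psh; A \<in> Ob C\<rbrakk> \<Longrightarrow> small (FOb P A)"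
  unfolding presheaf_iff by blast

lemma make_presheaf_in_Ob:
  assumes "\<And>A. A \<in> Ob C \<Longrightarrow> small (F A)"
    and "\<And>A B g x. \<lbrakk>A \<in> Ob C; B \<in> Ob C; g \<in> Hom C B A; x \<in> F A\<rbrakk> \<Longrightarrow> a A B g x \<in> F B"
    and "\<And>A x. \<lbrakk>A \<in> Ob C; x \<in> F A\<rbrakk> \<Longrightarrow> a A A (Id C A) x = x"
    and "\<And>A B D g h x. \<lbrakk>A \<in> Ob C; B \<in> Ob C; D \<in> Ob C; g \<in> Hom C B A; h \<in> Hom C D B; x \<in> F A\<rbrakk>
      \<Longrightarrow> a A D (Comp C D B A g h) x = a B D h (a A B g x)"
  shows "make_presheaf C F a \<in> Ob Psh"
  unfolding presheaf_iff
proof (intro conjI ballI)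
  show "extensional_func (op_category C) (make_presheaf C F a)"
    by (auto simp: extensional_func_def make_presheaf_def)
  show "FMap (make_presheaf C F a) A B g \<in> FOb (make_presheaf C F a) A \<rightarrow>\<^sub>E FOb (make_presheaf C F a) B"
    if "A \<in> Ob C" "B \<in> Ob C" "g \<in> Hom C B A" for A B g
    using that assms(2) by (auto simp: make_presheaf_def)
qed (use assms in auto)

lemma presheaf_eqI:
  assumes "P \<in> Ob Psh" "Q \<in> Ob Psh" "\<And>A. A \<in> Ob C \<Longrightarrow> FOb P A = FOb Q A"
    and "\<And>A B g x. \<lbrakk>A \<in> Ob C; B \<in> Ob C; g \<in> Hom C B A; x \<in> FOb P A\<rbrakk> \<Longrightarrow> act P B A x g = act Q B A x g"
  shows "P = Q"
proof (rule func.equality)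
  show "FOb P = FOb Q"
    using assms(1-3) unfolding presheaf_iff extensional_func_def by (metis op_category_simps(1) ext)
  show "FMap P = FMap Q"
  proof (intro ext)
    fix A B g x
    show "FMap P A B g x = FMap Q A B g x"
    proof (cases "A \<in> Ob C \<and> B \<in> Ob C \<and> g \<in> Hom C B A")
      case True
      then have "FMap P A B g \<in> extensional (FOb P A)" "FMap Q A B g \<in> extensional (FOb P A)"
        using assms(1-3) unfolding presheaf_iff by (auto simp: PiE_iff)
      then show ?thesis using True assms(4) by (cases "x \<in> FOb P A") (auto simp: extensional_def)
    next
      case False
      then show ?thesis using assms(1,2) unfolding presheaf_iff extensional_func_def by simp
    qed
  qed
qed simp

lemma Psh_Hom_iff:
  assumes "P \<in> Ob Psh" "Q \<in> Ob Psh"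
  shows "\<alpha> \<in> Hom Psh P Q \<longleftrightarrow> \<alpha> \<in> extensional (Ob C) \<and>
    (\<forall>A\<in>Ob C. \<alpha> A \<in> FOb P A \<rightarrow>\<^sub>E FOb Q A) \<and>
    (\<forall>A\<in>Ob C. \<forall>B\<in>Ob C. \<forall>g\<in>Hom C B A. \<forall>x\<in>FOb P A. \<alpha> B (act P B A x g) = act Q B A (\<alpha> A x) g)"
  (is "_ \<longleftrightarrow> ?R")
proof -
  interpret P: is_functor "op_category C" "Set_category small" P
    using assms by (simp add: PSh_def functor_category_def)
  interpret Q: is_functor "op_category C" "Set_category small" Q
    using assms by (simp add: PSh_def functor_category_def)
  show ?thesis
  proof
    assume "\<alpha> \<in> Hom Psh P Q"
    then have \<alpha>: "\<alpha> \<in> extensional (Ob C)"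
        "natural_transformation (op_category C) (Set_category small) P Q \<alpha>"
      by (simp_all add: PSh_def functor_category_def)
    interpret natural_transformation "op_category C" "Set_category small" P Q \<alpha> by (fact \<alpha>)
    show ?R
    proof (intro conjI ballI)
      show "\<alpha> B (act P B A x g) = act Q B A (\<alpha> A x) g"
        if "A \<in> Ob C" "B \<in> Ob C" "g \<in> Hom C B A" "x \<in> FOb P A" for A B g x
        using naturality[of A B g] that by (simp add: compose_def fun_eq_iff) meson
    qed (use \<alpha> component_in_Hom in auto)
  next
    assume R: ?R
    have "natural_transformation (op_category C) (Set_category small) P Q \<alpha>"
    proof unfold_locales
      show "Comp (Set_category small) (FOb P A) (FOb P B) (FOb Q B) (\<alpha> B) (FMap P A B f) =
        Comp (Set_category small) (FOb P A) (FOb Q A) (FOb Q B) (FMap Q A B f) (\<alpha> A)"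
        if "A \<in> Ob (op_category C)" "B \<in> Ob (op_category C)" "f \<in> Hom (op_category C) A B" for A B f
        using that R by (auto simp: compose_def fun_eq_iff)
    qed (use R in auto)
    then show "\<alpha> \<in> Hom Psh P Q" using R by (simp add: PSh_def functor_category_def)
  qed
qed

lemma nat_in:
  "\<lbrakk>P \<in> Ob Psh; Q \<in> Ob Psh; \<alpha> \<in> Hom Psh P Q; A \<in> Ob C; x \<in> FOb P A\<rbrakk> \<Longrightarrow> \<alpha> A x \<in> FOb Q A"
  unfolding Psh_Hom_iff by (meson PiE_mem)

lemma nat_in' [simp]:
  "\<lbrakk>\<alpha> \<in> Hom Psh P Q; P \<in> Ob Psh; Q \<in> Ob Psh; A \<in> Ob C; x \<in> FOb P A\<rbrakk> \<Longrightarrow> \<alpha> A x \<in> FOb Q A"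
  by (rule nat_in)

lemma nat_act:
  "\<lbrakk>P \<in> Ob Psh; Q \<in> Ob Psh; \<alpha> \<in> Hom Psh P Q; A \<in> Ob C; B \<in> Ob C; g \<in> Hom C B A; x \<in> FOb P A\<rbrakk>
    \<Longrightarrow> \<alpha> B (act P B A x g) = act Q B A (\<alpha> A x) g"
  unfolding Psh_Hom_iff by blast

lemma make_nat:
  assumes "P \<in> Ob Psh" "Q \<in> Ob Psh"
    and "\<And>A x. \<lbrakk>A \<in> Ob C; x \<in> FOb P A\<rbrakk> \<Longrightarrow> a A x \<in> FOb Q A"
    and "\<And>A B g x. \<lbrakk>A \<in> Ob C; B \<in> Ob C; g \<in> Hom C B A; x \<in> FOb P A\<rbrakk>
      \<Longrightarrow> a B (act P B A x g) = act Q B A (a A x) g"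
  shows "(\<lambda>A\<in>Ob C. \<lambda>x\<in>FOb P A. a A x) \<in> Hom Psh P Q"
  unfolding Psh_Hom_iff[OF assms(1,2)] using assms by auto

lemma nat_eqI:
  assumes "P \<in> Ob Psh" "Q \<in> Ob Psh" "\<alpha> \<in> Hom Psh P Q" "\<beta> \<in> Hom Psh P Q"
    and "\<And>A x. \<lbrakk>A \<in> Ob C; x \<in> FOb P A\<rbrakk> \<Longrightarrow> \<alpha> A x = \<beta> A x"
  shows "\<alpha> = \<beta>"
proof (intro extensionalityI[where A = "Ob C"])
  fix A assume "A \<in> Ob C"
  then show "\<alpha> A = \<beta> A"
    using assms unfolding Psh_Hom_iff[OF assms(1,2)]
    by (intro extensionalityI[where A = "FOb P A"]) (auto simp: PiE_iff)
qed (use assms in \<open>auto simp: Psh_Hom_iff\<close>)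

lemma Psh_Comp_app [simp]:
  "\<lbrakk>A \<in> Ob C; x \<in> FOb P A\<rbrakk> \<Longrightarrow> Comp Psh P Q R \<beta> \<alpha> A x = \<beta> A (\<alpha> A x)"
  by (simp add: PSh_def functor_category_def compose_def)

lemma Psh_Id_app [simp]: "\<lbrakk>A \<in> Ob C; x \<in> FOb P A\<rbrakk> \<Longrightarrow> Id Psh P A x = x"
  by (simp add: PSh_def functor_category_def)

lemma Psh_Comp_eq: "Comp Psh P Q R \<beta> \<alpha> = (\<lambda>A\<in>Ob C. \<lambda>x\<in>FOb P A. \<beta> A (\<alpha> A x))"
  by (simp add: PSh_def functor_category_def compose_def)

lemma Psh_Id_eq: "Id Psh P = (\<lambda>A\<in>Ob C. \<lambda>x\<in>FOb P A. x)"
  by (simp add: PSh_def functor_category_def)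

lemma category_Psh: "category Psh"
proof
  fix P assume P: "P \<in> Ob Psh"
  show Id: "Id Psh P \<in> Hom Psh P P"
    unfolding Psh_Id_eq by (rule make_nat) (use P in auto)
next
  fix P Q R \<alpha> \<beta>
  assume *: "P \<in> Ob Psh" "Q \<in> Ob Psh" "R \<in> Ob Psh" "\<alpha> \<in> Hom Psh P Q" "\<beta> \<in> Hom Psh Q R"
  show "Comp Psh P Q R \<beta> \<alpha> \<in> Hom Psh P R"
    unfolding Psh_Comp_eq
  proof (rule make_nat)
    show "\<beta> A (\<alpha> A x) \<in> FOb R A" if "A \<in> Ob C" "x \<in> FOb P A" for A x
      using nat_in[OF *(2,3,5)] nat_in[OF *(1,2,4)] that by blast
    show "\<beta> B (\<alpha> B (act P B A x g)) = act R B A (\<beta> A (\<alpha> A x)) g"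
      if "A \<in> Ob C" "B \<in> Ob C" "g \<in> Hom C B A" "x \<in> FOb P A" for A B g x
      using nat_act[OF *(2,3,5)] nat_act[OF *(1,2,4)] nat_in[OF *(1,2,4)] that by simp
  qed (use * in auto)
next
  fix P Q \<alpha>
  assume *: "P \<in> Ob Psh" "Q \<in> Ob Psh" "\<alpha> \<in> Hom Psh P Q"
  have ext: "(\<lambda>A\<in>Ob C. \<lambda>x\<in>FOb P A. \<alpha> A x) = \<alpha>"
    using * by (auto simp: Psh_Hom_iff fun_eq_iff extensional_def PiE_iff)
  show "Comp Psh P P Q \<alpha> (Id Psh P) = \<alpha>"
    unfolding Psh_Comp_eq by (rule trans[OF _ ext]) (auto simp: fun_eq_iff)
  show "Comp Psh P Q Q (Id Psh Q) \<alpha> = \<alpha>"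
    unfolding Psh_Comp_eq by (rule trans[OF _ ext]) (use nat_in[OF *] in \<open>auto simp: fun_eq_iff\<close>)
next
  fix P Q R S \<alpha> \<beta> \<gamma>
  assume *: "P \<in> Ob Psh" "Q \<in> Ob Psh" "R \<in> Ob Psh" "S \<in> Ob Psh"
    "\<alpha> \<in> Hom Psh P Q" "\<beta> \<in> Hom Psh Q R" "\<gamma> \<in> Hom Psh R S"
  show "Comp Psh P R S \<gamma> (Comp Psh P Q R \<beta> \<alpha>) = Comp Psh P Q S (Comp Psh Q R S \<gamma> \<beta>) \<alpha>"
    unfolding Psh_Comp_eq using nat_in[OF *(1,2,5)] by (auto simp: fun_eq_iff)
qed

sublocale Psh: category Psh
  by (rule category_Psh)

subsection \<open>Representable presheaves\<close>

lemma FOb_representable [simp]: "B \<in> Ob C \<Longrightarrow> FOb (representable C A) B = Hom C B A"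
  by (simp add: representable_def)

lemma act_representable [simp]:
  "\<lbrakk>B \<in> Ob C; D \<in> Ob C; g \<in> Hom C D B; x \<in> Hom C B A\<rbrakk>
    \<Longrightarrow> act (representable C A) D B x g = Comp C D B A x g"
  by (simp add: representable_def)

lemma representable_in_Ob [simp]: "A \<in> Ob C \<Longrightarrow> representable C A \<in> Ob Psh"
  unfolding representable_eq_make_presheaf
  by (rule make_presheaf_in_Ob) (auto simp: small_Hom Comp_assoc)

text \<open>
  By the Yoneda lemma every transformation from the presheaf represented by \<open>A\<close> to \<open>P\<close> is of this
  form.
\<close>

definition of_element :: "('o, 'u) presheaf \<Rightarrow> 'o \<Rightarrow> 'u \<Rightarrow> 'o \<Rightarrow> 'u \<Rightarrow> 'u" where
  "of_element P A x = (\<lambda>D\<in>Ob C. \<lambda>g\<in>FOb (representable C A) D. act P D A x g)"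

lemma of_element_app [simp]:
  "\<lbrakk>D \<in> Ob C; g \<in> Hom C D A\<rbrakk> \<Longrightarrow> of_element P A x D g = act P D A x g"
  by (simp add: of_element_def)

lemma of_element_in_Hom [simp]:
  "\<lbrakk>P \<in> Ob Psh; A \<in> Ob C; x \<in> FOb P A\<rbrakk> \<Longrightarrow> of_element P A x \<in> Hom Psh (representable C A) P"
  unfolding of_element_def by (rule make_nat) (auto simp: act_Comp)

lemma representable_nat_app:
  assumes "P \<in> Ob Psh" "A \<in> Ob C" "\<gamma> \<in> Hom Psh (representable C A) P" "D \<in> Ob C" "g \<in> Hom C D A"
  shows "\<gamma> D g = act P D A (\<gamma> A (Id C A)) g"
  using nat_act[of "representable C A" P \<gamma> A D g "Id C A"] assms by simp

lemma yoneda_FMap_eq: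
  "\<lbrakk>A \<in> Ob C; B \<in> Ob C; f \<in> Hom C A B\<rbrakk> \<Longrightarrow> FMap (yoneda C) A B f = of_element (representable C B) A f"
  by (auto simp: yoneda_def of_element_def fun_eq_iff)

lemma yoneda_in_Hom [simp]:
  "\<lbrakk>A \<in> Ob C; B \<in> Ob C; f \<in> Hom C A B\<rbrakk>
    \<Longrightarrow> FMap (yoneda C) A B f \<in> Hom Psh (representable C A) (representable C B)"
  by (simp add: yoneda_FMap_eq)

lemma yoneda_app [simp]:
  "\<lbrakk>D \<in> Ob C; x \<in> Hom C D A\<rbrakk> \<Longrightarrow> FMap (yoneda C) A B f D x = Comp C D A B f x"
  by (simp add: yoneda_def)

subsection \<open>Pullbacks of presheaves are computed pointwise\<close>

text \<open>
  Elements of \<open>P D\<close> are transformations \<open>y D \<Rightarrow> P\<close>, so the universal property at representables is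
  the pointwise statement. Conversely the pointwise mediating elements are unique, hence natural.
\<close>

lemma is_pullback_Psh_iff:
  "is_pullback Psh A B D f g P p q \<longleftrightarrow>
    A \<in> Ob Psh \<and> B \<in> Ob Psh \<and> D \<in> Ob Psh \<and> P \<in> Ob Psh \<and>
    f \<in> Hom Psh A D \<and> g \<in> Hom Psh B D \<and> p \<in> Hom Psh P A \<and> q \<in> Hom Psh P B \<and>
    (\<forall>I\<in>Ob C. \<forall>c\<in>FOb P I. f I (p I c) = g I (q I c)) \<and>
    (\<forall>I\<in>Ob C. \<forall>a\<in>FOb A I. \<forall>b\<in>FOb B I. f I a = g I b \<longrightarrow>
      (\<exists>!c. c \<in> FOb P I \<and> p I c = a \<and> q I c = b))"
  (is "?L \<longleftrightarrow> ?R")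
proof
  assume L: ?L
  then have ob [simp]: "A \<in> Ob Psh" "B \<in> Ob Psh" "D \<in> Ob Psh" "P \<in> Ob Psh"
    and h [simp]: "f \<in> Hom Psh A D" "g \<in> Hom Psh B D" "p \<in> Hom Psh P A" "q \<in> Hom Psh P B"
    and comm: "Comp Psh P A D f p = Comp Psh P B D g q"
    and univ: "\<And>Q a b. \<lbrakk>Q \<in> Ob Psh; a \<in> Hom Psh Q A; b \<in> Hom Psh Q B;
      Comp Psh Q A D f a = Comp Psh Q B D g b\<rbrakk>
      \<Longrightarrow> \<exists>!u. u \<in> Hom Psh Q P \<and> Comp Psh Q P A p u = a \<and> Comp Psh Q P B q u = b"
    unfolding is_pullback_def by auto
  have "f I (p I c) = g I (q I c)" if "I \<in> Ob C" "c \<in> FOb P I" for I c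
    using fun_cong[OF fun_cong[OF comm, of I], of c] that by simp
  moreover have "\<exists>!c. c \<in> FOb P I \<and> p I c = a \<and> q I c = b"
    if I [simp]: "I \<in> Ob C" and a [simp]: "a \<in> FOb A I" and b [simp]: "b \<in> FOb B I" and ab: "f I a = g I b"
    for I a b
  proof -
    let ?y = "representable C I"
    have "Comp Psh ?y A D f (of_element A I a) = Comp Psh ?y B D g (of_element B I b)"
    proof (rule nat_eqI[of ?y D])
      show "Comp Psh ?y A D f (of_element A I a) K k = Comp Psh ?y B D g (of_element B I b) K k"
        if "K \<in> Ob C" "k \<in> FOb ?y K" for K k
        using that nat_act[of A D f I K k a] nat_act[of B D g I K k b] ab by simp
    qed simp_all
    then have ex1: "\<exists>!u. u \<in> Hom Psh ?y P \<and> Comp Psh ?y P A p u = of_element A I a \<and>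
        Comp Psh ?y P B q u = of_element B I b"
      by (intro univ) simp_all
    then obtain u where u [simp]: "u \<in> Hom Psh ?y P" and pu: "Comp Psh ?y P A p u = of_element A I a"
      and qu: "Comp Psh ?y P B q u = of_element B I b" by blast
    have "u I (Id C I) \<in> FOb P I" using nat_in[of ?y P u I "Id C I"] by simp
    moreover have "p I (u I (Id C I)) = a"
      using fun_cong[OF fun_cong[OF pu, of I], of "Id C I"] by simp
    moreover have "q I (u I (Id C I)) = b"
      using fun_cong[OF fun_cong[OF qu, of I], of "Id C I"] by simp
    moreover have "c = u I (Id C I)" if c [simp]: "c \<in> FOb P I" and pc: "p I c = a" and qc: "q I c = b" for c
    proof -
      have "Comp Psh ?y P A p (of_element P I c) = of_element A I a"
        by (rule nat_eqI[of ?y A]) (simp_all add: nat_act[of P A p] pc)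
      moreover have "Comp Psh ?y P B q (of_element P I c) = of_element B I b"
        by (rule nat_eqI[of ?y B]) (simp_all add: nat_act[of P B q] qc)
      ultimately have "of_element P I c = u" using ex1 u pu qu of_element_in_Hom[of P I c] c ob I by metis
      then show ?thesis by auto
    qed
    ultimately show ?thesis by blast
  qed
  ultimately show ?R by (simp del: FOb_representable)
next
  assume R: ?R
  then have ob [simp]: "A \<in> Ob Psh" "B \<in> Ob Psh" "D \<in> Ob Psh" "P \<in> Ob Psh"
    and h [simp]: "f \<in> Hom Psh A D" "g \<in> Hom Psh B D" "p \<in> Hom Psh P A" "q \<in> Hom Psh P B"
    by auto
  have comm: "f I (p I c) = g I (q I c)" if "I \<in> Ob C" "c \<in> FOb P I" for I c
    using R that by blast
  have ex1: "\<exists>!c. c \<in> FOb P I \<and> p I c = a \<and> q I c = b"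
    if "I \<in> Ob C" "a \<in> FOb A I" "b \<in> FOb B I" "f I a = g I b" for I a b
    using R that by blast
  show ?L
    unfolding is_pullback_def
  proof (intro conjI ballI impI)
    show "Comp Psh P A D f p = Comp Psh P B D g q"
      by (rule nat_eqI[of P D]) (simp_all add: comm)
    fix Q a b
    assume Q [simp]: "Q \<in> Ob Psh" and a [simp]: "a \<in> Hom Psh Q A" and b [simp]: "b \<in> Hom Psh Q B"
      and ab: "Comp Psh Q A D f a = Comp Psh Q B D g b"
    have ab': "f I (a I x) = g I (b I x)" if "I \<in> Ob C" "x \<in> FOb Q I" for I x
      using fun_cong[OF fun_cong[OF ab, of I], of x] that by simp
    have aI: "a I x \<in> FOb A I" and bI: "b I x \<in> FOb B I" if "I \<in> Ob C" "x \<in> FOb Q I" for I x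
      using that nat_in[OF Q _ a] nat_in[OF Q _ b] by simp_all
    define w where "w I x = (THE c. c \<in> FOb P I \<and> p I c = a I x \<and> q I c = b I x)" for I x
    have w: "w I x \<in> FOb P I \<and> p I (w I x) = a I x \<and> q I (w I x) = b I x"
      if "I \<in> Ob C" "x \<in> FOb Q I" for I x
      unfolding w_def by (rule theI', rule ex1) (use that in \<open>simp_all add: ab' aI bI\<close>)
    have w_unique: "c = w I x"
      if "I \<in> Ob C" "x \<in> FOb Q I" "c \<in> FOb P I" "p I c = a I x" "q I c = b I x" for I x c
      using ex1[of I "a I x" "b I x"] w[of I x] that by (auto simp: ab' aI bI)
    let ?u = "\<lambda>I\<in>Ob C. \<lambda>x\<in>FOb Q I. w I x"
    have u: "?u \<in> Hom Psh Q P"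
    proof (rule make_nat)
      show "w K (act Q K I x k) = act P K I (w I x) k"
        if "I \<in> Ob C" "K \<in> Ob C" "k \<in> Hom C K I" "x \<in> FOb Q I" for I K k x
        by (rule w_unique[symmetric])
          (use that w in \<open>simp_all add: nat_act[of P A p] nat_act[of P B q] nat_act[of Q A a] nat_act[of Q B b]\<close>)
    qed (use w in auto)
    show "\<exists>!u. u \<in> Hom Psh Q P \<and> Comp Psh Q P A p u = a \<and> Comp Psh Q P B q u = b"
    proof (intro ex1I conjI)
      show "?u \<in> Hom Psh Q P" by (rule u)
      show "Comp Psh Q P A p ?u = a"
        by (rule nat_eqI[of Q A]) (use u w in simp_all)
      show "Comp Psh Q P B q ?u = b"
        by (rule nat_eqI[of Q B]) (use u w in simp_all)
      fix v assume v: "v \<in> Hom Psh Q P \<and> Comp Psh Q P A p v = a \<and> Comp Psh Q P B q v = b"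
      show "v = ?u"
      proof (rule nat_eqI[of Q P])
        fix I x assume Ix: "I \<in> Ob C" "x \<in> FOb Q I"
        have "p I (v I x) = Comp Psh Q P A p v I x" "q I (v I x) = Comp Psh Q P B q v I x"
          using Ix by simp_all
        then have "p I (v I x) = a I x" "q I (v I x) = b I x"
          using v by metis+
        then show "v I x = ?u I x" using w_unique[of I x "v I x"] Ix v nat_in[of Q P v I x] by simp
      qed (use u v in auto)
    qed
  qed simp_all
qed

subsection \<open>Injective transformations\<close>

definition injective :: "('o, 'u) presheaf \<Rightarrow> ('o \<Rightarrow> 'u \<Rightarrow> 'u) \<Rightarrow> bool" where
  "injective P \<mu> \<longleftrightarrow> (\<forall>A\<in>Ob C. inj_on (\<mu> A) (FOb P A))"

text \<open>
  The pointwise preimages are natural because they are determined by their images.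
\<close>

lemma factor_through_injective:
  assumes [simp]: "P \<in> Ob Psh" "Q \<in> Ob Psh" "R \<in> Ob Psh" "\<mu> \<in> Hom Psh P Q" "\<kappa> \<in> Hom Psh R Q"
    and inj: "injective P \<mu>"
    and im: "\<And>A x. \<lbrakk>A \<in> Ob C; x \<in> FOb R A\<rbrakk> \<Longrightarrow> \<kappa> A x \<in> \<mu> A ` FOb P A"
  obtains \<phi> where "\<phi> \<in> Hom Psh R P" "\<And>A x. \<lbrakk>A \<in> Ob C; x \<in> FOb R A\<rbrakk> \<Longrightarrow> \<mu> A (\<phi> A x) = \<kappa> A x"
proof
  let ?l = "\<lambda>A x. inv_into (FOb P A) (\<mu> A) (\<kappa> A x)"
  have l: "?l A x \<in> FOb P A" "\<mu> A (?l A x) = \<kappa> A x" if "A \<in> Ob C" "x \<in> FOb R A" for A x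
    using im[OF that] by (auto simp: inv_into_into f_inv_into_f)
  show "(\<lambda>A\<in>Ob C. \<lambda>x\<in>FOb R A. ?l A x) \<in> Hom Psh R P"
  proof (rule make_nat)
    fix A B g x assume *: "A \<in> Ob C" "B \<in> Ob C" "g \<in> Hom C B A" "x \<in> FOb R A"
    have "\<mu> B (?l B (act R B A x g)) = \<kappa> B (act R B A x g)"
      by (rule l) (use * in simp_all)
    also have "\<dots> = \<mu> B (act P B A (?l A x) g)"
      using * l by (simp add: nat_act[of P Q \<mu>] nat_act[of R Q \<kappa>])
    finally have "\<mu> B (?l B (act R B A x g)) = \<mu> B (act P B A (?l A x) g)" .
    then show "?l B (act R B A x g) = act P B A (?l A x) g"
      using inj * l unfolding injective_def by (auto dest: inj_onD)
  qed (use l in auto)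
  show "\<mu> A ((\<lambda>A\<in>Ob C. \<lambda>x\<in>FOb R A. ?l A x) A x) = \<kappa> A x" if "A \<in> Ob C" "x \<in> FOb R A" for A x
    using that l by simp
qed

definition subpresheaf :: "('o, 'u) presheaf \<Rightarrow> ('o \<Rightarrow> 'u \<Rightarrow> bool) \<Rightarrow> ('o, 'u) presheaf" where
  "subpresheaf P S = make_presheaf C (\<lambda>A. {x \<in> FOb P A. S A x}) (\<lambda>A B g x. act P B A x g)"

lemma FOb_subpresheaf [simp]: "A \<in> Ob C \<Longrightarrow> FOb (subpresheaf P S) A = {x \<in> FOb P A. S A x}"
  by (simp add: subpresheaf_def)

lemma act_subpresheaf [simp]:
  "\<lbrakk>A \<in> Ob C; B \<in> Ob C; g \<in> Hom C B A; x \<in> FOb P A; S A x\<rbrakk>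
    \<Longrightarrow> act (subpresheaf P S) B A x g = act P B A x g"
  by (simp add: subpresheaf_def)

lemma subpresheaf_in_Ob:
  assumes [simp]: "P \<in> Ob Psh"
    and S: "\<And>A B g x. \<lbrakk>A \<in> Ob C; B \<in> Ob C; g \<in> Hom C B A; x \<in> FOb P A; S A x\<rbrakk> \<Longrightarrow> S B (act P B A x g)"
  shows "subpresheaf P S \<in> Ob Psh"
  unfolding subpresheaf_def
  by (rule make_presheaf_in_Ob)
    (use S in \<open>auto simp: act_Comp intro: small_subset[OF small_presheaf[of P]]\<close>)

lemma pullback_element:
  assumes "is_pullback Psh A B D f g P p q" "I \<in> Ob C" "a \<in> FOb A I" "b \<in> FOb B I" "f I a = g I b"
  obtains c where "c \<in> FOb P I" "p I c = a" "q I c = b"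
  using assms unfolding is_pullback_Psh_iff by blast

lemma injectiveD:
  "\<lbrakk>injective P \<mu>; A \<in> Ob C; \<mu> A x = \<mu> A y; x \<in> FOb P A; y \<in> FOb P A\<rbrakk> \<Longrightarrow> x = y"
  unfolding injective_def by (auto dest: inj_onD)

end

section \<open>Total maps between restriction idempotents\<close>

locale small_restriction_category = restriction_category X + set_universe small
  for X :: "('o, 'u, 'm) rcategory_scheme" and small :: "'u set \<Rightarrow> bool" +
  assumes X_locally_small: "locally_small small X"
begin

abbreviation \<T> where "\<T> \<equiv> MTotal (K\<^sub>r X)"

abbreviation idem where "idem \<equiv> restriction_idempotent X"

lemma T_Ob [simp]: "(A, e) \<in> Ob \<T> \<longleftrightarrow> A \<in> Ob X \<and> idem A e"
  by (simp add: MTotal_def K\<^sub>r_def)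

lemma Kr_simps:
  "(A, e) \<in> Ob (K\<^sub>r X) \<longleftrightarrow> A \<in> Ob X \<and> idem A e"
  "Id (K\<^sub>r X) (A, e) = e"
  "Comp (K\<^sub>r X) (A, e) (B, d) (D, c) g f = Comp X A B D g f"
  by (simp_all add: K\<^sub>r_def)

lemma T_Id [simp]: "Id \<T> (A, e) = e"
  by (simp add: MTotal_def K\<^sub>r_def)

lemma T_Comp [simp]: "Comp \<T> (A, e) (B, d) (D, c) g f = Comp X A B D g f"
  by (simp add: MTotal_def K\<^sub>r_def)

lemma Kr_Hom_iff:
  assumes "A \<in> Ob X" "B \<in> Ob X" "idem A e" "idem B d"
  shows "f \<in> Hom (K\<^sub>r X) (A, e) (B, d) \<longleftrightarrow>
    f \<in> Hom X A B \<and> Comp X A B B d f = f \<and> Comp X A A B f e = f" (is "?L \<longleftrightarrow> ?R")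
proof
  assume ?L
  then have f: "f \<in> Hom X A B" and eq: "Comp X A B B d (Comp X A A B f e) = f"
    by (auto simp: K\<^sub>r_def)
  have "Comp X A B B d f = f"
    using f assms Comp_assoc[of A B B B "Comp X A A B f e" d d] by (simp add: eq)
  moreover have "Comp X A A B f e = f"
    using f assms Comp_assoc[of A A A B e e f]
      Comp_assoc[of A A B B e "Comp X A A B f e" d] by (simp add: eq)
  ultimately show ?R using f by blast
qed (auto simp: K\<^sub>r_def)

lemma T_Hom [simp]:
  assumes "A \<in> Ob X" "B \<in> Ob X" "idem A e" "idem B d"
  shows "f \<in> Hom \<T> (A, e) (B, d) \<longleftrightarrow> f \<in> Hom X A B \<and> Comp X A B B d f = f \<and> Rst X A B f = e"
proof -
  have "f \<in> Hom \<T> (A, e) (B, d) \<longleftrightarrow> f \<in> Hom (K\<^sub>r X) (A, e) (B, d) \<and> Rst X A B f = e"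
    by (auto simp: MTotal_def total_map_def K\<^sub>r_def)
  then show ?thesis using Kr_Hom_iff[OF assms] R1[OF assms(1,2)] by metis
qed

lemma Kr_idempotent_iff:
  "restriction_idempotent (K\<^sub>r X) (A, e) d \<longleftrightarrow> d \<in> Hom (K\<^sub>r X) (A, e) (A, e) \<and> Rst X A A d = d"
  unfolding restriction_idempotent_def K\<^sub>r_def by simp

lemma category_T: "category \<T>"
proof
  fix A B D :: "'o \<times> 'u" and f g
  assume *: "A \<in> Ob \<T>" "B \<in> Ob \<T>" "D \<in> Ob \<T>" "f \<in> Hom \<T> A B" "g \<in> Hom \<T> B D"
  obtain A0 a B0 b D0 d where [simp]: "A = (A0, a)" "B = (B0, b)" "D = (D0, d)"
    by (metis surj_pair)
  have ob: "A0 \<in> Ob X" "B0 \<in> Ob X" "D0 \<in> Ob X" "idem A0 a" "idem B0 b" "idem D0 d"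
    using * by simp_all
  then have f: "f \<in> Hom X A0 B0" "Comp X A0 B0 B0 b f = f" "Rst X A0 B0 f = a"
    and g: "g \<in> Hom X B0 D0" "Comp X B0 D0 D0 d g = g" "Rst X B0 D0 g = b"
    using * by simp_all
  have "Rst X A0 D0 (Comp X A0 B0 D0 g f) = a"
    using ob f g Rst_Rst_Comp[of A0 B0 D0 f g] by simp
  then show "Comp \<T> A B D g f \<in> Hom \<T> A D"
    using ob f g by (simp add: Comp_assoc)
next
  fix A B f
  assume *: "A \<in> Ob \<T>" "B \<in> Ob \<T>" "f \<in> Hom \<T> A B"
  obtain A0 a B0 b where [simp]: "A = (A0, a)" "B = (B0, b)"
    by (metis surj_pair)
  have ob: "A0 \<in> Ob X" "B0 \<in> Ob X" "idem A0 a" "idem B0 b"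
    using * by simp_all
  then have f: "f \<in> Hom X A0 B0" "Comp X A0 B0 B0 b f = f" "Rst X A0 B0 f = a"
    using * by simp_all
  show "Comp \<T> A A B f (Id \<T> A) = f" "Comp \<T> A B B (Id \<T> B) f = f"
    using R1[OF ob(1,2) f(1)] f by simp_all
next
  fix A B D E :: "'o \<times> 'u" and f g h
  assume *: "A \<in> Ob \<T>" "B \<in> Ob \<T>" "D \<in> Ob \<T>" "E \<in> Ob \<T>"
    "f \<in> Hom \<T> A B" "g \<in> Hom \<T> B D" "h \<in> Hom \<T> D E"
  obtain A0 a B0 b D0 d E0 e where [simp]: "A = (A0, a)" "B = (B0, b)" "D = (D0, d)" "E = (E0, e)"
    by (metis surj_pair)
  show "Comp \<T> A D E h (Comp \<T> A B D g f) = Comp \<T> A B E (Comp \<T> B D E h g) f"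
    using * by (simp add: Comp_assoc)
next
  fix A assume *: "A \<in> Ob \<T>"
  obtain A0 a where [simp]: "A = (A0, a)" by (metis surj_pair)
  show "Id \<T> A \<in> Hom \<T> A A" using * by simp
qed

sublocale X: locally_small_category X small
  by unfold_locales (fact X_locally_small)

sublocale T: category \<T>
  by (rule category_T)

sublocale T: locally_small_category \<T> small
proof unfold_locales
  have "small (Hom \<T> (A, e) (B, d))" if "(A, e) \<in> Ob \<T>" "(B, d) \<in> Ob \<T>" for A e B d
    by (rule small_subset[OF X.small_Hom[of A B]]) (use that in auto)
  then show "locally_small small \<T>" unfolding locally_small_def by (metis surj_pair)
qed

text \<open>
  The inclusion of a smaller idempotent is the typical restriction monic of \<open>\<T>\<close>; up to isomorphism
  there are no others.
\<close>

lemma idempotent_in_Mon: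
  assumes "A \<in> Ob X" "idem A e" "idem A e'" "Comp X A A A e e' = e'"
  shows "e' \<in> Mon \<T> (A, e') (A, e)"
proof -
  have c: "Comp X A A A e' e = e'" using assms restriction_idempotent_commute by metis
  have "restriction_idempotent (K\<^sub>r X) (A, e) e'"
    using assms c by (simp add: Kr_idempotent_iff Kr_Hom_iff)
  moreover have "splitting (K\<^sub>r X) (A, e) e' (A, e') e' e'"
    using assms c Kr_Hom_iff[of A A e e' e'] Kr_Hom_iff[of A A e' e e']
    unfolding splitting_def by (simp add: Kr_simps)
  ultimately show ?thesis by (auto simp: MTotal_def restriction_monic_def)
qed

lemma splitting_in_Kr:
  assumes ob: "A \<in> Ob X" "idem A e" and s: "splitting (K\<^sub>r X) (A, e) \<epsilon> (B, d) m r"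
  shows "B \<in> Ob X" "idem B d" "r \<in> Hom X A B" "Comp X A B B d r = r"
    "m \<in> Hom \<T> (B, d) (A, e)" "Comp X B A B r m = d" "Comp X A B A m r = \<epsilon>"
proof -
  show B: "B \<in> Ob X" "idem B d" and rm: "Comp X B A B r m = d" and "Comp X A B A m r = \<epsilon>"
    using s unfolding splitting_def Kr_simps by simp_all
  have "m \<in> Hom (K\<^sub>r X) (B, d) (A, e)" "r \<in> Hom (K\<^sub>r X) (A, e) (B, d)"
    using s by (auto simp: splitting_def)
  with B ob have m: "m \<in> Hom X B A" "Comp X B A A e m = m" "Comp X B B A m d = m"
    and r: "r \<in> Hom X A B" "Comp X A B B d r = r"
    by (simp_all add: Kr_Hom_iff)
  show "r \<in> Hom X A B" "Comp X A B B d r = r" by fact+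
  have "Comp X B B B d (Rst X B A m) = d"
    using Rst_Comp_Rst[of B A B m r] rm ob B m r by simp
  moreover have "Comp X B B B (Rst X B A m) d = Rst X B A m"
    using Rst_Comp_idempotent[of B A m d] ob B m by simp
  ultimately have "Rst X B A m = d"
    using restriction_idempotent_commute[OF B restriction_idempotent_Rst[OF B(1) ob(1) m(1)]] by simp
  then show "m \<in> Hom \<T> (B, d) (A, e)" using ob B m by simp
qed

lemma Mon_T_D:
  assumes "A \<in> Ob X" "idem A e" "m \<in> Mon \<T> (B, d) (A, e)"
  obtains r where "B \<in> Ob X" "idem B d" "r \<in> Hom X A B" "Comp X A B B d r = r"
    "m \<in> Hom \<T> (B, d) (A, e)" "Comp X B A B r m = d"
    "idem A (Comp X A B A m r)" "Comp X A A A e (Comp X A B A m r) = Comp X A B A m r"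
proof -
  obtain \<epsilon> r where i: "restriction_idempotent (K\<^sub>r X) (A, e) \<epsilon>"
    and s: "splitting (K\<^sub>r X) (A, e) \<epsilon> (B, d) m r"
    using assms by (auto simp: MTotal_def restriction_monic_def)
  note f = splitting_in_Kr[OF assms(1,2) s]
  have "\<epsilon> \<in> Hom (K\<^sub>r X) (A, e) (A, e)" "Rst X A A \<epsilon> = \<epsilon>"
    using i by (simp_all add: Kr_idempotent_iff)
  then have "idem A \<epsilon>" "Comp X A A A e \<epsilon> = \<epsilon>"
    using assms(1,2) by (simp_all add: Kr_Hom_iff restriction_idempotentI)
  with f that show thesis by blast
qed

text \<open>
  If \<open>g = m h\<close> then \<open>m r\<close> fixes \<open>g\<close>, since \<open>r m\<close> is an identity. Conversely the factor is \<open>r g\<close>, whose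
  domain is that of \<open>g\<close> because \<open>m\<close> is total.
\<close>

lemma factors_iff_idempotent:
  assumes ob: "A \<in> Ob X" "idem A e" "B \<in> Ob X" "idem B d"
    and r: "r \<in> Hom X A B" "Comp X A B B d r = r"
    and m: "m \<in> Hom \<T> (B, d) (A, e)" and rm: "Comp X B A B r m = d"
    and D: "(D, c) \<in> Ob \<T>" and g: "g \<in> Hom \<T> (D, c) (A, e)"
  shows "g \<in> Comp X D B A m ` Hom \<T> (D, c) (B, d) \<longleftrightarrow> Comp X D A A (Comp X A B A m r) g = g"
proof
  assume "g \<in> Comp X D B A m ` Hom \<T> (D, c) (B, d)"
  then obtain h where h: "h \<in> Hom \<T> (D, c) (B, d)" and "g = Comp X D B A m h" by blast
  moreover have "Comp X D A A (Comp X A B A m r) (Comp X D B A m h)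
      = Comp X D B A m (Comp X D B B (Comp X B A B r m) h)"
    using h m r D ob by (simp add: Comp_assoc)
  ultimately show "Comp X D A A (Comp X A B A m r) g = g"
    using rm D ob by simp
next
  assume eq: "Comp X D A A (Comp X A B A m r) g = g"
  have eq': "Comp X D B A m (Comp X D A B r g) = g"
    using eq g m r D ob by (simp add: Comp_assoc)
  have "Comp X D B B d (Comp X D A B r g) = Comp X D A B r g"
    using g r D ob by (simp add: Comp_assoc)
  moreover have "Rst X D B (Comp X D A B r g) = c"
    using Rst_Rst_Comp[of D B A "Comp X D A B r g" m] eq' m r g D ob calculation by simp
  ultimately have "Comp X D A B r g \<in> Hom \<T> (D, c) (B, d)"
    using g r D ob by simp
  with eq' show "g \<in> Comp X D B A m ` Hom \<T> (D, c) (B, d)" by force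
qed

section \<open>Domains of definition\<close>

text \<open>
  \<open>domain_at P S A e x e'\<close>: the restriction of \<open>x\<close> to \<open>e'\<close> is the largest restriction of \<open>x\<close> that
  satisfies \<open>S\<close>. The condition involves all the maps into \<open>(A, e)\<close> and not just the inclusions of
  smaller idempotents, so \<open>e'\<close> classifies the whole sieve of maps along which \<open>x\<close> satisfies \<open>S\<close>.
\<close>

definition domain_at ::
  "('o \<times> 'u, 'u) presheaf \<Rightarrow> ('o \<times> 'u \<Rightarrow> 'u \<Rightarrow> bool) \<Rightarrow> 'o \<Rightarrow> 'u \<Rightarrow> 'u \<Rightarrow> 'u \<Rightarrow> bool" where
  "domain_at P S A e x e' \<longleftrightarrow> idem A e' \<and> Comp X A A A e e' = e' \<and>
    (\<forall>B d g. (B, d) \<in> Ob \<T> \<longrightarrow> g \<in> Hom \<T> (B, d) (A, e) \<longrightarrow>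
      S (B, d) (act P (B, d) (A, e) x g) \<longleftrightarrow> Comp X B A A e' g = g)"

lemma domain_atD:
  assumes "A \<in> Ob X" "idem A e" "domain_at P S A e x e'"
  shows "idem A e'" "Comp X A A A e e' = e'" "Comp X A A A e' e = e'"
    "e' \<in> Hom \<T> (A, e') (A, e)" "S (A, e') (act P (A, e') (A, e) x e')"
    "\<And>B d g. \<lbrakk>B \<in> Ob X; idem B d; g \<in> Hom \<T> (B, d) (A, e)\<rbrakk> \<Longrightarrow>
      S (B, d) (act P (B, d) (A, e) x g) \<longleftrightarrow> Comp X B A A e' g = g"
proof -
  show *: "idem A e'" "Comp X A A A e e' = e'"
    using assms by (auto simp: domain_at_def)
  show "Comp X A A A e' e = e'" using * restriction_idempotent_commute assms by metis
  show h: "e' \<in> Hom \<T> (A, e') (A, e)" using * assms by simp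
  show **: "\<And>B d g. \<lbrakk>B \<in> Ob X; idem B d; g \<in> Hom \<T> (B, d) (A, e)\<rbrakk> \<Longrightarrow>
      S (B, d) (act P (B, d) (A, e) x g) \<longleftrightarrow> Comp X B A A e' g = g"
    using assms unfolding domain_at_def by simp
  show "S (A, e') (act P (A, e') (A, e) x e')"
    using **[OF assms(1) *(1) h] * assms(1) by simp
qed

lemma domain_at_unique:
  assumes "A \<in> Ob X" "idem A e" "domain_at P S A e x e1" "domain_at P S A e x e2"
  shows "e1 = e2"
proof -
  note 1 = domain_atD[OF assms(1,2,3)] and 2 = domain_atD[OF assms(1,2,4)]
  have "Comp X A A A e2 e1 = e1" "Comp X A A A e1 e2 = e2"
    using 1(5) 2(6)[OF assms(1) 1(1,4)] 2(5) 1(6)[OF assms(1) 2(1,4)] by simp_all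
  then show ?thesis using restriction_idempotent_commute[OF assms(1) 1(1) 2(1)] by simp
qed

lemma domain_at_self:
  assumes "P \<in> Ob T.Psh" "A \<in> Ob X" "idem A e" "x \<in> FOb P (A, e)" "domain_at P S A e x e'"
  shows "S (A, e) x \<longleftrightarrow> e' = e"
  using domain_atD(3)[OF assms(2,3,5)] domain_atD(6)[OF assms(2,3,5), of A e e]
    T.act_Id[OF assms(1), of "(A, e)" x] assms(2-4) by simp

section \<open>Partial maps of presheaves and their graphs\<close>

abbreviation PM where "PM \<equiv> PSh\<^sub>M small \<T>"

lemma PM_simps [simp]:
  "Ob PM = Ob T.Psh" "Hom PM = Hom T.Psh" "Comp PM = Comp T.Psh" "Id PM = Id T.Psh"
  "is_iso PM = is_iso T.Psh" "is_pullback PM = is_pullback T.Psh"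
  by (simp_all add: PSh\<^sub>M_def category.defs is_iso_def is_pullback_def fun_eq_iff)

text \<open>
  For a transformation into \<open>Q\<close> to be a chosen monic, pulling it back along the element \<open>x \<in> Q (A, e)\<close>
  has to give the inclusion of some \<open>e' \<le> e\<close>, up to isomorphism. Since pullbacks are pointwise, this
  says that the transformation is injective and that \<open>e'\<close> classifies the sieve of maps along which
  \<open>x\<close> lies in the image.
\<close>

lemma Mon_PM_iff:
  assumes [simp]: "P \<in> Ob T.Psh" "Q \<in> Ob T.Psh"
  shows "\<mu> \<in> Mon PM P Q \<longleftrightarrow> \<mu> \<in> Hom T.Psh P Q \<and> T.injective P \<mu> \<and>
    (\<forall>A\<in>Ob X. \<forall>e x. idem A e \<longrightarrow> x \<in> FOb Q (A, e) \<longrightarrow>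
      (\<exists>e'. domain_at Q (\<lambda>D y. y \<in> \<mu> D ` FOb P D) A e x e'))"
  (is "?L \<longleftrightarrow> _ \<and> _ \<and> ?R")
proof (intro iffI conjI; (elim conjE)?)
  assume L: ?L
  then show \<mu>: "\<mu> \<in> Hom T.Psh P Q" by (simp add: PSh\<^sub>M_def category.defs)
  have pb: "\<exists>B d m \<delta>. (B, d) \<in> Ob \<T> \<and> m \<in> Mon \<T> (B, d) D \<and> is_pullback T.Psh (representable \<T> D) P Q
      (T.of_element Q D x) \<mu> (representable \<T> (B, d)) (FMap (yoneda \<T>) (B, d) D m) \<delta>"
    if "D \<in> Ob \<T>" "x \<in> FOb Q D" for D x
  proof -
    have "\<exists>B\<in>Ob \<T>. \<exists>m\<in>Mon \<T> B D. \<exists>\<delta>. is_pullback T.Psh (representable \<T> D) P Q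
        (T.of_element Q D x) \<mu> (representable \<T> B) (FMap (yoneda \<T>) B D m) \<delta>"
      using L T.of_element_in_Hom[OF assms(2) that] that unfolding PSh\<^sub>M_def category.defs by simp
    then show ?thesis by (metis surj_pair)
  qed
  show "T.injective P \<mu>"
    unfolding T.injective_def
  proof (intro ballI inj_onI)
    fix D z1 z2
    assume D: "D \<in> Ob \<T>" and z: "z1 \<in> FOb P D" "z2 \<in> FOb P D" and eq: "\<mu> D z1 = \<mu> D z2"
    obtain A e where [simp]: "D = (A, e)" by (metis surj_pair)
    have x: "\<mu> D z1 \<in> FOb Q D" using T.nat_in[of P Q \<mu> D z1] \<mu> D z by simp
    obtain B d m \<delta> where B: "(B, d) \<in> Ob \<T>" and m: "m \<in> Mon \<T> (B, d) D"
      and p: "is_pullback T.Psh (representable \<T> D) P Q (T.of_element Q D (\<mu> D z1)) \<mu>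
        (representable \<T> (B, d)) (FMap (yoneda \<T>) (B, d) D m) \<delta>"
      using pb[OF D x] by blast
    obtain r where r: "r \<in> Hom X A B" "Comp X B A B r m = d" and mH: "m \<in> Hom \<T> (B, d) (A, e)"
      using Mon_T_D[of A e m B d thesis] m D by simp
    have c: "\<exists>c. c \<in> Hom \<T> D (B, d) \<and> FMap (yoneda \<T>) (B, d) D m D c = e \<and> \<delta> D c = z"
      if "z \<in> FOb P D" "\<mu> D z = \<mu> D z1" for z
      by (rule T.pullback_element[OF p D, of e z]) (use D that x T.act_Id[OF _ D x] in auto)
    obtain c1 where c1: "c1 \<in> Hom \<T> D (B, d)" "FMap (yoneda \<T>) (B, d) D m D c1 = e" "\<delta> D c1 = z1"
      using c[OF z(1)] by auto
    obtain c2 where c2: "c2 \<in> Hom \<T> D (B, d)" "FMap (yoneda \<T>) (B, d) D m D c2 = e" "\<delta> D c2 = z2"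
      using c[OF z(2)] eq by auto
    have "c1 = Comp X A B B (Comp X B A B r m) c1"
      using c1(1) B D r by simp
    also have "\<dots> = Comp X A A B r (Comp X A B A m c1)"
      using c1(1) B D r(1) mH by (simp add: Comp_assoc)
    also have "\<dots> = Comp X A A B r (Comp X A B A m c2)"
      using c1 c2 D by simp
    also have "\<dots> = Comp X A B B (Comp X B A B r m) c2"
      using c2(1) B D r(1) mH by (simp add: Comp_assoc)
    also have "\<dots> = c2" using c2(1) B D r by simp
    finally show "z1 = z2" using c1 c2 by simp
  qed
  show ?R
  proof (intro ballI allI impI)
    fix A e x
    assume A: "A \<in> Ob X" "idem A e" and x: "x \<in> FOb Q (A, e)"
    then have D: "(A, e) \<in> Ob \<T>" by simp
    obtain B d m \<delta> where B: "(B, d) \<in> Ob \<T>" and m: "m \<in> Mon \<T> (B, d) (A, e)"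
      and p: "is_pullback T.Psh (representable \<T> (A, e)) P Q (T.of_element Q (A, e) x) \<mu>
        (representable \<T> (B, d)) (FMap (yoneda \<T>) (B, d) (A, e) m) \<delta>"
      using pb[OF D x] by blast
    obtain r where r: "B \<in> Ob X" "idem B d" "r \<in> Hom X A B" "Comp X A B B d r = r"
      "m \<in> Hom \<T> (B, d) (A, e)" "Comp X B A B r m = d"
      "idem A (Comp X A B A m r)" "Comp X A A A e (Comp X A B A m r) = Comp X A B A m r"
      using Mon_T_D[OF A m] by metis
    have "act Q (D, c) (A, e) x g \<in> \<mu> (D, c) ` FOb P (D, c)
        \<longleftrightarrow> Comp X D A A (Comp X A B A m r) g = g"
      if Dc: "(D, c) \<in> Ob \<T>" and g: "g \<in> Hom \<T> (D, c) (A, e)" for D c g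
    proof -
      have "act Q (D, c) (A, e) x g \<in> \<mu> (D, c) ` FOb P (D, c)
        \<longleftrightarrow> g \<in> Comp X D B A m ` Hom \<T> (D, c) (B, d)"
      proof
        assume "act Q (D, c) (A, e) x g \<in> \<mu> (D, c) ` FOb P (D, c)"
        then obtain z where "z \<in> FOb P (D, c)" "act Q (D, c) (A, e) x g = \<mu> (D, c) z" by auto
        then have "\<exists>h. h \<in> Hom \<T> (D, c) (B, d) \<and> FMap (yoneda \<T>) (B, d) (A, e) m (D, c) h = g"
          using p[unfolded T.is_pullback_Psh_iff] Dc g
          by (metis T.FOb_representable T.of_element_app)
        then obtain h where "h \<in> Hom \<T> (D, c) (B, d)" "FMap (yoneda \<T>) (B, d) (A, e) m (D, c) h = g"
          by blast
        then show "g \<in> Comp X D B A m ` Hom \<T> (D, c) (B, d)"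
          using T.yoneda_app[OF Dc, of h "(B, d)" "(A, e)" m] by (metis T_Comp image_eqI)
      next
        assume "g \<in> Comp X D B A m ` Hom \<T> (D, c) (B, d)"
        then obtain h where h: "h \<in> Hom \<T> (D, c) (B, d)" and hg: "Comp X D B A m h = g" by blast
        then have "T.of_element Q (A, e) x (D, c) (FMap (yoneda \<T>) (B, d) (A, e) m (D, c) h)
            = \<mu> (D, c) (\<delta> (D, c) h)"
          using p[unfolded T.is_pullback_Psh_iff] Dc by (metis T.FOb_representable)
        moreover have "\<delta> (D, c) h \<in> FOb P (D, c)"
          using p[unfolded T.is_pullback_Psh_iff] Dc h
            T.nat_in[of "representable \<T> (B, d)" P \<delta> "(D, c)" h] by simp
        ultimately show "act Q (D, c) (A, e) x g \<in> \<mu> (D, c) ` FOb P (D, c)"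
          using T.yoneda_app[OF Dc h, of "(A, e)" m] T.of_element_app[OF Dc g] hg by auto
      qed
      then show ?thesis using factors_iff_idempotent[OF A r(1-6) Dc g] by simp
    qed
    then have "domain_at Q (\<lambda>D y. y \<in> \<mu> D ` FOb P D) A e x (Comp X A B A m r)"
      unfolding domain_at_def using r by blast
    then show "\<exists>e'. domain_at Q (\<lambda>D y. y \<in> \<mu> D ` FOb P D) A e x e'" by blast
  qed
next
  assume \<mu>: "\<mu> \<in> Hom T.Psh P Q" and inj: "T.injective P \<mu>" and R: ?R
  have "\<exists>B\<in>Ob \<T>. \<exists>m\<in>Mon \<T> B D. \<exists>\<delta>. is_pullback T.Psh (representable \<T> D) P Q \<gamma> \<mu>
        (representable \<T> B) (FMap (yoneda \<T>) B D m) \<delta>"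
    if D: "D \<in> Ob \<T>" and \<gamma>: "\<gamma> \<in> Hom T.Psh (representable \<T> D) Q" for D \<gamma>
  proof -
    obtain A e where [simp]: "D = (A, e)" by (metis surj_pair)
    have A: "A \<in> Ob X" "idem A e" using D by auto
    define x where "x = \<gamma> D (Id \<T> D)"
    have x: "x \<in> FOb Q (A, e)"
      using T.nat_in[of "representable \<T> D" Q \<gamma> D e] D \<gamma> T.Id_in_Hom[OF D] by (simp add: x_def)
    have \<gamma>x: "\<gamma> K k = act Q K D x k" if "K \<in> Ob \<T>" "k \<in> Hom \<T> K D" for K k
      using T.representable_nat_app[of Q D \<gamma> K k] that D \<gamma> by (simp add: x_def)
    obtain e' where dom: "domain_at Q (\<lambda>D y. y \<in> \<mu> D ` FOb P D) A e x e'" using R A x by blast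
    note d = domain_atD[OF A dom]
    obtain z where z: "z \<in> FOb P (A, e')" "\<mu> (A, e') z = act Q (A, e') (A, e) x e'"
      using d(5) by auto
    let ?y = "FMap (yoneda \<T>) (A, e') D e'" and ?z = "T.of_element P (A, e') z"
    have B: "(A, e') \<in> Ob \<T>" using A d by simp
    have "is_pullback T.Psh (representable \<T> D) P Q \<gamma> \<mu> (representable \<T> (A, e')) ?y ?z"
      unfolding T.is_pullback_Psh_iff
    proof (intro conjI ballI impI)
      show "?y \<in> Hom T.Psh (representable \<T> (A, e')) (representable \<T> D)"
        using B D d by simp
      show "?z \<in> Hom T.Psh (representable \<T> (A, e')) P"
        using B z by simp
      fix I assume I: "I \<in> Ob \<T>"
      obtain K k where [simp]: "I = (K, k)" by (metis surj_pair)
      show "\<gamma> I (?y I c) = \<mu> I (?z I c)" if "c \<in> FOb (representable \<T> (A, e')) I" for c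
      proof -
        have c: "c \<in> Hom \<T> I (A, e')" using that I by simp
        have "\<gamma> I (?y I c) = act Q I D x (Comp \<T> I (A, e') D e' c)"
          using \<gamma>x[OF I] T.Comp_in_Hom[OF I B D c] d(4) T.yoneda_app[OF I c] by simp
        also have "\<dots> = act Q I (A, e') (act Q (A, e') D x e') c"
          by (rule T.act_Comp) (use B D I c d(4) x in simp_all)
        also have "\<dots> = \<mu> I (?z I c)"
          using z T.nat_act[of P Q \<mu> "(A, e')" I c z] \<mu> B I c by simp
        finally show ?thesis .
      qed
      fix a b
      assume a: "a \<in> FOb (representable \<T> D) I" and b: "b \<in> FOb P I" and ab: "\<gamma> I a = \<mu> I b"
      have aH: "a \<in> Hom \<T> (K, k) (A, e)" using a I by simp
      have "act Q (K, k) (A, e) x a \<in> \<mu> (K, k) ` FOb P (K, k)"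
        by (rule image_eqI[of _ _ b]) (use ab b \<gamma>x[OF I, of a] a I in simp_all)
      then have ea: "Comp X K A A e' a = a" using d(6)[of K k a] I aH by simp
      have aH': "a \<in> Hom \<T> I (A, e')" using aH ea I A d by simp
      show "\<exists>!c. c \<in> FOb (representable \<T> (A, e')) I \<and> ?y I c = a \<and> ?z I c = b"
      proof (intro ex1I conjI)
        show "a \<in> FOb (representable \<T> (A, e')) I" using aH' I by simp
        show ya: "?y I a = a" using T.yoneda_app[OF I aH'] ea by simp
        have "\<mu> I (?z I a) = act Q I (A, e') (act Q (A, e') D x e') a"
          using z T.nat_act[of P Q \<mu> "(A, e')" I a z] \<mu> B I aH' by simp
        also have "\<dots> = act Q I D x (Comp \<T> I (A, e') D e' a)"
          by (rule T.act_Comp[symmetric]) (use B D I aH' d(4) x in simp_all)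
        also have "\<dots> = \<mu> I b" using ea \<gamma>x[OF I, of a] aH ab by simp
        finally have "\<mu> I (?z I a) = \<mu> I b" .
        moreover have "?z I a \<in> FOb P I"
          using T.act_in[of P "(A, e')" I a z] z(1) B I aH' by simp
        ultimately show "?z I a = b" using b by (rule T.injectiveD[OF inj I])
        show "c = a" if c: "c \<in> FOb (representable \<T> (A, e')) I \<and> ?y I c = a \<and> ?z I c = b" for c
        proof -
          have cH: "c \<in> Hom \<T> I (A, e')" using c I by simp
          then have "Comp X K A A e' c = c" using I A d by simp
          then show ?thesis using c T.yoneda_app[OF I cH] by simp
        qed
      qed
    qed (use \<mu> \<gamma> D B in simp_all)
    moreover have "e' \<in> Mon \<T> (A, e') D" using idempotent_in_Mon A d by simp
    ultimately show ?thesis using B by blast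
  qed
  then show ?L using \<mu> by (simp add: PSh\<^sub>M_def category.defs)
qed

text \<open>
  The image of \<open>m\<close> is cut out by the idempotent \<open>m r\<close>, so the sieve of maps along which an element
  \<open>x\<close> of the representable presheaf factors through \<open>m\<close> is classified by the domain of \<open>m r x\<close>.
\<close>

lemma yoneda_in_Mon_PM:
  assumes A: "A \<in> Ob X" "idem A e" and m: "m \<in> Mon \<T> (B, d) (A, e)"
  shows "FMap (yoneda \<T>) (B, d) (A, e) m \<in> Mon PM (representable \<T> (B, d)) (representable \<T> (A, e))"
proof -
  obtain r where r: "B \<in> Ob X" "idem B d" "r \<in> Hom X A B" "Comp X A B B d r = r"
    "m \<in> Hom \<T> (B, d) (A, e)" "Comp X B A B r m = d"
    "idem A (Comp X A B A m r)" "Comp X A A A e (Comp X A B A m r) = Comp X A B A m r"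
    using Mon_T_D[OF A m] by metis
  have D: "(A, e) \<in> Ob \<T>" "(B, d) \<in> Ob \<T>" using A r by simp_all
  let ?\<mu> = "FMap (yoneda \<T>) (B, d) (A, e) m" and ?\<epsilon> = "Comp X A B A m r"
  have app: "?\<mu> (K, k) h = Comp X K B A m h" if "(K, k) \<in> Ob \<T>" "h \<in> Hom \<T> (K, k) (B, d)" for K k h
    using T.yoneda_app[OF that] by simp
  have "T.injective (representable \<T> (B, d)) ?\<mu>"
    unfolding T.injective_def
  proof (intro ballI inj_onI)
    fix I h1 h2
    assume I: "I \<in> Ob \<T>" and h: "h1 \<in> FOb (representable \<T> (B, d)) I" "h2 \<in> FOb (representable \<T> (B, d)) I"
      and eq: "?\<mu> I h1 = ?\<mu> I h2"
    obtain K k where [simp]: "I = (K, k)" by (metis surj_pair)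
    have hH: "h1 \<in> Hom \<T> (K, k) (B, d)" "h2 \<in> Hom \<T> (K, k) (B, d)" using h I by simp_all
    have "Comp X K B B (Comp X B A B r m) h1 = Comp X K B B (Comp X B A B r m) h2"
    proof -
      have "Comp X K A B r (Comp X K B A m h1) = Comp X K A B r (Comp X K B A m h2)"
        using eq app hH I by simp
      then show ?thesis using hH I r(1-5) A by (simp add: Comp_assoc)
    qed
    then show "h1 = h2" using hH I r by simp
  qed
  moreover have "\<exists>e'. domain_at (representable \<T> (A, e))
      (\<lambda>I y. y \<in> ?\<mu> I ` FOb (representable \<T> (B, d)) I) K k x e'"
    if K: "K \<in> Ob X" "idem K k" and x: "x \<in> FOb (representable \<T> (A, e)) (K, k)" for K k x
  proof -
    have xH: "x \<in> Hom \<T> (K, k) (A, e)" using x K by simp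
    let ?e' = "Rst X K A (Comp X K A A ?\<epsilon> x)"
    have "domain_at (representable \<T> (A, e)) (\<lambda>I y. y \<in> ?\<mu> I ` FOb (representable \<T> (B, d)) I) K k x ?e'"
      unfolding domain_at_def
    proof (intro conjI allI impI)
      show "idem K ?e'" using K A r xH by (simp add: restriction_idempotent_Rst)
      then show "Comp X K K K k ?e' = ?e'"
        using Rst_Comp_Rst[of K A A x ?\<epsilon>] K A xH r restriction_idempotent_commute[of K k ?e'] by simp
      fix J j g assume J: "(J, j) \<in> Ob \<T>" and g: "g \<in> Hom \<T> (J, j) (K, k)"
      have KT: "(K, k) \<in> Ob \<T>" using K by simp
      have xg: "Comp X J K A x g \<in> Hom \<T> (J, j) (A, e)"
        using T.Comp_in_Hom[OF J KT D(1) g xH] by simp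
      have act_eq: "act (representable \<T> (A, e)) (J, j) (K, k) x g = Comp X J K A x g"
        using T.act_representable[OF KT J g xH] by simp
      have im_eq: "?\<mu> (J, j) ` FOb (representable \<T> (B, d)) (J, j) = Comp X J B A m ` Hom \<T> (J, j) (B, d)"
        using app[OF J] J by simp
      have "Comp X J K A x g \<in> Comp X J B A m ` Hom \<T> (J, j) (B, d)
          \<longleftrightarrow> Comp X J A A ?\<epsilon> (Comp X J K A x g) = Comp X J K A x g"
        by (rule factors_iff_idempotent[OF A r(1-6) J xg])
      also have "\<dots> \<longleftrightarrow> Comp X J K K ?e' g = g"
        by (rule idempotent_fixes_Comp_iff) (use g xH J K A r in simp_all)
      finally show "act (representable \<T> (A, e)) (J, j) (K, k) x g \<in> ?\<mu> (J, j) ` FOb (representable \<T> (B, d)) (J, j)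
          \<longleftrightarrow> Comp X J K K ?e' g = g"
        unfolding act_eq im_eq .
    qed
    then show ?thesis by blast
  qed
  ultimately show ?thesis
    unfolding Mon_PM_iff[OF T.representable_in_Ob[OF D(2)] T.representable_in_Ob[OF D(1)]]
    using T.yoneda_in_Hom[OF D(2,1) r(5)] by blast
qed

section \<open>Restriction presheaves\<close>


abbreviation RP where "RP \<equiv> PSh\<^sub>r small X"

lemma RP_simps:
  "Hom RP P Q = Hom X.Psh (fst P) (fst Q)" "Id RP P = Id X.Psh (fst P)"
  "Comp RP P Q R = Comp X.Psh (fst P) (fst Q) (fst R)"
  by (simp_all add: PSh\<^sub>r_def)

lemma RP_Rst_eq:
  "Rst RP P Q \<alpha> = (\<lambda>A\<in>Ob X. \<lambda>x\<in>FOb (fst P) A. act (fst P) A A x (snd Q A (\<alpha> A x)))"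
  by (simp add: PSh\<^sub>r_def)

lemma RP_Rst_app:
  "\<lbrakk>A \<in> Ob X; x \<in> FOb (fst P) A\<rbrakk> \<Longrightarrow> Rst RP P Q \<alpha> A x = act (fst P) A A x (snd Q A (\<alpha> A x))"
  by (simp add: RP_Rst_eq)

lemma RP_Ob_iff: "P \<in> Ob RP \<longleftrightarrow> restriction_presheaf small X (fst P, snd P)"
  by (simp add: PSh\<^sub>r_def)

lemma RP_presheaf [simp]: "P \<in> Ob RP \<Longrightarrow> fst P \<in> Ob X.Psh"
  unfolding RP_Ob_iff restriction_presheaf_def case_prod_conv by blast

context
  fixes P :: "('o, 'u) rpresheaf" and A x
  assumes P: "P \<in> Ob RP" and A: "A \<in> Ob X" and x: "x \<in> FOb (fst P) A"
begin

lemma rho_idem [simp]: "idem A (snd P A x)"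
  using P A x unfolding RP_Ob_iff restriction_presheaf_def case_prod_conv by blast

lemma act_rho [simp]: "act (fst P) A A x (snd P A x) = x"
  using P A x unfolding RP_Ob_iff restriction_presheaf_def case_prod_conv by blast

lemma rho_act_idem: "idem A e \<Longrightarrow> snd P A (act (fst P) A A x e) = Comp X A A A (snd P A x) e"
  using P A x unfolding RP_Ob_iff restriction_presheaf_def case_prod_conv by blast

lemma rho_Comp:
  "\<lbrakk>B \<in> Ob X; g \<in> Hom X B A\<rbrakk>
    \<Longrightarrow> Comp X B A A (snd P A x) g = Comp X B B A g (snd P B (act (fst P) B A x g))"
  using P A x unfolding RP_Ob_iff restriction_presheaf_def case_prod_conv by blast

end

text \<open>
  Write \<open>d\<close> for the idempotent of the restricted element. By (A3) the map on the right is \<open>g d\<close>, so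
  its restriction is the meet of \<open>d\<close> and the restriction of \<open>g\<close>. That meet is \<open>d\<close>: by (A2), because
  the restricted element does not change when it is restricted further to the domain of \<open>g\<close>.
\<close>

lemma rho_act:
  assumes "P \<in> Ob RP" "A \<in> Ob X" "x \<in> FOb (fst P) A" "B \<in> Ob X" "g \<in> Hom X B A"
  shows "snd P B (act (fst P) B A x g) = Rst X B A (Comp X B A A (snd P A x) g)"
proof -
  let ?y = "act (fst P) B A x g"
  have y: "?y \<in> FOb (fst P) B" using assms by simp
  have i: "idem B (snd P B ?y)" using assms y by simp
  have "act (fst P) B B ?y (Rst X B A g) = ?y"
    using X.act_Comp[of "fst P" A B B g "Rst X B A g" x] assms by simp
  then have "snd P B ?y = Comp X B B B (snd P B ?y) (Rst X B A g)"
    using rho_act_idem[OF assms(1,4) y restriction_idempotent_Rst[OF assms(4,2,5)]] by simp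
  also have "\<dots> = Comp X B B B (Rst X B A g) (snd P B ?y)"
    using restriction_idempotent_commute[OF assms(4) i] restriction_idempotent_Rst assms by simp
  also have "\<dots> = Rst X B A (Comp X B B A g (snd P B ?y))"
    using Rst_Comp_idempotent[of B A g "snd P B ?y"] i assms by simp
  also have "\<dots> = Rst X B A (Comp X B A A (snd P A x) g)"
    using rho_Comp[OF assms(1-5)] by simp
  finally show ?thesis .
qed

lemma RP_Rst_in_Hom:
  assumes "P \<in> Ob RP" "Q \<in> Ob RP" "\<alpha> \<in> Hom X.Psh (fst P) (fst Q)"
  shows "Rst RP P Q \<alpha> \<in> Hom X.Psh (fst P) (fst P)"
  unfolding RP_Rst_eq
proof (rule X.make_nat)
  have \<alpha>: "\<alpha> A x \<in> FOb (fst Q) A" if "A \<in> Ob X" "x \<in> FOb (fst P) A" for A x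
    using X.nat_in[OF _ _ assms(3)] assms that by simp
  show "act (fst P) A A x (snd Q A (\<alpha> A x)) \<in> FOb (fst P) A" if "A \<in> Ob X" "x \<in> FOb (fst P) A" for A x
    using \<alpha> assms that by simp
  show "act (fst P) B B (act (fst P) B A x g) (snd Q B (\<alpha> B (act (fst P) B A x g)))
      = act (fst P) B A (act (fst P) A A x (snd Q A (\<alpha> A x))) g"
    if *: "A \<in> Ob X" "B \<in> Ob X" "g \<in> Hom X B A" "x \<in> FOb (fst P) A" for A B g x
  proof -
    have q: "\<alpha> A x \<in> FOb (fst Q) A" by (rule \<alpha>) fact+
    have n: "\<alpha> B (act (fst P) B A x g) = act (fst Q) B A (\<alpha> A x) g"
      using X.nat_act[OF _ _ assms(3)] assms * by simp
    have "idem B (snd Q B (act (fst Q) B A (\<alpha> A x) g))" using assms * q by simp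
    then show ?thesis
      unfolding n using * assms q rho_Comp[OF assms(2) *(1) q *(2,3)]
      by (simp flip: X.act_Comp)
  qed
qed (use assms in simp_all)

text \<open>
  Naturality and (A2) turn the domain of \<open>\<beta>\<close> at a restricted element into a meet of idempotents. Since
  meets are commutative, this yields both (R2) and (R3).
\<close>

lemma RP_Rst_meet:
  assumes P: "P \<in> Ob RP" and Q: "Q \<in> Ob RP" and R: "R \<in> Ob RP"
    and \<alpha>: "\<alpha> \<in> Hom X.Psh (fst P) (fst Q)" and \<beta>: "\<beta> \<in> Hom X.Psh (fst P) (fst R)"
    and A: "A \<in> Ob X" and x: "x \<in> FOb (fst P) A"
  defines "e \<equiv> snd Q A (\<alpha> A x)" and "d \<equiv> snd R A (\<beta> A x)"
  shows "snd R A (\<beta> A (act (fst P) A A x e)) = Comp X A A A d e"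
    and "Rst RP P R \<beta> A (Rst RP P Q \<alpha> A x) = act (fst P) A A x (Comp X A A A d e)"
proof -
  have a: "\<alpha> A x \<in> FOb (fst Q) A" and b: "\<beta> A x \<in> FOb (fst R) A"
    using X.nat_in[OF _ _ \<alpha> A x] X.nat_in[OF _ _ \<beta> A x] P Q R by simp_all
  have i: "idem A e" "idem A d" using Q R A a b by (simp_all add: e_def d_def)
  show 1: "snd R A (\<beta> A (act (fst P) A A x e)) = Comp X A A A d e"
    using X.nat_act[OF _ _ \<beta> A A _ x, of e] i rho_act_idem[OF R A b i(1)] P R by (simp add: d_def)
  have "act (fst P) A A x e \<in> FOb (fst P) A" using P A x i by simp
  then have "Rst RP P R \<beta> A (Rst RP P Q \<alpha> A x) = act (fst P) A A (act (fst P) A A x e) (Comp X A A A d e)"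
    using A x 1 by (simp add: RP_Rst_app e_def)
  also have "\<dots> = act (fst P) A A x (Comp X A A A e (Comp X A A A d e))"
    using P A x i by (intro X.act_Comp[symmetric]) simp_all
  finally show "Rst RP P R \<beta> A (Rst RP P Q \<alpha> A x) = act (fst P) A A x (Comp X A A A d e)"
    using idempotent_absorb[OF A i] by simp
qed

lemma restriction_category_RP: "restriction_category RP"
proof
  fix P assume "P \<in> Ob RP"
  then show "Id RP P \<in> Hom RP P P" by (simp add: RP_simps)
next
  fix P Q R \<alpha> \<beta>
  assume "P \<in> Ob RP" "Q \<in> Ob RP" "R \<in> Ob RP" "\<alpha> \<in> Hom RP P Q" "\<beta> \<in> Hom RP Q R"
  then show "Comp RP P Q R \<beta> \<alpha> \<in> Hom RP P R" by (simp add: RP_simps)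
next
  fix P Q \<alpha>
  assume *: "P \<in> Ob RP" "Q \<in> Ob RP" "\<alpha> \<in> Hom RP P Q"
  then show "Comp RP P P Q \<alpha> (Id RP P) = \<alpha>" "Comp RP P Q Q (Id RP Q) \<alpha> = \<alpha>"
    by (simp_all add: RP_simps)
  show R: "Rst RP P Q \<alpha> \<in> Hom RP P P" using * RP_Rst_in_Hom by (simp add: RP_simps)
  have "Comp RP P P Q \<alpha> (Rst RP P Q \<alpha>) A x = \<alpha> A x" if Ax: "A \<in> Ob X" "x \<in> FOb (fst P) A" for A x
  proof -
    have q: "\<alpha> A x \<in> FOb (fst Q) A" using X.nat_in[of "fst P" "fst Q" \<alpha>] * Ax by (simp add: RP_simps)
    have "idem A (snd Q A (\<alpha> A x))" using * Ax q by simp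
    then show ?thesis
      using X.nat_act[of "fst P" "fst Q" \<alpha> A A "snd Q A (\<alpha> A x)" x] * Ax q
      by (simp add: RP_simps RP_Rst_app)
  qed
  then show "Comp RP P P Q \<alpha> (Rst RP P Q \<alpha>) = \<alpha>"
    using * R by (intro X.nat_eqI[of "fst P" "fst Q"]) (simp_all add: RP_simps)
next
  fix P Q R \<alpha> \<beta>
  assume *: "P \<in> Ob RP" "Q \<in> Ob RP" "R \<in> Ob RP" "\<alpha> \<in> Hom RP P Q" "\<beta> \<in> Hom RP P R"
  have H: "\<alpha> \<in> Hom X.Psh (fst P) (fst Q)" "\<beta> \<in> Hom X.Psh (fst P) (fst R)"
    using * by (simp_all add: RP_simps)
  note RH = RP_Rst_in_Hom[OF *(1,2) H(1)] RP_Rst_in_Hom[OF *(1,3) H(2)]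
  have CR: "Comp X.Psh (fst P) (fst P) (fst R) \<beta> (Rst RP P Q \<alpha>) \<in> Hom X.Psh (fst P) (fst R)"
    using * H RH by simp
  have i: "idem A (snd Q A (\<alpha> A x))" "idem A (snd R A (\<beta> A x))" if "A \<in> Ob X" "x \<in> FOb (fst P) A" for A x
    using that * X.nat_in[OF _ _ H(1)] X.nat_in[OF _ _ H(2)] by simp_all
  show "Comp RP P P P (Rst RP P R \<beta>) (Rst RP P Q \<alpha>) = Comp RP P P P (Rst RP P Q \<alpha>) (Rst RP P R \<beta>)"
    using RP_Rst_meet(2)[OF *(1-3) H] RP_Rst_meet(2)[OF *(1,3,2) H(2,1)] i
      restriction_idempotent_commute * RH
    by (intro X.nat_eqI[of "fst P" "fst P"]) (simp_all add: RP_simps)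
  have "Rst RP P R (Comp RP P P R \<beta> (Rst RP P Q \<alpha>)) A x = Comp RP P P P (Rst RP P R \<beta>) (Rst RP P Q \<alpha>) A x"
    if Ax: "A \<in> Ob X" "x \<in> FOb (fst P) A" for A x
  proof -
    have "Rst RP P R (Comp RP P P R \<beta> (Rst RP P Q \<alpha>)) A x
        = act (fst P) A A x (snd R A (\<beta> A (act (fst P) A A x (snd Q A (\<alpha> A x)))))"
      using Ax by (simp add: RP_simps RP_Rst_app)
    also have "\<dots> = Rst RP P R \<beta> A (Rst RP P Q \<alpha> A x)"
      unfolding RP_Rst_meet[OF *(1-3) H Ax] by simp
    also have "\<dots> = Comp RP P P P (Rst RP P R \<beta>) (Rst RP P Q \<alpha>) A x"
      using Ax by (simp add: RP_simps)
    finally show ?thesis .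
  qed
  then show "Rst RP P R (Comp RP P P R \<beta> (Rst RP P Q \<alpha>)) = Comp RP P P P (Rst RP P R \<beta>) (Rst RP P Q \<alpha>)"
    using * RH RP_Rst_in_Hom[OF *(1,3) CR]
    by (intro X.nat_eqI[of "fst P" "fst P"]) (simp_all add: RP_simps)
next
  fix P Q R \<alpha> \<gamma>
  assume *: "P \<in> Ob RP" "Q \<in> Ob RP" "R \<in> Ob RP" "\<alpha> \<in> Hom RP P Q" "\<gamma> \<in> Hom RP Q R"
  have H: "\<alpha> \<in> Hom X.Psh (fst P) (fst Q)" "\<gamma> \<in> Hom X.Psh (fst Q) (fst R)"
    using * by (simp_all add: RP_simps)
  have C: "Comp X.Psh (fst P) (fst Q) (fst R) \<gamma> \<alpha> \<in> Hom X.Psh (fst P) (fst R)" using * H by simp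
  have "Comp RP P Q Q (Rst RP Q R \<gamma>) \<alpha> A x = Comp RP P P Q \<alpha> (Rst RP P R (Comp RP P Q R \<gamma> \<alpha>)) A x"
    if Ax: "A \<in> Ob X" "x \<in> FOb (fst P) A" for A x
  proof -
    have a: "\<alpha> A x \<in> FOb (fst Q) A" using X.nat_in[OF _ _ H(1)] * Ax by simp
    then have c: "\<gamma> A (\<alpha> A x) \<in> FOb (fst R) A" using X.nat_in[OF _ _ H(2)] * Ax by simp
    then have "idem A (snd R A (\<gamma> A (\<alpha> A x)))" using * Ax by simp
    then show ?thesis
      using Ax a X.nat_act[OF _ _ H(1), of A A "snd R A (\<gamma> A (\<alpha> A x))" x] *
      by (simp add: RP_simps RP_Rst_app)
  qed
  then show "Comp RP P Q Q (Rst RP Q R \<gamma>) \<alpha> = Comp RP P P Q \<alpha> (Rst RP P R (Comp RP P Q R \<gamma> \<alpha>))"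
    using * H RP_Rst_in_Hom[OF *(1,3) C] RP_Rst_in_Hom[OF *(2,3) H(2)]
    by (intro X.nat_eqI[of "fst P" "fst Q"]) (simp_all add: RP_simps)
next
  fix P Q R S \<alpha> \<beta> \<gamma>
  assume "P \<in> Ob RP" "Q \<in> Ob RP" "R \<in> Ob RP" "S \<in> Ob RP"
    "\<alpha> \<in> Hom RP P Q" "\<beta> \<in> Hom RP Q R" "\<gamma> \<in> Hom RP R S"
  then show "Comp RP P R S \<gamma> (Comp RP P Q R \<beta> \<alpha>) = Comp RP P Q S (Comp RP Q R S \<gamma> \<beta>) \<alpha>"
    by (simp add: RP_simps X.Psh.Comp_assoc)
qed

section \<open>Graphs of partial maps\<close>

type_synonym ('a, 'b) psh_span = "('a \<times> 'b, 'b) presheaf \<times> ('a \<times> 'b \<Rightarrow> 'b \<Rightarrow> 'b) \<times> ('a \<times> 'b \<Rightarrow> 'b \<Rightarrow> 'b)"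

fun graph :: "('o, 'u) psh_span \<Rightarrow> 'o \<times> 'u \<Rightarrow> 'u \<Rightarrow> 'u \<Rightarrow> bool" where
  "graph (Z, m, f) D x y \<longleftrightarrow> D \<in> Ob \<T> \<and> (\<exists>z\<in>FOb Z D. m D z = x \<and> f D z = y)"

definition par_graph :: "('o, 'u) psh_span set \<Rightarrow> 'o \<times> 'u \<Rightarrow> 'u \<Rightarrow> 'u \<Rightarrow> bool" where
  "par_graph S D x y \<longleftrightarrow> (\<exists>s\<in>S. graph s D x y)"

lemma spans_PM_iff [simp]:
  "(Z, m, f) \<in> spans PM P Q \<longleftrightarrow> Z \<in> Ob T.Psh \<and> m \<in> Mon PM Z P \<and> f \<in> Hom T.Psh Z Q"
  by (simp add: spans_def)

lemma Mon_PM_D: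
  assumes "m \<in> Mon PM P Q" "P \<in> Ob T.Psh" "Q \<in> Ob T.Psh"
  shows "m \<in> Hom T.Psh P Q" "T.injective P m"
  using assms Mon_PM_iff by blast+

text \<open>
  The left leg being injective, the vertex can be recovered from the graph up to an isomorphism that
  is compatible with both legs.
\<close>

lemma span_iso_iff_graph:
  assumes [simp]: "P \<in> Ob T.Psh" "Q \<in> Ob T.Psh"
  shows "(s, t) \<in> span_iso PM P Q \<longleftrightarrow> s \<in> spans PM P Q \<and> t \<in> spans PM P Q \<and> graph s = graph t"
proof -
  obtain Z m f Z' m' f' where st [simp]: "s = (Z, m, f)" "t = (Z', m', f')" by (metis prod_cases3)
  show ?thesis
  proof (cases "s \<in> spans PM P Q \<and> t \<in> spans PM P Q")
    case False
    then show ?thesis by (auto simp: span_iso_def)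
  next
    case True
    then have Z [simp]: "Z \<in> Ob T.Psh" "Z' \<in> Ob T.Psh"
      and f: "f \<in> Hom T.Psh Z Q" "f' \<in> Hom T.Psh Z' Q"
      and M: "m \<in> Mon PM Z P" "m' \<in> Mon PM Z' P" by auto
    note m = Mon_PM_D[OF M(1) Z(1) assms(1)] and m' = Mon_PM_D[OF M(2) Z(2) assms(1)]
    have "(\<exists>\<phi>. is_iso T.Psh Z Z' \<phi> \<and> Comp T.Psh Z Z' P m' \<phi> = m \<and> Comp T.Psh Z Z' Q f' \<phi> = f)
        \<longleftrightarrow> graph s = graph t" (is "?L = ?R")
    proof
      assume ?L
      then obtain \<phi> \<psi> where \<phi>: "\<phi> \<in> Hom T.Psh Z Z'" and \<psi>: "\<psi> \<in> Hom T.Psh Z' Z"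
        and inv: "Comp T.Psh Z' Z Z' \<phi> \<psi> = Id T.Psh Z'"
        and c: "Comp T.Psh Z Z' P m' \<phi> = m" "Comp T.Psh Z Z' Q f' \<phi> = f"
        unfolding is_iso_def by blast
      have e: "m' D (\<phi> D z) = m D z" "f' D (\<phi> D z) = f D z" if "D \<in> Ob \<T>" "z \<in> FOb Z D" for D z
        using that T.Psh_Comp_app[of D z Z Z' P m' \<phi>] T.Psh_Comp_app[of D z Z Z' Q f' \<phi>] c by simp_all
      have e': "\<phi> D (\<psi> D z) = z" if "D \<in> Ob \<T>" "z \<in> FOb Z' D" for D z
        using that T.Psh_Comp_app[of D z Z' Z Z' \<phi> \<psi>] T.Psh_Id_app[of D z Z'] inv by simp
      have n: "\<phi> D z \<in> FOb Z' D" if "D \<in> Ob \<T>" "z \<in> FOb Z D" for D z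
        using T.nat_in[OF Z \<phi>] that by blast
      have n': "\<psi> D z \<in> FOb Z D" if "D \<in> Ob \<T>" "z \<in> FOb Z' D" for D z
        using T.nat_in[OF Z(2,1) \<psi>] that by blast
      have "graph s D x y \<longleftrightarrow> graph t D x y" for D x y
        unfolding st graph.simps using e e' n n' by metis
      then show ?R by (simp add: fun_eq_iff)
    next
      assume g: ?R
      have tr: "\<exists>z'\<in>FOb Z' D. m' D z' = m D z \<and> f' D z' = f D z" if "D \<in> Ob \<T>" "z \<in> FOb Z D" for D z
        using fun_cong[OF fun_cong[OF fun_cong[OF g, of D], of "m D z"], of "f D z"] that by auto
      have tr': "\<exists>z\<in>FOb Z D. m D z = m' D z' \<and> f D z = f' D z'" if "D \<in> Ob \<T>" "z' \<in> FOb Z' D" for D z'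
        using fun_cong[OF fun_cong[OF fun_cong[OF g, of D], of "m' D z'"], of "f' D z'"] that by auto
      obtain \<phi> where \<phi>: "\<phi> \<in> Hom T.Psh Z Z'"
        and m\<phi>: "\<And>D z. \<lbrakk>D \<in> Ob \<T>; z \<in> FOb Z D\<rbrakk> \<Longrightarrow> m' D (\<phi> D z) = m D z"
        by (rule T.factor_through_injective[OF Z(2) assms(1) Z(1) m'(1) m(1) m'(2)]) (use tr in force)+
      obtain \<psi> where \<psi>: "\<psi> \<in> Hom T.Psh Z' Z"
        and m\<psi>: "\<And>D z. \<lbrakk>D \<in> Ob \<T>; z \<in> FOb Z' D\<rbrakk> \<Longrightarrow> m D (\<psi> D z) = m' D z"
        by (rule T.factor_through_injective[OF Z(1) assms(1) Z(2) m(1) m'(1) m(2)]) (use tr' in force)+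
      have n: "\<phi> D z \<in> FOb Z' D" if "D \<in> Ob \<T>" "z \<in> FOb Z D" for D z
        using T.nat_in[OF Z \<phi>] that by blast
      have n': "\<psi> D z \<in> FOb Z D" if "D \<in> Ob \<T>" "z \<in> FOb Z' D" for D z
        using T.nat_in[OF Z(2,1) \<psi>] that by blast
      have f\<phi>: "f' D (\<phi> D z) = f D z" if D: "D \<in> Ob \<T>" "z \<in> FOb Z D" for D z
        using tr[OF D] T.injectiveD[OF m'(2) D(1)] m\<phi>[OF D] n[OF D] by metis
      have "\<psi> D (\<phi> D z) = z" if D: "D \<in> Ob \<T>" "z \<in> FOb Z D" for D z
        using T.injectiveD[OF m(2) D(1)] m\<phi>[OF D] m\<psi>[OF D(1) n[OF D]] n'[OF D(1) n[OF D]] D by metis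
      moreover have "\<phi> D (\<psi> D z) = z" if D: "D \<in> Ob \<T>" "z \<in> FOb Z' D" for D z
        using T.injectiveD[OF m'(2) D(1)] m\<psi>[OF D] m\<phi>[OF D(1) n'[OF D]] n[OF D(1) n'[OF D]] D by metis
      ultimately have "Comp T.Psh Z Z' Z \<psi> \<phi> = Id T.Psh Z"
        "Comp T.Psh Z' Z Z' \<phi> \<psi> = Id T.Psh Z'"
        using \<phi> \<psi> by (simp_all add: T.nat_eqI[of Z Z] T.nat_eqI[of Z' Z'])
      then have "is_iso T.Psh Z Z' \<phi>" unfolding is_iso_def using \<phi> \<psi> by blast
      moreover have "Comp T.Psh Z Z' P m' \<phi> = m"
        by (rule T.nat_eqI[of Z P]) (use \<phi> m m' m\<phi> in simp_all)
      moreover have "Comp T.Psh Z Z' Q f' \<phi> = f"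
        by (rule T.nat_eqI[of Z Q]) (use \<phi> f f\<phi> in simp_all)
      ultimately show ?L by blast
    qed
    then show ?thesis using True by (simp add: span_iso_def)
  qed
qed

lemma par_graph_class:
  assumes "P \<in> Ob T.Psh" "Q \<in> Ob T.Psh" "s \<in> spans PM P Q"
  shows "par_graph (span_iso PM P Q `` {s}) = graph s"
proof (intro ext)
  fix D x y
  show "par_graph (span_iso PM P Q `` {s}) D x y = graph s D x y"
    unfolding par_graph_def Image_singleton
    using span_iso_iff_graph[OF assms(1,2), of s] assms(3) by (metis mem_Collect_eq)
qed

lemma Par_simps:
  "Ob (Par PM) = Ob T.Psh" "Hom (Par PM) P Q = spans PM P Q // span_iso PM P Q"
  by (simp_all add: Par_def)

lemma class_in_Hom_Par:
  "s \<in> spans PM P Q \<Longrightarrow> span_iso PM P Q `` {s} \<in> Hom (Par PM) P Q"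
  unfolding Par_simps by (rule quotientI)

lemma Hom_Par_cases:
  assumes "P \<in> Ob T.Psh" "Q \<in> Ob T.Psh" "S \<in> Hom (Par PM) P Q"
  obtains Z m f where "(Z, m, f) \<in> S" "(Z, m, f) \<in> spans PM P Q"
    "S = span_iso PM P Q `` {(Z, m, f)}" "par_graph S = graph (Z, m, f)"
proof -
  obtain s where s: "s \<in> spans PM P Q" "S = span_iso PM P Q `` {s}"
    using assms(3) unfolding Par_simps by (auto elim: quotientE)
  then have "s \<in> S" using assms by (simp add: span_iso_iff_graph)
  then show thesis using that s par_graph_class[OF assms(1,2) s(1)] by (metis prod_cases3)
qed

lemma Hom_Par_mem:
  assumes "P \<in> Ob T.Psh" "Q \<in> Ob T.Psh" "S \<in> Hom (Par PM) P Q" "s \<in> S"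
  shows "s \<in> spans PM P Q" "graph s = par_graph S"
proof -
  obtain t where t: "S = span_iso PM P Q `` {t}" "par_graph S = graph t"
    using Hom_Par_cases[OF assms(1-3)] by metis
  then have "(t, s) \<in> span_iso PM P Q" using assms(4) by simp
  then show "s \<in> spans PM P Q" "graph s = par_graph S"
    using t span_iso_iff_graph[OF assms(1,2), of t s] by metis+
qed

lemma class_eq_if_graph:
  assumes "P \<in> Ob T.Psh" "Q \<in> Ob T.Psh" "S \<in> Hom (Par PM) P Q" "U \<noteq> {}"
    and "\<And>u. u \<in> U \<Longrightarrow> u \<in> spans PM P Q \<and> graph u = par_graph S"
  shows "span_iso PM P Q `` U = S"
proof -
  obtain s where s: "s \<in> spans PM P Q" "S = span_iso PM P Q `` {s}" "par_graph S = graph s"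
    using Hom_Par_cases[OF assms(1-3)] by metis
  have "(u, t) \<in> span_iso PM P Q \<longleftrightarrow> (s, t) \<in> span_iso PM P Q" if "u \<in> U" for u t
    using span_iso_iff_graph[OF assms(1,2)] s assms(5)[OF that] by metis
  then show ?thesis using assms(4) unfolding s(2) by blast
qed

lemma Hom_Par_eqI:
  assumes "P \<in> Ob T.Psh" "Q \<in> Ob T.Psh" "S \<in> Hom (Par PM) P Q" "S' \<in> Hom (Par PM) P Q"
    and "par_graph S = par_graph S'"
  shows "S = S'"
proof -
  obtain s where s: "s \<in> spans PM P Q" "S = span_iso PM P Q `` {s}" "par_graph S = graph s"
    using Hom_Par_cases[OF assms(1-3)] by metis
  then show ?thesis using class_eq_if_graph[OF assms(1,2,4), of "{s}"] assms(5) by simp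
qed

context
  fixes P Q S
  assumes P [simp]: "P \<in> Ob T.Psh" and Q [simp]: "Q \<in> Ob T.Psh" and S: "S \<in> Hom (Par PM) P Q"
begin

lemma par_graph_in:
  assumes "par_graph S D x y"
  shows "D \<in> Ob \<T>" "x \<in> FOb P D" "y \<in> FOb Q D"
proof -
  obtain Z m f where *: "(Z, m, f) \<in> spans PM P Q" "par_graph S = graph (Z, m, f)"
    using Hom_Par_cases[OF P Q S] by metis
  then show "D \<in> Ob \<T>" using assms by simp
  then show "x \<in> FOb P D" "y \<in> FOb Q D"
    using * assms Mon_PM_D[of m Z P] T.nat_in[of Z P m D] T.nat_in[of Z Q f D] by auto
qed

lemma par_graph_functional:
  assumes "par_graph S D x y" "par_graph S D x y'"
  shows "y = y'"
proof -
  obtain Z m f where *: "(Z, m, f) \<in> spans PM P Q" "par_graph S = graph (Z, m, f)"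
    using Hom_Par_cases[OF P Q S] by metis
  then have "T.injective Z m" using Mon_PM_D[of m Z P] by simp
  then show ?thesis using * assms T.injectiveD[of Z m D] by auto
qed

lemma par_graph_act:
  assumes "par_graph S D x y" "I \<in> Ob \<T>" "g \<in> Hom \<T> I D"
  shows "par_graph S I (act P I D x g) (act Q I D y g)"
proof -
  obtain Z m f where *: "(Z, m, f) \<in> spans PM P Q" "par_graph S = graph (Z, m, f)"
    using Hom_Par_cases[OF P Q S] by metis
  then have Z: "Z \<in> Ob T.Psh" "m \<in> Hom T.Psh Z P" "f \<in> Hom T.Psh Z Q" using Mon_PM_D[of m Z P] by simp_all
  obtain z where z: "D \<in> Ob \<T>" "z \<in> FOb Z D" "m D z = x" "f D z = y" using * assms by auto
  then have "m I (act Z I D z g) = act P I D x g" "f I (act Z I D z g) = act Q I D y g"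
    using T.nat_act[OF Z(1) P Z(2) z(1) assms(2,3) z(2)] T.nat_act[OF Z(1) Q Z(3) z(1) assms(2,3) z(2)]
    by simp_all
  then show ?thesis using * assms T.act_in[OF Z(1) z(1) assms(2,3) z(2)] by auto
qed

lemma par_graph_domain:
  assumes "A \<in> Ob X" "idem A e" "x \<in> FOb P (A, e)"
  obtains e' where "domain_at P (\<lambda>D x. \<exists>y. par_graph S D x y) A e x e'"
proof -
  obtain Z m f where *: "(Z, m, f) \<in> spans PM P Q" "par_graph S = graph (Z, m, f)"
    using Hom_Par_cases[OF P Q S] by metis
  then have "Z \<in> Ob T.Psh" "m \<in> Mon PM Z P" by simp_all
  then obtain e' where e': "domain_at P (\<lambda>D x. x \<in> m D ` FOb Z D) A e x e'"
    using Mon_PM_iff[OF _ P, of Z m] assms by blast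
  have "(\<exists>y. par_graph S (B, d) x y) \<longleftrightarrow> x \<in> m (B, d) ` FOb Z (B, d)" if "(B, d) \<in> Ob \<T>" for B d x
    using that unfolding *(2) by auto
  then have "domain_at P (\<lambda>D x. \<exists>y. par_graph S D x y) A e x e'"
    using e' unfolding domain_at_def by blast
  then show thesis by (rule that)
qed

text \<open>
  Whether an injective left leg is a chosen monic depends only on its image, hence only on the graph.
  A span that is known to have the graph of a partial map needs no further verification.
\<close>

lemma span_of_graph:
  assumes V: "V \<in> Ob T.Psh" "k \<in> Hom T.Psh V P" "h \<in> Hom T.Psh V Q" and inj: "T.injective V k"
    and g: "graph (V, k, h) = par_graph S"
  shows "(V, k, h) \<in> spans PM P Q"
proof -
  have "\<exists>e'. domain_at P (\<lambda>D y. y \<in> k D ` FOb V D) A e x e'"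
    if A: "A \<in> Ob X" "idem A e" and x: "x \<in> FOb P (A, e)" for A e x
  proof -
    obtain e' where e': "domain_at P (\<lambda>D x. \<exists>y. par_graph S D x y) A e x e'"
      using par_graph_domain[OF A x] .
    have "(\<exists>y. par_graph S (B, d) x y) \<longleftrightarrow> x \<in> k (B, d) ` FOb V (B, d)" if "(B, d) \<in> Ob \<T>" for B d x
      using that unfolding g[symmetric] by auto
    then have "domain_at P (\<lambda>D y. y \<in> k D ` FOb V D) A e x e'"
      using e' unfolding domain_at_def by blast
    then show ?thesis by blast
  qed
  then have "k \<in> Mon PM V P" using Mon_PM_iff[OF V(1) P] V inj by blast
  then show ?thesis using V by simp
qed

end

section \<open>Partial elements\<close>


lemma Comp_in_T_Hom:
  assumes "A \<in> Ob X" "B \<in> Ob X" "idem A e" "g \<in> Hom X B A"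
  shows "Comp X B A A e g \<in> Hom \<T> (B, Rst X B A (Comp X B A A e g)) (A, e)"
  using assms by (simp add: Comp_assoc restriction_idempotent_Rst)

text \<open>
  A partial element of \<open>P\<close> at \<open>A\<close> is an element of \<open>P\<close> on a restriction of \<open>A\<close>, that is, a map
  \<open>y (A, 1) \<Rightarrow> P\<close> in the category of partial maps. Its domain is its restriction, and \<open>g : B \<rightarrow> A\<close> acts
  by the total map that \<open>e g\<close> induces on its domain.
\<close>

definition partial_elements :: "('o \<times> 'u, 'u) presheaf \<Rightarrow> ('o, 'u) presheaf" where
  "partial_elements P = make_presheaf X (\<lambda>A. pairing ` (SIGMA e:Collect (idem A). FOb P (A, e)))
    (\<lambda>A B g t. let h = Comp X B A A (fst_of t) g; d = Rst X B A h
      in pairing (d, act P (B, d) (A, fst_of t) (snd_of t) h))"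

lemma pairing_in_partial_elements [simp]:
  "A \<in> Ob X \<Longrightarrow> pairing (e, x) \<in> FOb (partial_elements P) A \<longleftrightarrow> idem A e \<and> x \<in> FOb P (A, e)"
  by (auto simp: partial_elements_def)

lemma partial_elements_cases:
  assumes "A \<in> Ob X" "t \<in> FOb (partial_elements P) A"
  obtains e x where "t = pairing (e, x)" "idem A e" "x \<in> FOb P (A, e)"
  using assms by (auto simp: partial_elements_def)

lemma act_partial_elements:
  "\<lbrakk>A \<in> Ob X; B \<in> Ob X; g \<in> Hom X B A; idem A e; x \<in> FOb P (A, e)\<rbrakk>
    \<Longrightarrow> act (partial_elements P) B A (pairing (e, x)) g =
      pairing (Rst X B A (Comp X B A A e g),
        act P (B, Rst X B A (Comp X B A A e g)) (A, e) x (Comp X B A A e g))"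
  by (simp add: partial_elements_def Let_def image_iff)

lemma act_partial_elements_total:
  assumes "A \<in> Ob X" "B \<in> Ob X" "idem A e" "idem B d" "x \<in> FOb P (A, e)" "g \<in> Hom \<T> (B, d) (A, e)"
  shows "act (partial_elements P) B A (pairing (e, x)) g = pairing (d, act P (B, d) (A, e) x g)"
  using assms act_partial_elements[of A B g e x P] by simp

lemma partial_elements_in_Ob [simp]:
  assumes P: "P \<in> Ob T.Psh"
  shows "partial_elements P \<in> Ob X.Psh"
  unfolding partial_elements_def
proof (rule X.make_presheaf_in_Ob)
  fix A assume A: "A \<in> Ob X"
  show "small (pairing ` (SIGMA e:Collect (idem A). FOb P (A, e)))"
  proof (rule small_pairing_Sigma)
    show "small (Collect (idem A))"
      by (rule small_subset[OF X.small_Hom[OF A A]]) auto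
    show "small (FOb P (A, e))" if "e \<in> Collect (idem A)" for e
      using that A T.small_presheaf[OF P] by simp
  qed
next
  fix A B g t
  assume *: "A \<in> Ob X" "B \<in> Ob X" "g \<in> Hom X B A"
      and t: "t \<in> pairing ` (SIGMA e:Collect (idem A). FOb P (A, e))"
  obtain e x where t: "t = pairing (e, x)" "idem A e" "x \<in> FOb P (A, e)" using t by auto
  have i: "idem B (Rst X B A (Comp X B A A e g))"
    using * t by (simp add: restriction_idempotent_Rst)
  moreover have "act P (B, Rst X B A (Comp X B A A e g)) (A, e) x (Comp X B A A e g)
      \<in> FOb P (B, Rst X B A (Comp X B A A e g))"
    using * t i Comp_in_T_Hom[of A B e g] by (intro T.act_in[OF P]) simp_all
  ultimately show "(let h = Comp X B A A (fst_of t) g; d = Rst X B A h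
      in pairing (d, act P (B, d) (A, fst_of t) (snd_of t) h))
      \<in> pairing ` (SIGMA e:Collect (idem B). FOb P (B, e))"
    using t by (simp add: Let_def image_iff)
next
  fix A t
  assume *: "A \<in> Ob X" and t: "t \<in> pairing ` (SIGMA e:Collect (idem A). FOb P (A, e))"
  obtain e x where t: "t = pairing (e, x)" "idem A e" "x \<in> FOb P (A, e)" using t by auto
  show "(let h = Comp X A A A (fst_of t) (Id X A); d = Rst X A A h
      in pairing (d, act P (A, d) (A, fst_of t) (snd_of t) h)) = t"
    using * t T.act_Id[OF P, of "(A, e)" x] by simp
next
  fix A B D g h t
  assume *: "A \<in> Ob X" "B \<in> Ob X" "D \<in> Ob X" "g \<in> Hom X B A" "h \<in> Hom X D B"
    and t: "t \<in> pairing ` (SIGMA e:Collect (idem A). FOb P (A, e))"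
  obtain e x where t: "t = pairing (e, x)" "idem A e" "x \<in> FOb P (A, e)" using t by auto
  let ?eg = "Comp X B A A e g"
  let ?c = "Rst X B A ?eg"
  have eg: "?eg \<in> Hom X B A" and c: "idem B ?c"
    using * t by (simp_all add: restriction_idempotent_Rst)
  let ?ch = "Comp X D B B ?c h"
  have ch: "Rst X D B ?ch = Rst X D A (Comp X D A A e (Comp X D B A g h))"
    using Rst_Rst_Comp[of D B A h ?eg] * eg t by (simp add: Comp_assoc)
  have eq: "Comp X D B A ?eg ?ch = Comp X D A A e (Comp X D B A g h)"
  proof -
    have "Comp X D B A ?eg ?ch = Comp X D B A (Comp X B B A ?eg ?c) h"
      using * eg c by (intro Comp_assoc) simp_all
    also have "\<dots> = Comp X D B A ?eg h" using * eg by simp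
    also have "\<dots> = Comp X D A A e (Comp X D B A g h)" using * t by (simp add: Comp_assoc)
    finally show ?thesis .
  qed
  have "act P (D, Rst X D B ?ch) (A, e) x (Comp X D B A ?eg ?ch)
      = act P (D, Rst X D B ?ch) (B, ?c) (act P (B, ?c) (A, e) x ?eg) ?ch"
    using T.act_Comp[OF P, of "(A, e)" "(B, ?c)" "(D, Rst X D B ?ch)" ?eg ?ch x]
      * t c Comp_in_T_Hom[of A B e g] Comp_in_T_Hom[of B D ?c h] restriction_idempotent_Rst[of D B ?ch]
    by simp
  then show "(let h = Comp X D A A (fst_of t) (Comp X D B A g h); d = Rst X D A h
      in pairing (d, act P (D, d) (A, fst_of t) (snd_of t) h)) =
    (let h = Comp X D B B (fst_of (let h = Comp X B A A (fst_of t) g; d = Rst X B A h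
      in pairing (d, act P (B, d) (A, fst_of t) (snd_of t) h))) h; d = Rst X D B h
      in pairing (d, act P (D, d) (B, fst_of (let h = Comp X B A A (fst_of t) g; d = Rst X B A h
      in pairing (d, act P (B, d) (A, fst_of t) (snd_of t) h)))
        (snd_of (let h = Comp X B A A (fst_of t) g; d = Rst X B A h
      in pairing (d, act P (B, d) (A, fst_of t) (snd_of t) h))) h))"
    unfolding Let_def t fst_of_pairing snd_of_pairing by (simp only: eq ch)
qed

definition restriction_presheaf_of :: "('o \<times> 'u, 'u) presheaf \<Rightarrow> ('o, 'u) rpresheaf" where
  "restriction_presheaf_of P =
    (partial_elements P, \<lambda>A\<in>Ob X. \<lambda>t\<in>FOb (partial_elements P) A. fst_of t)"

lemma restriction_presheaf_of_simps [simp]: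
  "fst (restriction_presheaf_of P) = partial_elements P"
  "\<lbrakk>A \<in> Ob X; idem A e; x \<in> FOb P (A, e)\<rbrakk> \<Longrightarrow> snd (restriction_presheaf_of P) A (pairing (e, x)) = e"
  by (simp_all add: restriction_presheaf_of_def)

lemma restriction_presheaf_of_in_Ob [simp]:
  assumes P: "P \<in> Ob T.Psh"
  shows "restriction_presheaf_of P \<in> Ob RP"
  unfolding RP_Ob_iff restriction_presheaf_def case_prod_conv
proof (intro conjI ballI allI impI)
  show "fst (restriction_presheaf_of P) \<in> Ob X.Psh" using P by simp
  show "snd (restriction_presheaf_of P)
      \<in> (\<Pi>\<^sub>E A\<in>Ob X. FOb (fst (restriction_presheaf_of P)) A \<rightarrow>\<^sub>E Hom X A A)"
  proof -
    have "fst_of t \<in> Hom X A A" if "A \<in> Ob X" "t \<in> FOb (partial_elements P) A" for A t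
      using partial_elements_cases[OF that] by (metis fst_of_pairing restriction_idempotentD(1))
    then show ?thesis by (auto simp: restriction_presheaf_of_def)
  qed
  fix A t assume A: "A \<in> Ob X" and "t \<in> FOb (fst (restriction_presheaf_of P)) A"
  then obtain e x where t [simp]: "t = pairing (e, x)" and e: "idem A e" and x: "x \<in> FOb P (A, e)"
    by (auto elim: partial_elements_cases)
  show "idem A (snd (restriction_presheaf_of P) A t)" using A e x by simp
  show "act (fst (restriction_presheaf_of P)) A A t (snd (restriction_presheaf_of P) A t) = t"
    using A e x T.act_Id[OF P, of "(A, e)" x] by (simp add: act_partial_elements)
  show "snd (restriction_presheaf_of P) A (act (fst (restriction_presheaf_of P)) A A t d) =
      Comp X A A A (snd (restriction_presheaf_of P) A t) d" if d: "idem A d" for d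
  proof -
    have ed: "Rst X A A (Comp X A A A e d) = Comp X A A A e d"
      using Rst_Comp_idempotent[of A A e d] A e d by simp
    have "idem A (Comp X A A A e d)" using restriction_idempotent_Comp A e d by simp
    moreover have "act P (A, Comp X A A A e d) (A, e) x (Comp X A A A e d) \<in> FOb P (A, Comp X A A A e d)"
      using T.act_in[OF P, of "(A, e)" "(A, Comp X A A A e d)" "Comp X A A A e d" x]
        Comp_in_T_Hom[of A A e d] A e d x calculation ed by simp
    ultimately show ?thesis using A e x d ed by (simp add: act_partial_elements)
  qed
  show "Comp X B A A (snd (restriction_presheaf_of P) A t) g =
      Comp X B B A g (snd (restriction_presheaf_of P) B (act (fst (restriction_presheaf_of P)) B A t g))"
    if B: "B \<in> Ob X" and g: "g \<in> Hom X B A" for B g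
  proof -
    let ?d = "Rst X B A (Comp X B A A e g)"
    have d: "idem B ?d" using A B g e by (simp add: restriction_idempotent_Rst)
    moreover have "act P (B, ?d) (A, e) x (Comp X B A A e g) \<in> FOb P (B, ?d)"
      using T.act_in[OF P, of "(A, e)" "(B, ?d)" "Comp X B A A e g" x]
        Comp_in_T_Hom[of A B e g] A B g e x d by simp
    ultimately show ?thesis using A e x B g idempotent_Comp[of B A g e] by (simp add: act_partial_elements)
  qed
qed

section \<open>Partial maps act on partial elements\<close>

abbreviation dom_of :: "('o, 'u) psh_span set \<Rightarrow> 'o \<times> 'u \<Rightarrow> 'u \<Rightarrow> bool" where
  "dom_of S \<equiv> \<lambda>D x. \<exists>y. par_graph S D x y"

text \<open>
  The partial map is applied to the largest restriction of \<open>x\<close> at which it is defined. There is exactly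
  one such value, since domains of definition are unique and graphs are functional.
\<close>

definition on_partial_elements ::
  "('o \<times> 'u, 'u) presheaf \<Rightarrow> ('o \<times> 'u, 'u) presheaf \<Rightarrow> ('o, 'u) psh_span set \<Rightarrow> 'o \<Rightarrow> 'u \<Rightarrow> 'u" where
  "on_partial_elements P Q S = (\<lambda>A\<in>Ob X. \<lambda>t\<in>FOb (partial_elements P) A.
    THE t'. \<exists>e' y. t' = pairing (e', y) \<and> domain_at P (dom_of S) A (fst_of t) (snd_of t) e' \<and>
      par_graph S (A, e') (act P (A, e') (A, fst_of t) (snd_of t) e') y)"

text \<open>
  Restricting the restriction of \<open>x\<close> along \<open>h\<close> along a further map \<open>k\<close> is restricting \<open>x\<close> along \<open>h k\<close>, and
  \<open>e'\<close> fixes \<open>h k\<close> exactly if the domain of \<open>e' h\<close> fixes \<open>k\<close>.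
\<close>

lemma domain_at_act:
  assumes P: "P \<in> Ob T.Psh" and A: "A \<in> Ob X" "idem A e" and x: "x \<in> FOb P (A, e)"
    and dom: "domain_at P S A e x e'"
    and B: "B \<in> Ob X" "idem B d" and h: "h \<in> Hom \<T> (B, d) (A, e)"
  shows "domain_at P S B d (act P (B, d) (A, e) x h) (Rst X B A (Comp X B A A e' h))"
  unfolding domain_at_def
proof (intro conjI allI impI)
  note d = domain_atD[OF A dom]
  have hX: "h \<in> Hom X B A" "Rst X B A h = d" using h A B by simp_all
  let ?d = "Rst X B A (Comp X B A A e' h)"
  show i: "idem B ?d" using hX A B d by (simp add: restriction_idempotent_Rst)
  show "Comp X B B B d ?d = ?d"
    using Rst_Comp_Rst[of B A A h e'] restriction_idempotent_commute[OF B i] hX A B d by simp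
  fix D c k
  assume D: "(D, c) \<in> Ob \<T>" and k: "k \<in> Hom \<T> (D, c) (B, d)"
  have kX: "k \<in> Hom X D B" "Rst X D B k = c" using k B D by simp_all
  have hk: "Comp X D B A h k \<in> Hom \<T> (D, c) (A, e)"
    using T.Comp_in_Hom[OF D _ _ k h] A B by simp
  have "act P (D, c) (B, d) (act P (B, d) (A, e) x h) k = act P (D, c) (A, e) x (Comp X D B A h k)"
    using T.act_Comp[OF P _ _ D h k x] A B by simp
  then have "S (D, c) (act P (D, c) (B, d) (act P (B, d) (A, e) x h) k)
      \<longleftrightarrow> Comp X D A A e' (Comp X D B A h k) = Comp X D B A h k"
    using d(6)[of D c "Comp X D B A h k"] D hk by simp
  also have "\<dots> \<longleftrightarrow> Comp X D B B ?d k = k"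
    by (rule idempotent_fixes_Comp_iff) (use A B D d hX kX h k in simp_all)
  finally show "S (D, c) (act P (D, c) (B, d) (act P (B, d) (A, e) x h) k) \<longleftrightarrow> Comp X D B B ?d k = k" .
qed

context
  fixes P Q S
  assumes P [simp]: "P \<in> Ob T.Psh" and Q [simp]: "Q \<in> Ob T.Psh" and S: "S \<in> Hom (Par PM) P Q"
begin

lemma on_partial_elements_eqI:
  assumes A: "A \<in> Ob X" "idem A e" "x \<in> FOb P (A, e)"
    and d: "domain_at P (dom_of S) A e x e'" and y: "par_graph S (A, e') (act P (A, e') (A, e) x e') y"
  shows "on_partial_elements P Q S A (pairing (e, x)) = pairing (e', y)"
proof -
  have "(THE t'. \<exists>e' y. t' = pairing (e', y) \<and> domain_at P (dom_of S) A e x e' \<and>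
      par_graph S (A, e') (act P (A, e') (A, e) x e') y) = pairing (e', y)"
    by (rule the_equality)
      (use d y domain_at_unique[OF A(1,2) _ d] par_graph_functional[OF P Q S] in blast)+
  then show ?thesis using A by (simp add: on_partial_elements_def)
qed

lemma on_partial_elements_cases:
  assumes A: "A \<in> Ob X" "idem A e" "x \<in> FOb P (A, e)"
  obtains e' y where "on_partial_elements P Q S A (pairing (e, x)) = pairing (e', y)"
    "domain_at P (dom_of S) A e x e'" "par_graph S (A, e') (act P (A, e') (A, e) x e') y"
    "idem A e'" "Comp X A A A e e' = e'" "Comp X A A A e' e = e'"
    "e' \<in> Hom \<T> (A, e') (A, e)" "y \<in> FOb Q (A, e')"
proof -
  obtain e' where e': "domain_at P (dom_of S) A e x e'" using par_graph_domain[OF P Q S A] .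
  note d = domain_atD[OF A(1,2) e']
  obtain y where y: "par_graph S (A, e') (act P (A, e') (A, e) x e') y" using d(5) by blast
  show thesis
    using that[OF on_partial_elements_eqI[OF A e' y] e' y d(1-4)] par_graph_in[OF P Q S y] by blast
qed

text \<open>
  The action on partial elements determines the graph, and with it the partial map.
\<close>

lemma on_partial_elements_total_iff:
  assumes A: "A \<in> Ob X" "idem A e" "x \<in> FOb P (A, e)"
  shows "on_partial_elements P Q S A (pairing (e, x)) = pairing (e, y) \<longleftrightarrow> par_graph S (A, e) x y"
proof -
  obtain e' y' where *: "on_partial_elements P Q S A (pairing (e, x)) = pairing (e', y')"
    "domain_at P (dom_of S) A e x e'" "par_graph S (A, e') (act P (A, e') (A, e) x e') y'"
    using on_partial_elements_cases[OF A] by metis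
  have "act P (A, e) (A, e) x e = x" using T.act_Id[OF P, of "(A, e)" x] A by simp
  then show ?thesis
    using * domain_at_self[OF P A *(2)] par_graph_functional[OF P Q S, of "(A, e)" x] by auto
qed

lemma on_partial_elements_in_Hom:
  "on_partial_elements P Q S \<in> Hom X.Psh (partial_elements P) (partial_elements Q)"
proof -
  have eta: "on_partial_elements P Q S =
      (\<lambda>A\<in>Ob X. \<lambda>t\<in>FOb (partial_elements P) A. on_partial_elements P Q S A t)"
    by (auto simp: on_partial_elements_def fun_eq_iff)
  show ?thesis
  proof (subst eta, rule X.make_nat)
    fix A t assume A: "A \<in> Ob X" and "t \<in> FOb (partial_elements P) A"
    then obtain e x where t: "t = pairing (e, x)" "idem A e" "x \<in> FOb P (A, e)"
      by (auto elim: partial_elements_cases)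
    obtain e' y where *: "on_partial_elements P Q S A t = pairing (e', y)" "idem A e'" "y \<in> FOb Q (A, e')"
      using on_partial_elements_cases[OF A t(2,3)] t(1) by metis
    then show "on_partial_elements P Q S A t \<in> FOb (partial_elements Q) A" using A by simp
    fix B g assume B: "B \<in> Ob X" and g: "g \<in> Hom X B A"
    show "on_partial_elements P Q S B (act (partial_elements P) B A t g)
        = act (partial_elements Q) B A (on_partial_elements P Q S A t) g"
    proof -
      obtain e' y where *: "on_partial_elements P Q S A t = pairing (e', y)"
        "domain_at P (dom_of S) A e x e'" "par_graph S (A, e') (act P (A, e') (A, e) x e') y"
        "idem A e'" "Comp X A A A e e' = e'" "Comp X A A A e' e = e'"
        "e' \<in> Hom \<T> (A, e') (A, e)" "y \<in> FOb Q (A, e')"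
        using on_partial_elements_cases[OF A t(2,3)] t(1) by metis
      let ?h = "Comp X B A A e g" and ?k = "Comp X B A A e' g"
      let ?d = "Rst X B A ?h" and ?c = "Rst X B A ?k"
      have d: "idem B ?d" and c: "idem B ?c"
        using A B g t * by (simp_all add: restriction_idempotent_Rst)
      have h: "?h \<in> Hom \<T> (B, ?d) (A, e)" and k: "?k \<in> Hom \<T> (B, ?c) (A, e')"
        using Comp_in_T_Hom[of A B e g] Comp_in_T_Hom[of A B e' g] A B g t * by simp_all
      have hX: "?h \<in> Hom X B A" using A B g t by simp
      have e'h: "Comp X B A A e' ?h = ?k" using A B g t * by (simp add: Comp_assoc)
      have e'k: "Comp X B A A e' ?k = ?k" using A B g * by (simp add: Comp_assoc)
      have dom: "domain_at P (dom_of S) B ?d (act P (B, ?d) (A, e) x ?h) ?c"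
        using domain_at_act[OF P A t(2,3) *(2) B d h] e'h by simp
      have cd: "?c \<in> Hom \<T> (B, ?c) (B, ?d)" by (rule domain_atD(4)[OF B d dom])
      have "act P (B, ?c) (B, ?d) (act P (B, ?d) (A, e) x ?h) ?c
          = act P (B, ?c) (A, e) x (Comp X B B A ?h ?c)"
        using T.act_Comp[OF P _ _ _ h cd t(3)] A B c d t(2) by simp
      also have "Comp X B B A ?h ?c = Comp X B A A e' ?k"
        using idempotent_Comp[OF B A hX *(4)] e'h e'k by simp
      also have "act P (B, ?c) (A, e) x \<dots> = act P (B, ?c) (A, e') (act P (A, e') (A, e) x e') ?k"
        using T.act_Comp[OF P _ _ _ *(7) k t(3)] A B c *(4) t(2) by simp
      finally have "par_graph S (B, ?c) (act P (B, ?c) (B, ?d) (act P (B, ?d) (A, e) x ?h) ?c)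
          (act Q (B, ?c) (A, e') y ?k)"
        using par_graph_act[OF P Q S *(3) _ k] B c by simp
      moreover have "act P (B, ?d) (A, e) x ?h \<in> FOb P (B, ?d)"
        using T.act_in[OF P _ _ h t(3)] A B d t(2) by simp
      ultimately have "on_partial_elements P Q S B (pairing (?d, act P (B, ?d) (A, e) x ?h))
          = pairing (?c, act Q (B, ?c) (A, e') y ?k)"
        using on_partial_elements_eqI[OF B d _ dom] by blast
      then show ?thesis
        using act_partial_elements[OF A B g t(2,3)] act_partial_elements[OF A B g *(4,8)] t(1) *(1) by simp
    qed
  qed simp_all
qed

end

lemma on_partial_elements_faithful:
  assumes P: "P \<in> Ob T.Psh" and Q: "Q \<in> Ob T.Psh" and S: "S \<in> Hom (Par PM) P Q" "S' \<in> Hom (Par PM) P Q"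
    and eq: "on_partial_elements P Q S = on_partial_elements P Q S'"
  shows "S = S'"
proof (rule Hom_Par_eqI[OF P Q S], intro ext)
  fix D :: "'o \<times> 'u" and x y
  obtain A e where D: "D = (A, e)" by (metis surj_pair)
  show "par_graph S D x y = par_graph S' D x y"
  proof (cases "D \<in> Ob \<T> \<and> x \<in> FOb P D")
    case True
    then show ?thesis
      using on_partial_elements_total_iff[OF P Q S(1), of A e x y]
        on_partial_elements_total_iff[OF P Q S(2), of A e x y] eq D by simp
  next
    case False
    then show ?thesis using par_graph_in[OF P Q S(1)] par_graph_in[OF P Q S(2)] by blast
  qed
qed

text \<open>
  A transformation \<open>\<alpha>\<close> of partial elements is recovered from its behaviour on those elements whose
  domain it does not shrink: they form a subobject of \<open>P\<close> that is classified by the domains of the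
  values of \<open>\<alpha>\<close>, and \<open>\<alpha>\<close> restricts to a transformation on it.
\<close>

lemma on_partial_elements_full:
  assumes P [simp]: "P \<in> Ob T.Psh" and Q [simp]: "Q \<in> Ob T.Psh"
    and \<alpha>: "\<alpha> \<in> Hom X.Psh (partial_elements P) (partial_elements Q)"
  obtains S where "S \<in> Hom (Par PM) P Q" "on_partial_elements P Q S = \<alpha>"
proof -
  define fix_dom where "fix_dom = (\<lambda>(A, e) x. fst_of (\<alpha> A (pairing (e, x))) = e)"
  have val: "\<exists>e' y. \<alpha> A (pairing (e, x)) = pairing (e', y) \<and> idem A e' \<and> y \<in> FOb Q (A, e') \<and>
      Comp X A A A e e' = e'" if A: "A \<in> Ob X" "idem A e" "x \<in> FOb P (A, e)" for A e x
  proof -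
    have t: "pairing (e, x) \<in> FOb (partial_elements P) A" using A by simp
    then have "\<alpha> A (pairing (e, x)) \<in> FOb (partial_elements Q) A"
      using X.nat_in[OF _ _ \<alpha> A(1)] by simp
    then obtain e' y where y: "\<alpha> A (pairing (e, x)) = pairing (e', y)" "idem A e'" "y \<in> FOb Q (A, e')"
      by (rule partial_elements_cases[OF A(1)])
    have "act (partial_elements P) A A (pairing (e, x)) e = pairing (e, x)"
      using act_partial_elements[of A A e e x P] T.act_Id[OF P, of "(A, e)" x] A by simp
    then have "pairing (e', y) = act (partial_elements Q) A A (pairing (e', y)) e"
      using X.nat_act[OF _ _ \<alpha> A(1) A(1) _ t, of e] A y by simp
    then have "e' = Rst X A A (Comp X A A A e' e)"
      using act_partial_elements[of A A e e' y Q] A y by simp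
    then have "Comp X A A A e' e = e'"
      using Rst_Comp_idempotent[of A A e' e] A y by simp
    then show ?thesis using y restriction_idempotent_commute A by metis
  qed
  have nat: "\<alpha> B (pairing (d, act P (B, d) (A, e) x g))
      = pairing (Rst X B A (Comp X B A A e' g),
          act Q (B, Rst X B A (Comp X B A A e' g)) (A, e') y (Comp X B A A e' g))"
    if "A \<in> Ob X" "idem A e" "x \<in> FOb P (A, e)" "B \<in> Ob X" "idem B d" "g \<in> Hom \<T> (B, d) (A, e)"
      "\<alpha> A (pairing (e, x)) = pairing (e', y)" "idem A e'" "y \<in> FOb Q (A, e')" for A e x B d g e' y
  proof -
    have "\<alpha> B (act (partial_elements P) B A (pairing (e, x)) g)
        = act (partial_elements Q) B A (pairing (e', y)) g"
      using X.nat_act[OF _ _ \<alpha> that(1,4), of g "pairing (e, x)"] that by simp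
    moreover have "g \<in> Hom X B A" using that by simp
    ultimately show ?thesis
      using act_partial_elements_total[of A B e d x P g] act_partial_elements[of A B g e' y Q] that by simp
  qed
  have dom: "domain_at P fix_dom A e x e'"
    if A: "A \<in> Ob X" "idem A e" "x \<in> FOb P (A, e)" and y: "\<alpha> A (pairing (e, x)) = pairing (e', y)"
    for A e x e' y
  proof -
    have e': "idem A e'" "y \<in> FOb Q (A, e')" "Comp X A A A e e' = e'" using val[OF A] y by auto
    have "fix_dom (B, d) (act P (B, d) (A, e) x g) \<longleftrightarrow> Comp X B A A e' g = g"
      if B: "(B, d) \<in> Ob \<T>" and g: "g \<in> Hom \<T> (B, d) (A, e)" for B d g
    proof -
      have "fix_dom (B, d) (act P (B, d) (A, e) x g) \<longleftrightarrow> Rst X B A (Comp X B A A e' g) = d"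
        using nat[OF A _ _ g y e'(1,2)] B by (simp add: fix_dom_def)
      then show ?thesis using idempotent_Comp_eq_iff[of B A g e'] A B g e' by simp
    qed
    then show ?thesis unfolding domain_at_def using e' by blast
  qed
  let ?Z = "T.subpresheaf P fix_dom"
  have sub: "fix_dom I (act P I D x g)"
    if "D \<in> Ob \<T>" "I \<in> Ob \<T>" "g \<in> Hom \<T> I D" "x \<in> FOb P D" "fix_dom D x" for D I g x
  proof -
    obtain A e B d where [simp]: "D = (A, e)" "I = (B, d)" by (metis surj_pair)
    have A: "A \<in> Ob X" "idem A e" "x \<in> FOb P (A, e)" and fd: "fix_dom (A, e) x"
      using that by simp_all
    obtain y where y: "\<alpha> A (pairing (e, x)) = pairing (e, y)"
      using val[OF A] fd by (auto simp: fix_dom_def)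
    show ?thesis using dom[OF A y] that unfolding domain_at_def by simp
  qed
  have Z: "?Z \<in> Ob T.Psh" by (rule T.subpresheaf_in_Ob[OF P]) (rule sub)
  have FZ: "FOb ?Z D = {x \<in> FOb P D. fix_dom D x}" if "D \<in> Ob \<T>" for D
    by (rule T.FOb_subpresheaf[OF that])
  define m where "m = (\<lambda>D\<in>Ob \<T>. \<lambda>z\<in>FOb ?Z D. z)"
  define f where "f = (\<lambda>D\<in>Ob \<T>. \<lambda>z\<in>FOb ?Z D. snd_of (\<alpha> (fst D) (pairing (snd D, z))))"
  have fix_val: "\<exists>y. \<alpha> A (pairing (e, z)) = pairing (e, y) \<and> y \<in> FOb Q (A, e)"
    if "A \<in> Ob X" "idem A e" "z \<in> FOb ?Z (A, e)" for A e z
    using val[of A e z] that FZ by (auto simp: fix_dom_def)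
  have m: "m \<in> Hom T.Psh ?Z P"
    unfolding m_def by (rule T.make_nat)
        (use Z T.FOb_subpresheaf[of _ P fix_dom] T.act_subpresheaf[of _ _ _ _ P fix_dom] sub in simp_all)
  have f: "f \<in> Hom T.Psh ?Z Q"
    unfolding f_def
  proof (rule T.make_nat)
    fix D z assume D: "D \<in> Ob \<T>" and z: "z \<in> FOb ?Z D"
    obtain A e where [simp]: "D = (A, e)" by (metis surj_pair)
    have A: "A \<in> Ob X" "idem A e" and zP: "z \<in> FOb P (A, e)" using D z FZ by auto
    obtain y where y: "\<alpha> A (pairing (e, z)) = pairing (e, y)" "y \<in> FOb Q (A, e)"
      using fix_val[OF A] z by auto
    then show "snd_of (\<alpha> (fst D) (pairing (snd D, z))) \<in> FOb Q D" by simp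
    fix I g assume I: "I \<in> Ob \<T>" and g: "g \<in> Hom \<T> I D"
    obtain B d where [simp]: "I = (B, d)" by (metis surj_pair)
    have B: "B \<in> Ob X" "idem B d" using I by simp_all
    have gX: "g \<in> Hom X B A" "Comp X B A A e g = g" "Rst X B A g = d" using g A B by simp_all
    have "\<alpha> B (pairing (d, act P (B, d) (A, e) z g)) = pairing (d, act Q (B, d) (A, e) y g)"
      using nat[OF A zP B _ y(1) A(2) y(2), of g] g gX by simp
    moreover have "act ?Z I D z g = act P (B, d) (A, e) z g"
      using T.act_subpresheaf[OF D I g, of z P fix_dom] z FZ[OF D] by simp
    ultimately show "snd_of (\<alpha> (fst I) (pairing (snd I, act ?Z I D z g))) =
        act Q I D (snd_of (\<alpha> (fst D) (pairing (snd D, z)))) g"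
      using y by simp
  qed (use Z in auto)
  have image: "m D ` FOb ?Z D = {x \<in> FOb P D. fix_dom D x}" if "D \<in> Ob \<T>" for D
    using that FZ[OF that] by (auto simp: m_def image_iff)
  have "m \<in> Mon PM ?Z P"
    unfolding Mon_PM_iff[OF Z P]
  proof (intro conjI ballI allI impI)
    show "T.injective ?Z m" by (auto simp: T.injective_def m_def inj_on_def)
    fix A e x assume A: "A \<in> Ob X" "idem A e" "x \<in> FOb P (A, e)"
    obtain e' y where y: "\<alpha> A (pairing (e, x)) = pairing (e', y)" using val[OF A] by blast
    have "act P (B, d) (A, e) x g \<in> m (B, d) ` FOb ?Z (B, d) \<longleftrightarrow> fix_dom (B, d) (act P (B, d) (A, e) x g)"
      if "(B, d) \<in> Ob \<T>" "g \<in> Hom \<T> (B, d) (A, e)" for B d g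
      using image[OF that(1)] T.act_in[OF P _ that A(3)] A by simp
    then have "domain_at P (\<lambda>D y. y \<in> m D ` FOb ?Z D) A e x e'"
      using dom[OF A y] unfolding domain_at_def by blast
    then show "\<exists>e'. domain_at P (\<lambda>D y. y \<in> m D ` FOb ?Z D) A e x e'" by blast
  qed (fact m)
  then have s: "(?Z, m, f) \<in> spans PM P Q" using Z f by simp
  define S where "S = span_iso PM P Q `` {(?Z, m, f)}"
  have S: "S \<in> Hom (Par PM) P Q" unfolding S_def by (rule class_in_Hom_Par[OF s])
  have graph_iff: "par_graph S (A, e) x y \<longleftrightarrow> \<alpha> A (pairing (e, x)) = pairing (e, y)"
    if A: "A \<in> Ob X" "idem A e" "x \<in> FOb P (A, e)" for A e x y
  proof -
    have D: "(A, e) \<in> Ob \<T>" using A by simp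
    have "par_graph S (A, e) x y \<longleftrightarrow> fix_dom (A, e) x \<and> snd_of (\<alpha> A (pairing (e, x))) = y"
      using A D FZ[OF D] unfolding S_def par_graph_class[OF P Q s] by (auto simp: m_def f_def)
    then show ?thesis using val[OF A] by (auto simp: fix_dom_def)
  qed
  have dom_iff: "dom_of S (A, e) x \<longleftrightarrow> fix_dom (A, e) x"
    if A: "A \<in> Ob X" "idem A e" "x \<in> FOb P (A, e)" for A e x
    using graph_iff[OF A] val[OF A] by (auto simp: fix_dom_def)
  have "on_partial_elements P Q S A t = \<alpha> A t" if "A \<in> Ob X" "t \<in> FOb (partial_elements P) A" for A t
  proof -
    obtain e x where t: "t = pairing (e, x)" and A: "A \<in> Ob X" "idem A e" "x \<in> FOb P (A, e)"
      using partial_elements_cases[OF \<open>A \<in> Ob X\<close>] \<open>t \<in> _\<close> \<open>A \<in> Ob X\<close> by metis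
    obtain e' y where y: "\<alpha> A (pairing (e, x)) = pairing (e', y)" "idem A e'" "y \<in> FOb Q (A, e')"
      "Comp X A A A e e' = e'"
      using val[OF A] by blast
    have h: "e' \<in> Hom \<T> (A, e') (A, e)" using A y by simp
    have "dom_of S (B, d) (act P (B, d) (A, e) x g) \<longleftrightarrow> fix_dom (B, d) (act P (B, d) (A, e) x g)"
      if "(B, d) \<in> Ob \<T>" "g \<in> Hom \<T> (B, d) (A, e)" for B d g
      using dom_iff[of B d] T.act_in[OF P _ that A(3)] A that by simp
    then have d: "domain_at P (dom_of S) A e x e'"
      using dom[OF A y(1)] unfolding domain_at_def by blast
    have "act P (A, e') (A, e) x e' \<in> FOb P (A, e')"
      using T.act_in[OF P _ _ h A(3)] A y by simp
    then have "par_graph S (A, e') (act P (A, e') (A, e) x e') y"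
      using graph_iff[of A e'] nat[OF A A(1) y(2) h y(1-3)] A y T.act_Id[OF Q, of "(A, e')" y] by simp
    then show ?thesis using on_partial_elements_eqI[OF P Q S A d] t y by simp
  qed
  then have "on_partial_elements P Q S = \<alpha>"
    by (intro X.nat_eqI[OF _ _ on_partial_elements_in_Hom[OF P Q S] \<alpha>]) simp_all
  then show thesis using that S by blast
qed

section \<open>The structure of the category of partial maps\<close>


lemma Id_in_Mon_PM:
  assumes P: "P \<in> Ob T.Psh"
  shows "Id T.Psh P \<in> Mon PM P P"
  unfolding Mon_PM_iff[OF P P]
proof (intro conjI ballI allI impI)
  show "T.injective P (Id T.Psh P)" by (simp add: T.injective_def inj_on_def)
  fix A e x assume A: "A \<in> Ob X" "idem A e" "x \<in> FOb P (A, e)"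
  have "act P (B, d) (A, e) x g \<in> Id T.Psh P (B, d) ` FOb P (B, d)"
    if B: "(B, d) \<in> Ob \<T>" and g: "g \<in> Hom \<T> (B, d) (A, e)" for B d g
    using T.act_in[OF P _ B g A(3)] A B
      T.Psh_Id_app[OF B, of "act P (B, d) (A, e) x g" P] by (metis T_Ob image_eqI)
  moreover have "Comp X B A A e g = g"
    if B: "(B, d) \<in> Ob \<T>" and g: "g \<in> Hom \<T> (B, d) (A, e)" for B d g
    using B g A by simp
  ultimately have "domain_at P (\<lambda>D y. y \<in> Id T.Psh P D ` FOb P D) A e x e"
    unfolding domain_at_def using A(2) restriction_idempotent_idem[OF A(1,2)] by blast
  then show "\<exists>e'. domain_at P (\<lambda>D y. y \<in> Id T.Psh P D ` FOb P D) A e x e'" by blast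
qed (use P in simp)

lemma Id_Par:
  assumes P: "P \<in> Ob T.Psh"
  shows Id_Par_in_Hom: "Id (Par PM) P \<in> Hom (Par PM) P P"
    and on_partial_elements_Id:
      "on_partial_elements P P (Id (Par PM) P) = Id X.Psh (partial_elements P)"
proof -
  let ?s = "(P, Id T.Psh P, Id T.Psh P)"
  have s: "?s \<in> spans PM P P" using P Id_in_Mon_PM by simp
  have I: "Id (Par PM) P = span_iso PM P P `` {?s}" by (simp add: Par_def)
  show H: "Id (Par PM) P \<in> Hom (Par PM) P P"
    unfolding I by (rule class_in_Hom_Par[OF s])
  show "on_partial_elements P P (Id (Par PM) P) = Id X.Psh (partial_elements P)"
  proof (rule X.nat_eqI[OF _ _ on_partial_elements_in_Hom[OF P P H]])
    fix A t assume A: "A \<in> Ob X" and t': "t \<in> FOb (partial_elements P) A"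
    then obtain e x where t: "t = pairing (e, x)" "idem A e" "x \<in> FOb P (A, e)"
      by (auto elim: partial_elements_cases)
    have "par_graph (Id (Par PM) P) (A, e) x x"
      unfolding I par_graph_class[OF P P s] using A t by simp
    then show "on_partial_elements P P (Id (Par PM) P) A t
        = Id X.Psh (partial_elements P) A t"
      using on_partial_elements_total_iff[OF P P H A t(2,3), of x] A t t' by simp
  qed (use P in simp_all)
qed

lemma Rst_Par:
  assumes P: "P \<in> Ob T.Psh" and Q: "Q \<in> Ob T.Psh" and S: "S \<in> Hom (Par PM) P Q"
  shows Rst_Par_in_Hom: "Rst (Par PM) P Q S \<in> Hom (Par PM) P P"
    and on_partial_elements_Rst: "on_partial_elements P P (Rst (Par PM) P Q S)
      = Rst RP (restriction_presheaf_of P) (restriction_presheaf_of Q) (on_partial_elements P Q S)"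
proof -
  obtain Z m f where s: "(Z, m, f) \<in> S" "(Z, m, f) \<in> spans PM P Q" using Hom_Par_cases[OF P Q S] by metis
  have m: "m \<in> Hom T.Psh Z P" using s Mon_PM_D[of m Z P] P by simp
  let ?U = "{(Z, m, m) | Z m f. (Z, m, f) \<in> S}"
  have u: "u \<in> spans PM P P \<and> (\<forall>D x y. graph u D x y \<longleftrightarrow> x = y \<and> dom_of S D x)"
    if uU: "u \<in> ?U" for u
  proof -
    obtain Z m f where f: "u = (Z, m, m)" "(Z, m, f) \<in> S" using uU by blast
    then have "(Z, m, f) \<in> spans PM P Q" "par_graph S = graph (Z, m, f)"
        using Hom_Par_mem[OF P Q S] by metis+
    then show ?thesis using f Mon_PM_D[of m Z P] P by auto
  qed
  have sU: "(Z, m, m) \<in> ?U" using s by blast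
  have sp: "(Z, m, m) \<in> spans PM P P" using u[OF sU] by blast
  let ?R = "span_iso PM P P `` {(Z, m, m)}"
  have R: "?R \<in> Hom (Par PM) P P" by (rule class_in_Hom_Par[OF sp])
  have gR: "par_graph ?R D x y \<longleftrightarrow> x = y \<and> dom_of S D x" for D x y
    unfolding par_graph_class[OF P P sp] using u[OF sU] by blast
  have "graph v = par_graph ?R" if "v \<in> ?U" for v
    using u[OF that] gR by (intro ext) metis
  then have "span_iso PM P P `` ?U = ?R"
    using class_eq_if_graph[OF P P R, of ?U] u sU by blast
  then have eq: "Rst (Par PM) P Q S = ?R" by (simp add: Par_def)
  show "Rst (Par PM) P Q S \<in> Hom (Par PM) P P" unfolding eq by (rule R)
  show "on_partial_elements P P (Rst (Par PM) P Q S)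
      = Rst RP (restriction_presheaf_of P) (restriction_presheaf_of Q) (on_partial_elements P Q S)"
    unfolding eq
  proof (rule X.nat_eqI[OF _ _ on_partial_elements_in_Hom[OF P P R]])
    show "Rst RP (restriction_presheaf_of P) (restriction_presheaf_of Q) (on_partial_elements P Q S)
        \<in> Hom X.Psh (partial_elements P) (partial_elements P)"
      using RP_Rst_in_Hom[of "restriction_presheaf_of P" "restriction_presheaf_of Q"]
        on_partial_elements_in_Hom[OF P Q S] P Q by simp
    fix A t assume A: "A \<in> Ob X" and t': "t \<in> FOb (partial_elements P) A"
    then obtain e x where t: "t = pairing (e, x)" "idem A e" "x \<in> FOb P (A, e)"
      by (auto elim: partial_elements_cases)
    obtain e' y where *: "on_partial_elements P Q S A (pairing (e, x)) = pairing (e', y)"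
        "domain_at P (dom_of S) A e x e'" "par_graph S (A, e') (act P (A, e') (A, e) x e') y"
        "idem A e'" "Comp X A A A e e' = e'" "Comp X A A A e' e = e'"
        "e' \<in> Hom \<T> (A, e') (A, e)" "y \<in> FOb Q (A, e')"
      using on_partial_elements_cases[OF P Q S A t(2,3)] by metis
    have "domain_at P (dom_of ?R) A e x e'" using *(2) gR by simp
    then have "on_partial_elements P P ?R A t = pairing (e', act P (A, e') (A, e) x e')"
      using on_partial_elements_eqI[OF P P R A t(2,3)] gR *(3) t(1) by blast
    also have "\<dots> = act (partial_elements P) A A (pairing (e, x)) e'"
      using act_partial_elements_total[of A A e e' x P e'] * A t by simp
    also have "\<dots> = Rst RP (restriction_presheaf_of P) (restriction_presheaf_of Q)
        (on_partial_elements P Q S) A t"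
      using * A t by (simp add: RP_Rst_app)
    finally show "on_partial_elements P P ?R A t = \<dots>" .
  qed (use P in simp_all)
qed

text \<open>
  Pullbacks of presheaves are pointwise, so every representative of a composite has the relational
  composite of the graphs as its graph. At least one representative exists: the inverse image of the
  image of the second left leg.
\<close>

lemma Comp_Par_eq:
  assumes P: "P \<in> Ob T.Psh" and Q: "Q \<in> Ob T.Psh" and W: "W \<in> Ob T.Psh"
    and S: "S \<in> Hom (Par PM) P Q" and U: "U \<in> Hom (Par PM) Q W" and R: "R \<in> Hom (Par PM) P W"
    and g: "\<And>D x w. par_graph R D x w \<longleftrightarrow> (\<exists>y. par_graph S D x y \<and> par_graph U D y w)"
  shows "Comp (Par PM) P Q W U S = R"
proof -
  let ?K = "{(V, Comp PM V Z P m p, Comp PM V N W k q) | Z m f N n k V p q.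
    (Z, m, f) \<in> S \<and> (N, n, k) \<in> U \<and> is_pullback PM Z N Q f n V p q}"
  have comp: "u \<in> spans PM P W \<and> graph u = par_graph R" if uK: "u \<in> ?K" for u
  proof -
    obtain Z m f N n k V p q where ueq: "u = (V, Comp PM V Z P m p, Comp PM V N W k q)"
      and sS: "(Z, m, f) \<in> S" and sU: "(N, n, k) \<in> U" and pb: "is_pullback T.Psh Z N Q f n V p q"
      using uK by auto
    have sS': "(Z, m, f) \<in> spans PM P Q" and gS: "par_graph S = graph (Z, m, f)"
      using Hom_Par_mem[OF P Q S sS] by simp_all
    have sU': "(N, n, k) \<in> spans PM Q W" and gU: "par_graph U = graph (N, n, k)"
      using Hom_Par_mem[OF Q W U sU] by simp_all
    have Z: "Z \<in> Ob T.Psh" "m \<in> Hom T.Psh Z P" "T.injective Z m" "f \<in> Hom T.Psh Z Q"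
      using sS' Mon_PM_D[of m Z P] P by simp_all
    have N: "N \<in> Ob T.Psh" "n \<in> Hom T.Psh N Q" "T.injective N n" "k \<in> Hom T.Psh N W"
      using sU' Mon_PM_D[of n N Q] Q by simp_all
    have V: "V \<in> Ob T.Psh" "p \<in> Hom T.Psh V Z" "q \<in> Hom T.Psh V N"
      and comm: "\<And>I c. \<lbrakk>I \<in> Ob \<T>; c \<in> FOb V I\<rbrakk> \<Longrightarrow> f I (p I c) = n I (q I c)"
      and ex1: "\<And>I a b. \<lbrakk>I \<in> Ob \<T>; a \<in> FOb Z I; b \<in> FOb N I; f I a = n I b\<rbrakk>
        \<Longrightarrow> \<exists>!c. c \<in> FOb V I \<and> p I c = a \<and> q I c = b"
      using pb unfolding T.is_pullback_Psh_iff by blast+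
    have pin: "p I c \<in> FOb Z I" and qin: "q I c \<in> FOb N I" if "I \<in> Ob \<T>" "c \<in> FOb V I" for I c
      using T.nat_in[OF V(1) Z(1) V(2) that] T.nat_in[OF V(1) N(1) V(3) that] by simp_all
    have "graph u D x w \<longleftrightarrow> par_graph R D x w" for D x w
    proof (cases "D \<in> Ob \<T>")
      case True
      have "graph u D x w \<longleftrightarrow> (\<exists>c\<in>FOb V D. m D (p D c) = x \<and> k D (q D c) = w)"
        using True by (simp add: ueq)
      also have "\<dots> \<longleftrightarrow> (\<exists>z\<in>FOb Z D. \<exists>b\<in>FOb N D. f D z = n D b \<and> m D z = x \<and> k D b = w)"
        using ex1[OF True] comm[OF True] pin[OF True] qin[OF True] by metis
      also have "\<dots> \<longleftrightarrow> (\<exists>y. par_graph S D x y \<and> par_graph U D y w)"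
        unfolding gS gU using True by auto metis
      finally show ?thesis using g by simp
    next
      case False
      then have "\<not> par_graph R D x w" using par_graph_in(1)[OF P W R] by blast
      then show ?thesis using False by (simp add: ueq)
    qed
    then have gu: "graph u = par_graph R" by (intro ext)
    have "T.injective V (Comp T.Psh V Z P m p)"
      unfolding T.injective_def
    proof (intro ballI inj_onI)
      fix I c c' assume I: "I \<in> Ob \<T>" and c: "c \<in> FOb V I" "c' \<in> FOb V I"
        and "Comp T.Psh V Z P m p I c = Comp T.Psh V Z P m p I c'"
      then have pp: "p I c = p I c'"
        using T.injectiveD[OF Z(3) I _ pin[OF I c(1)] pin[OF I c(2)]] by simp
      then have "n I (q I c) = n I (q I c')" using comm[OF I] c by metis
      then have "q I c = q I c'" using T.injectiveD[OF N(3) I _ qin[OF I c(1)] qin[OF I c(2)]] by simp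
      then show "c = c'" using ex1[OF I pin[OF I c(2)] qin[OF I c(2)] comm[OF I c(2)]] pp c by metis
    qed
    moreover have "Comp T.Psh V Z P m p \<in> Hom T.Psh V P" "Comp T.Psh V N W k q \<in> Hom T.Psh V W"
      using V Z N P W by simp_all
    ultimately have "u \<in> spans PM P W"
      using span_of_graph[OF P W R V(1)] gu unfolding ueq PM_simps by blast
    with gu show ?thesis by blast
  qed
  obtain Z m f where sS: "(Z, m, f) \<in> S" "(Z, m, f) \<in> spans PM P Q" using Hom_Par_cases[OF P Q S] by metis
  obtain N n k where sU: "(N, n, k) \<in> U" "(N, n, k) \<in> spans PM Q W" using Hom_Par_cases[OF Q W U] by metis
  have Z: "Z \<in> Ob T.Psh" "f \<in> Hom T.Psh Z Q" using sS by simp_all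
  have N: "N \<in> Ob T.Psh" "n \<in> Hom T.Psh N Q" "T.injective N n" using sU Mon_PM_D[of n N Q] Q by simp_all
  \<comment> \<open>The inverse image of the domain of the second map under the first.\<close>
  let ?in = "\<lambda>D z. f D z \<in> n D ` FOb N D"
  let ?V = "T.subpresheaf Z ?in"
  have closed: "?in I (act Z I D z h)"
    if "D \<in> Ob \<T>" "I \<in> Ob \<T>" "h \<in> Hom \<T> I D" "z \<in> FOb Z D" and im: "?in D z" for D I h z
  proof -
    obtain b where b: "b \<in> FOb N D" "f D z = n D b" using im by blast
    have "f I (act Z I D z h) = n I (act N I D b h)"
      using T.nat_act[OF Z(1) Q Z(2) that(1-4)] T.nat_act[OF N(1) Q N(2) that(1-3) b(1)] b by simp
    then show ?thesis using T.act_in[OF N(1) that(1-3) b(1)] by blast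
  qed
  have V: "?V \<in> Ob T.Psh" by (rule T.subpresheaf_in_Ob[OF Z(1)]) (rule closed)
  define p where "p = (\<lambda>D\<in>Ob \<T>. \<lambda>z\<in>FOb ?V D. z)"
  have p: "p \<in> Hom T.Psh ?V Z"
    unfolding p_def by (rule T.make_nat)
        (use V Z T.FOb_subpresheaf[of _ Z ?in] T.act_subpresheaf[of _ _ _ _ Z ?in] closed in simp_all)
  have p_app: "p D z = z" if "D \<in> Ob \<T>" "z \<in> FOb ?V D" for D z using that by (simp add: p_def)
  have fp: "Comp T.Psh ?V Z Q f p \<in> Hom T.Psh ?V Q" using V Z Q p by simp
  have im: "Comp T.Psh ?V Z Q f p D z \<in> n D ` FOb N D" if "D \<in> Ob \<T>" "z \<in> FOb ?V D" for D z
    using that T.FOb_subpresheaf[OF that(1), of Z ?in] p_app by simp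
  obtain q where q: "q \<in> Hom T.Psh ?V N"
    and nq: "\<And>D z. \<lbrakk>D \<in> Ob \<T>; z \<in> FOb ?V D\<rbrakk> \<Longrightarrow> n D (q D z) = Comp T.Psh ?V Z Q f p D z"
    by (rule T.factor_through_injective[OF N(1) Q V N(2) fp N(3)]) (use im that in blast)+
  have "is_pullback T.Psh Z N Q f n ?V p q"
    unfolding T.is_pullback_Psh_iff
  proof (intro conjI ballI impI)
    fix I assume I: "I \<in> Ob \<T>"
    show "f I (p I c) = n I (q I c)" if c: "c \<in> FOb ?V I" for c
      using nq[OF I c] T.Psh_Comp_app[OF I c, of Z Q f p] by argo
    fix a b assume a: "a \<in> FOb Z I" and b: "b \<in> FOb N I" and ab: "f I a = n I b"
    have aV: "a \<in> FOb ?V I" using a b ab I by auto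
    have "n I (q I a) = n I b"
      using nq[OF I aV] T.Psh_Comp_app[OF I aV, of Z Q f p] ab p_app[OF I aV] by metis
    then have "q I a = b" using T.injectiveD[OF N(3) I _ T.nat_in[OF V N(1) q I aV] b] by blast
    moreover have "c = a" if "c \<in> FOb ?V I" "p I c = a" for c
      using p_app[OF I that(1)] that(2) by argo
    ultimately show "\<exists>!c. c \<in> FOb ?V I \<and> p I c = a \<and> q I c = b"
      using aV p_app[OF I aV] by blast
  qed (use Z N Q V p q in simp_all)
  then have "(?V, Comp PM ?V Z P m p, Comp PM ?V N W k q) \<in> ?K"
    using sS(1) sU(1) unfolding PM_simps by blast
  then have "?K \<noteq> {}" by blast
  then have "span_iso PM P W `` ?K = R" by (rule class_eq_if_graph[OF P W R]) (rule comp)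
  then show ?thesis by (simp only: Par_def rcategory.simps category.simps)
qed

text \<open>
  Fullness provides a partial map \<open>R\<close> whose action is the composite of the two actions, and then the
  graph of \<open>R\<close> is the relational composite. In this way the stability of the chosen monics under
  composition and pullback is inherited from the composition of natural transformations.
\<close>

lemma Comp_Par:
  assumes P: "P \<in> Ob T.Psh" and Q: "Q \<in> Ob T.Psh" and W: "W \<in> Ob T.Psh"
    and S: "S \<in> Hom (Par PM) P Q" and U: "U \<in> Hom (Par PM) Q W"
  shows Comp_Par_in_Hom: "Comp (Par PM) P Q W U S \<in> Hom (Par PM) P W"
    and on_partial_elements_Comp: "on_partial_elements P W (Comp (Par PM) P Q W U S) =
      Comp X.Psh (partial_elements P) (partial_elements Q) (partial_elements W)
        (on_partial_elements Q W U) (on_partial_elements P Q S)"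
proof -
  let ?\<alpha> = "Comp X.Psh (partial_elements P) (partial_elements Q) (partial_elements W)
        (on_partial_elements Q W U) (on_partial_elements P Q S)"
  have \<alpha>: "?\<alpha> \<in> Hom X.Psh (partial_elements P) (partial_elements W)"
    using on_partial_elements_in_Hom[OF P Q S] on_partial_elements_in_Hom[OF Q W U] P Q W by simp
  obtain R where R: "R \<in> Hom (Par PM) P W" and RS: "on_partial_elements P W R = ?\<alpha>"
    using on_partial_elements_full[OF P W \<alpha>] .
  have "par_graph R D x w \<longleftrightarrow> (\<exists>y. par_graph S D x y \<and> par_graph U D y w)" for D x w
  proof (cases "D \<in> Ob \<T> \<and> x \<in> FOb P D")
    case True
    obtain A e where D: "D = (A, e)" by (metis surj_pair)
    have A: "A \<in> Ob X" "idem A e" "x \<in> FOb P (A, e)" using True D by simp_all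
    obtain e1 y where 1: "on_partial_elements P Q S A (pairing (e, x)) = pairing (e1, y)"
        "idem A e1" "Comp X A A A e1 e = e1" "y \<in> FOb Q (A, e1)"
      using on_partial_elements_cases[OF P Q S A] by metis
    obtain e2 v where 2: "on_partial_elements Q W U A (pairing (e1, y)) = pairing (e2, v)"
        "Comp X A A A e1 e2 = e2"
      using on_partial_elements_cases[OF Q W U A(1) 1(2,4)] by metis
    have R_iff: "par_graph R D x w \<longleftrightarrow> e2 = e \<and> v = w"
      using on_partial_elements_total_iff[OF P W R A, of w] RS D 1 2 A by simp
    show ?thesis
    proof
      assume "par_graph R D x w"
      then have ev: "e2 = e" "v = w" using R_iff by simp_all
      then have "e1 = e" using 1 2 by simp
      then show "\<exists>y. par_graph S D x y \<and> par_graph U D y w"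
        using on_partial_elements_total_iff[OF P Q S A, of y]
            on_partial_elements_total_iff[OF Q W U A(1,2), of y w]
          1 2 ev D by auto
    next
      assume "\<exists>y. par_graph S D x y \<and> par_graph U D y w"
      then obtain y' where y': "par_graph S (A, e) x y'" "par_graph U (A, e) y' w" using D by blast
      then have "pairing (e1, y) = pairing (e, y')"
        using on_partial_elements_total_iff[OF P Q S A, of y'] 1 by simp
      then have ey: "e1 = e" "y = y'" by simp_all
      then have "pairing (e2, v) = pairing (e, w)"
        using on_partial_elements_total_iff[OF Q W U A(1,2), of y' w] y' 1 2 by simp
      then show "par_graph R D x w" using R_iff by simp
    qed
  next
    case False
    then show ?thesis using par_graph_in[OF P W R] par_graph_in[OF P Q S] by blast
  qed
  then have "Comp (Par PM) P Q W U S = R" by (rule Comp_Par_eq[OF P Q W S U R])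
  then show "Comp (Par PM) P Q W U S \<in> Hom (Par PM) P W"
      "on_partial_elements P W (Comp (Par PM) P Q W U S) = ?\<alpha>"
    using R RS by simp_all
qed

section \<open>The equivalence and its essential surjectivity\<close>

text \<open>
  A restriction presheaf is the presheaf of partial elements of the presheaf that sends \<open>(A, e)\<close> to
  the elements with restriction \<open>e\<close>.
\<close>

definition fibres :: "('o, 'u) rpresheaf \<Rightarrow> ('o \<times> 'u, 'u) presheaf" where
  "fibres P = make_presheaf \<T> (\<lambda>D. {x \<in> FOb (fst P) (fst D). snd P (fst D) x = snd D})
    (\<lambda>D I g x. act (fst P) (fst I) (fst D) x g)"

lemma FOb_fibres [simp]:
  "\<lbrakk>A \<in> Ob X; idem A e\<rbrakk> \<Longrightarrow> FOb (fibres P) (A, e) = {x \<in> FOb (fst P) A. snd P A x = e}"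
  by (simp add: fibres_def)

lemma act_fibres [simp]:
  "\<lbrakk>(A, e) \<in> Ob \<T>; (B, d) \<in> Ob \<T>; g \<in> Hom \<T> (B, d) (A, e); x \<in> FOb (fst P) A; snd P A x = e\<rbrakk>
    \<Longrightarrow> act (fibres P) (B, d) (A, e) x g = act (fst P) B A x g"
  unfolding fibres_def by (subst make_presheaf_simps(2)) auto

lemma fibres_in_Ob [simp]:
  assumes P: "P \<in> Ob RP"
  shows "fibres P \<in> Ob T.Psh"
  unfolding fibres_def
proof (rule T.make_presheaf_in_Ob)
  fix D assume D: "D \<in> Ob \<T>"
  obtain A e where [simp]: "D = (A, e)" by (metis surj_pair)
  have A: "A \<in> Ob X" "idem A e" using D by simp_all
  show "small {x \<in> FOb (fst P) (fst D). snd P (fst D) x = snd D}"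
    by (rule small_subset[OF X.small_presheaf[OF RP_presheaf[OF P] A(1)]]) auto
  fix x assume x: "x \<in> {x \<in> FOb (fst P) (fst D). snd P (fst D) x = snd D}"
  show "act (fst P) (fst D) (fst D) x (Id \<T> D) = x"
    using x act_rho[OF P A(1), of x] by auto
next
  fix D I g x
  assume D: "D \<in> Ob \<T>" and I: "I \<in> Ob \<T>" and g: "g \<in> Hom \<T> I D"
    and x: "x \<in> {x \<in> FOb (fst P) (fst D). snd P (fst D) x = snd D}"
  obtain A e B d where [simp]: "D = (A, e)" "I = (B, d)" by (metis surj_pair)
  have gX: "g \<in> Hom X B A" "Comp X B A A e g = g" "Rst X B A g = d" using g D I by simp_all
  then show "act (fst P) (fst I) (fst D) x g \<in> {x \<in> FOb (fst P) (fst I). snd P (fst I) x = snd I}"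
    using rho_act[OF P, of A x B g] D I x P by simp
next
  fix D I K g h x
  assume D: "D \<in> Ob \<T>" and I: "I \<in> Ob \<T>" and K: "K \<in> Ob \<T>"
    and g: "g \<in> Hom \<T> I D" and h: "h \<in> Hom \<T> K I"
    and x: "x \<in> {x \<in> FOb (fst P) (fst D). snd P (fst D) x = snd D}"
  obtain A e B d N k where [simp]: "D = (A, e)" "I = (B, d)" "K = (N, k)" by (metis surj_pair)
  have "g \<in> Hom X B A" "h \<in> Hom X N B" using g h D I K by simp_all
  then show "act (fst P) (fst K) (fst D) x (Comp \<T> K I D g h)
      = act (fst P) (fst K) (fst I) (act (fst P) (fst I) (fst D) x g) h"
    using X.act_Comp[of "fst P" A B N g h x] D I K x P by simp
qed

definition to_fibres :: "('o, 'u) rpresheaf \<Rightarrow> 'o \<Rightarrow> 'u \<Rightarrow> 'u" where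
  "to_fibres P = (\<lambda>A\<in>Ob X. \<lambda>x\<in>FOb (fst P) A. pairing (snd P A x, x))"

definition from_fibres :: "('o, 'u) rpresheaf \<Rightarrow> 'o \<Rightarrow> 'u \<Rightarrow> 'u" where
  "from_fibres P = (\<lambda>A\<in>Ob X. \<lambda>t\<in>FOb (partial_elements (fibres P)) A. snd_of t)"

lemma to_fibres_app [simp]:
  "\<lbrakk>A \<in> Ob X; x \<in> FOb (fst P) A\<rbrakk> \<Longrightarrow> to_fibres P A x = pairing (snd P A x, x)"
  by (simp add: to_fibres_def)

lemma from_fibres_app [simp]:
  "\<lbrakk>A \<in> Ob X; idem A (snd P A x); x \<in> FOb (fst P) A\<rbrakk> \<Longrightarrow> from_fibres P A (pairing (snd P A x, x)) = x"
  by (simp add: from_fibres_def)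

lemma partial_elements_fibres_cases:
  assumes "P \<in> Ob RP" "A \<in> Ob X" "t \<in> FOb (partial_elements (fibres P)) A"
  obtains x where "t = pairing (snd P A x, x)" "x \<in> FOb (fst P) A"
proof -
  obtain e x where t: "t = pairing (e, x)" "idem A e" "x \<in> FOb (fibres P) (A, e)"
    using partial_elements_cases[OF assms(2,3)] .
  then have "x \<in> FOb (fst P) A" "snd P A x = e" using assms(2) by simp_all
  then show thesis using that t(1) by blast
qed

lemma act_partial_elements_fibres:
  assumes P: "P \<in> Ob RP" and A: "A \<in> Ob X" "B \<in> Ob X" and g: "g \<in> Hom X B A" and x: "x \<in> FOb (fst P) A"
  shows "act (partial_elements (fibres P)) B A (pairing (snd P A x, x)) g
    = pairing (snd P B (act (fst P) B A x g), act (fst P) B A x g)"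
proof -
  let ?e = "snd P A x"
  let ?h = "Comp X B A A ?e g"
  have e: "idem A ?e" using P A x by simp
  have d: "idem B (Rst X B A ?h)" using e A g by (simp add: restriction_idempotent_Rst)
  have h: "?h \<in> Hom \<T> (B, Rst X B A ?h) (A, ?e)" by (rule Comp_in_T_Hom[OF A e g])
  have "act (fst P) B A x ?h = act (fst P) B A x g"
    using X.act_Comp[of "fst P" A A B ?e g x] P A e g x by simp
  then show ?thesis
    using act_partial_elements[of A B g ?e x "fibres P"] act_fibres[OF _ _ h x] rho_act[OF P A(1) x A(2) g]
      A e d g x by simp
qed

lemma to_fibres_in_Hom:
  assumes P: "P \<in> Ob RP"
  shows "to_fibres P \<in> Hom X.Psh (fst P) (partial_elements (fibres P))"
  unfolding to_fibres_def
  by (rule X.make_nat) (use P act_partial_elements_fibres in simp_all)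

lemma from_fibres_in_Hom:
  assumes P: "P \<in> Ob RP"
  shows "from_fibres P \<in> Hom X.Psh (partial_elements (fibres P)) (fst P)"
  unfolding from_fibres_def
proof (rule X.make_nat)
  fix A t assume A: "A \<in> Ob X" and t: "t \<in> FOb (partial_elements (fibres P)) A"
  then obtain x where x: "t = pairing (snd P A x, x)" "x \<in> FOb (fst P) A"
    using partial_elements_fibres_cases[OF P] by blast
  then show "snd_of t \<in> FOb (fst P) A" by simp
  fix B g assume "B \<in> Ob X" "g \<in> Hom X B A"
  then show "snd_of (act (partial_elements (fibres P)) B A t g) = act (fst P) B A (snd_of t) g"
    using act_partial_elements_fibres[OF P A _ _ x(2)] x(1) by simp
qed (use P in simp_all)

lemma fibres_inverse:
  assumes P: "P \<in> Ob RP"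
  shows "Comp X.Psh (fst P) (partial_elements (fibres P)) (fst P) (from_fibres P) (to_fibres P)
      = Id X.Psh (fst P)"
    and "Comp X.Psh (partial_elements (fibres P)) (fst P) (partial_elements (fibres P))
      (to_fibres P) (from_fibres P) = Id X.Psh (partial_elements (fibres P))"
proof -
  show "Comp X.Psh (fst P) (partial_elements (fibres P)) (fst P) (from_fibres P) (to_fibres P)
      = Id X.Psh (fst P)"
    unfolding X.Psh_Comp_eq X.Psh_Id_eq
    by (intro ext) (use P in simp)
  show "Comp X.Psh (partial_elements (fibres P)) (fst P) (partial_elements (fibres P))
      (to_fibres P) (from_fibres P) = Id X.Psh (partial_elements (fibres P))"
    unfolding X.Psh_Comp_eq X.Psh_Id_eq
  proof (intro restrict_ext)
    fix A t assume A: "A \<in> Ob X" "t \<in> FOb (partial_elements (fibres P)) A"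
    obtain x where "t = pairing (snd P A x, x)" "x \<in> FOb (fst P) A"
      using partial_elements_fibres_cases[OF P A] .
    then show "to_fibres P A (from_fibres P A t) = t" using A P by simp
  qed
qed

definition partial_elements_functor where
  "partial_elements_functor = \<lparr>FOb = restriction_presheaf_of, FMap = on_partial_elements\<rparr>"

abbreviation \<E> where "\<E> \<equiv> partial_elements_functor"

lemma E_simps [simp]:
  "FOb \<E> P = restriction_presheaf_of P" "FMap \<E> P Q S = on_partial_elements P Q S"
  by (simp_all add: partial_elements_functor_def)

sublocale RP: restriction_category RP
  by (rule restriction_category_RP)

sublocale transport: restriction_transport "Par PM" RP \<E>
proof unfold_locales
  fix P Q assume "P \<in> Ob (Par PM)" "Q \<in> Ob (Par PM)"
  then have P: "P \<in> Ob T.Psh" "Q \<in> Ob T.Psh" by (simp_all add: Par_simps)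
  show "FOb \<E> P \<in> Ob RP" using P by simp
  show "bij_betw (FMap \<E> P Q) (Hom (Par PM) P Q) (Hom RP (FOb \<E> P) (FOb \<E> Q))"
    unfolding bij_betw_def E_simps RP_simps restriction_presheaf_of_simps
  proof (intro conjI inj_onI equalityI subsetI)
    show "\<alpha> \<in> on_partial_elements P Q ` Hom (Par PM) P Q"
      if "\<alpha> \<in> Hom X.Psh (partial_elements P) (partial_elements Q)" for \<alpha>
      using on_partial_elements_full[OF P that] by blast
  qed (use on_partial_elements_faithful[OF P] on_partial_elements_in_Hom[OF P] in auto)
  show "Id (Par PM) P \<in> Hom (Par PM) P P" by (rule Id_Par_in_Hom[OF P(1)])
  show "FMap \<E> P P (Id (Par PM) P) = Id RP (FOb \<E> P)"
    using on_partial_elements_Id[OF P(1)] by (simp add: RP_simps)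
  fix S assume S: "S \<in> Hom (Par PM) P Q"
  show "Rst (Par PM) P Q S \<in> Hom (Par PM) P P" by (rule Rst_Par_in_Hom[OF P S])
  show "FMap \<E> P P (Rst (Par PM) P Q S) = Rst RP (FOb \<E> P) (FOb \<E> Q) (FMap \<E> P Q S)"
    using on_partial_elements_Rst[OF P S] by simp
next
  fix P Q W S U
  assume "P \<in> Ob (Par PM)" "Q \<in> Ob (Par PM)" "W \<in> Ob (Par PM)"
    and S: "S \<in> Hom (Par PM) P Q" and U: "U \<in> Hom (Par PM) Q W"
  then have P: "P \<in> Ob T.Psh" "Q \<in> Ob T.Psh" "W \<in> Ob T.Psh" by (simp_all add: Par_simps)
  show "Comp (Par PM) P Q W U S \<in> Hom (Par PM) P W" by (rule Comp_Par_in_Hom[OF P S U])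
  show "FMap \<E> P W (Comp (Par PM) P Q W U S) =
      Comp RP (FOb \<E> P) (FOb \<E> Q) (FOb \<E> W) (FMap \<E> Q W U) (FMap \<E> P Q S)"
    using on_partial_elements_Comp[OF P S U] by (simp add: RP_simps)
next
  fix P assume P: "P \<in> Ob RP"
  then have "fibres P \<in> Ob (Par PM)" by (simp add: Par_simps)
  moreover have "to_fibres P \<in> Hom RP P (FOb \<E> (fibres P))"
    "from_fibres P \<in> Hom RP (FOb \<E> (fibres P)) P"
    using to_fibres_in_Hom[OF P] from_fibres_in_Hom[OF P] by (simp_all add: RP_simps)
  moreover have "Comp RP P (FOb \<E> (fibres P)) P (from_fibres P) (to_fibres P) = Id RP P"
    "Comp RP (FOb \<E> (fibres P)) P (FOb \<E> (fibres P)) (to_fibres P) (from_fibres P)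
      = Id RP (FOb \<E> (fibres P))"
    using fibres_inverse[OF P] by (simp_all add: RP_simps)
  ultimately show "\<exists>A\<in>Ob (Par PM). \<exists>i\<in>Hom RP P (FOb \<E> A). \<exists>j\<in>Hom RP (FOb \<E> A) P.
      Comp RP P (FOb \<E> A) P j i = Id RP P \<and>
      Comp RP (FOb \<E> A) P (FOb \<E> A) i j = Id RP (FOb \<E> A)"
    by blast
qed

section \<open>Compatibility with the Yoneda embedding\<close>

lemma yoneda\<^sub>r_simps [simp]:
  "fst (FOb (yoneda\<^sub>r X) A) = representable X A"
  "\<lbrakk>B \<in> Ob X; f \<in> Hom X B A\<rbrakk> \<Longrightarrow> snd (FOb (yoneda\<^sub>r X) A) B f = Rst X B A f"
  "FMap (yoneda\<^sub>r X) = FMap (yoneda X)"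
  by (simp_all add: yoneda\<^sub>r_def)

lemma yoneda\<^sub>r_in_Ob:
  assumes A: "A \<in> Ob X"
  shows "FOb (yoneda\<^sub>r X) A \<in> Ob RP"
  unfolding RP_Ob_iff restriction_presheaf_def case_prod_conv
proof (intro conjI ballI allI impI)
  show "snd (FOb (yoneda\<^sub>r X) A) \<in> (\<Pi>\<^sub>E B\<in>Ob X. FOb (fst (FOb (yoneda\<^sub>r X) A)) B \<rightarrow>\<^sub>E Hom X B B)"
    using A by (simp add: yoneda\<^sub>r_def)
  fix B f assume B: "B \<in> Ob X" and f: "f \<in> FOb (fst (FOb (yoneda\<^sub>r X) A)) B"
  then have fX: "f \<in> Hom X B A" by simp
  show "idem B (snd (FOb (yoneda\<^sub>r X) A) B f)"
    using A B fX by (simp add: restriction_idempotent_Rst)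
  show "act (fst (FOb (yoneda\<^sub>r X) A)) B B f (snd (FOb (yoneda\<^sub>r X) A) B f) = f"
    using A B fX by simp
  show "snd (FOb (yoneda\<^sub>r X) A) B (act (fst (FOb (yoneda\<^sub>r X) A)) B B f e) =
      Comp X B B B (snd (FOb (yoneda\<^sub>r X) A) B f) e" if "idem B e" for e
    using A B fX that Rst_Comp_idempotent[of B A f e] by simp
  show "Comp X D B B (snd (FOb (yoneda\<^sub>r X) A) B f) g =
      Comp X D D B g (snd (FOb (yoneda\<^sub>r X) A) D (act (fst (FOb (yoneda\<^sub>r X) A)) D B f g))"
    if "D \<in> Ob X" "g \<in> Hom X D B" for D g
    using A B fX that R4[of D B A g f] by simp
qed (use A in simp)

lemma restriction_functor_yoneda\<^sub>r: "restriction_functor X RP (yoneda\<^sub>r X)"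
proof unfold_locales
  fix A B f assume A: "A \<in> Ob X" and B: "B \<in> Ob X" and f: "f \<in> Hom X A B"
  show "FMap (yoneda\<^sub>r X) A B f \<in> Hom RP (FOb (yoneda\<^sub>r X) A) (FOb (yoneda\<^sub>r X) B)"
    using A B f by (simp add: RP_simps)
  show "FMap (yoneda\<^sub>r X) A A (Rst X A B f)
      = Rst RP (FOb (yoneda\<^sub>r X) A) (FOb (yoneda\<^sub>r X) B) (FMap (yoneda\<^sub>r X) A B f)"
  proof (rule X.nat_eqI[of "representable X A" "representable X A"])
    show "Rst RP (FOb (yoneda\<^sub>r X) A) (FOb (yoneda\<^sub>r X) B) (FMap (yoneda\<^sub>r X) A B f)
        \<in> Hom X.Psh (representable X A) (representable X A)"
      using RP_Rst_in_Hom[OF yoneda\<^sub>r_in_Ob[OF A] yoneda\<^sub>r_in_Ob[OF B]] A B f by simp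
    fix D g assume "D \<in> Ob X" "g \<in> FOb (representable X A) D"
    then show "FMap (yoneda\<^sub>r X) A A (Rst X A B f) D g
        = Rst RP (FOb (yoneda\<^sub>r X) A) (FOb (yoneda\<^sub>r X) B) (FMap (yoneda\<^sub>r X) A B f) D g"
      using A B f R4[of D A B g f] by (simp add: RP_Rst_app)
  qed (use A B f in simp_all)
next
  fix A assume A: "A \<in> Ob X"
  show "FOb (yoneda\<^sub>r X) A \<in> Ob RP" by (rule yoneda\<^sub>r_in_Ob[OF A])
  show "FMap (yoneda\<^sub>r X) A A (Id X A) = Id RP (FOb (yoneda\<^sub>r X) A)"
    by (rule X.nat_eqI[of "representable X A" "representable X A"]) (use A in \<open>simp_all add: RP_simps\<close>)
next
  fix A B D f g assume *: "A \<in> Ob X" "B \<in> Ob X" "D \<in> Ob X" "f \<in> Hom X A B" "g \<in> Hom X B D"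
  show "FMap (yoneda\<^sub>r X) A D (Comp X A B D g f) = Comp RP (FOb (yoneda\<^sub>r X) A) (FOb (yoneda\<^sub>r X) B)
      (FOb (yoneda\<^sub>r X) D) (FMap (yoneda\<^sub>r X) B D g) (FMap (yoneda\<^sub>r X) A B f)"
    by (rule X.nat_eqI[of "representable X A" "representable X D"])
      (use * in \<open>simp_all add: RP_simps Comp_assoc\<close>)
qed

lemma fibres_yoneda\<^sub>r:
  assumes A: "A \<in> Ob X"
  shows "fibres (FOb (yoneda\<^sub>r X) A) = representable \<T> (A, Id X A)"
proof (rule T.presheaf_eqI)
  have T: "(A, Id X A) \<in> Ob \<T>" using A by (simp add: restriction_idempotent_Id)
  then show "representable \<T> (A, Id X A) \<in> Ob T.Psh" by simp
  show "fibres (FOb (yoneda\<^sub>r X) A) \<in> Ob T.Psh" using yoneda\<^sub>r_in_Ob[OF A] by simp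
  fix D assume D: "D \<in> Ob \<T>"
  obtain B e where [simp]: "D = (B, e)" by (metis surj_pair)
  have B: "B \<in> Ob X" "idem B e" using D by simp_all
  have Hom: "f \<in> Hom \<T> (B, e) (A, Id X A) \<longleftrightarrow> f \<in> Hom X B A \<and> Rst X B A f = e" for f
    using A B by (simp add: restriction_idempotent_Id) (metis Comp_Id_left)
  show F: "FOb (fibres (FOb (yoneda\<^sub>r X) A)) D = FOb (representable \<T> (A, Id X A)) D"
    by (rule set_eqI) (use A B in \<open>simp add: restriction_idempotent_Id cong: conj_cong\<close>)
  fix I g x assume I: "I \<in> Ob \<T>" and g: "g \<in> Hom \<T> I D" and x: "x \<in> FOb (fibres (FOb (yoneda\<^sub>r X) A)) D"
  obtain N k where [simp]: "I = (N, k)" by (metis surj_pair)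
  have xX: "x \<in> Hom X B A" "Rst X B A x = e" using x B by (simp_all cong: conj_cong)
  have "g \<in> Hom X N B" using g I B by simp
  then have "act (fibres (FOb (yoneda\<^sub>r X) A)) (N, k) (B, e) x g = Comp X N B A x g"
    using act_fibres[of B e N k g x "FOb (yoneda\<^sub>r X) A"] D I g xX B by simp
  then show "act (fibres (FOb (yoneda\<^sub>r X) A)) I D x g = act (representable \<T> (A, Id X A)) I D x g"
    using T.act_representable[OF D I g, of x "(A, Id X A)"] Hom xX by simp
qed

fun yoneda_span :: "'o \<times> 'u \<Rightarrow> 'o \<times> 'u \<Rightarrow> ('o \<times> 'u) \<times> 'u \<times> 'u \<Rightarrow> ('o, 'u) psh_span" where
  "yoneda_span A B (Z, m, h) =
    (representable \<T> Z, FMap (yoneda \<T>) Z A m, FMap (yoneda \<T>) Z B h)"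

text \<open>
  All the representatives of a class of spans in \<open>\<T>\<close> give the same class, since isomorphic spans have
  images with the same graph.
\<close>

lemma Par_func_yoneda:
  assumes A: "A \<in> Ob \<T>" and B: "B \<in> Ob \<T>" and s: "(Z, m, h) \<in> spans \<T> A B"
  shows "yoneda_span A B (Z, m, h) \<in> spans PM (representable \<T> A) (representable \<T> B)"
    and "FMap (Par_func PM (yoneda \<T>)) A B (span_iso \<T> A B `` {(Z, m, h)}) =
      span_iso PM (representable \<T> A) (representable \<T> B) `` {yoneda_span A B (Z, m, h)}"
proof -
  let ?y = "yoneda_span A B"
  let ?t = "?y (Z, m, h)"
  have rA: "representable \<T> A \<in> Ob T.Psh" and rB: "representable \<T> B \<in> Ob T.Psh" using A B by simp_all
  have T: "Z \<in> Ob \<T> \<and> m \<in> Hom \<T> Z A \<and> h \<in> Hom \<T> Z B"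
      "?y (Z, m, h) \<in> spans PM (representable \<T> A) (representable \<T> B)"
    if s: "(Z, m, h) \<in> spans \<T> A B" for Z m h
  proof -
    obtain A0 a Z0 c where [simp]: "A = (A0, a)" "Z = (Z0, c)" by (metis surj_pair)
    have Z: "Z \<in> Ob \<T>" "m \<in> Mon \<T> Z A" "h \<in> Hom \<T> Z B" using s by (simp_all add: spans_def)
    have A0: "A0 \<in> Ob X" "idem A0 a" using A by simp_all
    have "m \<in> Hom \<T> (Z0, c) (A0, a)" using Mon_T_D[OF A0, of m Z0 c] Z(2) by (metis \<open>A = _\<close> \<open>Z = _\<close>)
    then show "Z \<in> Ob \<T> \<and> m \<in> Hom \<T> Z A \<and> h \<in> Hom \<T> Z B" using Z by simp
    have "FMap (yoneda \<T>) Z A m \<in> Mon PM (representable \<T> Z) (representable \<T> A)"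
      using yoneda_in_Mon_PM[OF A0, of m Z0 c] Z(2) by simp
    then show "?y (Z, m, h) \<in> spans PM (representable \<T> A) (representable \<T> B)"
      using T.yoneda_in_Hom[OF Z(1) B Z(3)] T.representable_in_Ob[OF Z(1)] by simp
  qed
  have g: "graph (?y (Z, m, h)) D u v \<longleftrightarrow> D \<in> Ob \<T> \<and>
      (\<exists>z\<in>Hom \<T> D Z. Comp \<T> D Z A m z = u \<and> Comp \<T> D Z B h z = v)" for Z m h D u v
    by auto
  have graph_le: "graph (?y (Z, m, h)) D u v"
    if st: "(Z, m, h) \<in> spans \<T> A B" "(Z', m', h') \<in> spans \<T> A B"
      and \<phi>: "\<phi> \<in> Hom \<T> Z' Z" "Comp \<T> Z' Z A m \<phi> = m'" "Comp \<T> Z' Z B h \<phi> = h'"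
      and gr: "graph (?y (Z', m', h')) D u v" for Z m h Z' m' h' \<phi> D u v
  proof -
    obtain z where D: "D \<in> Ob \<T>" and z: "z \<in> Hom \<T> D Z'" "Comp \<T> D Z' A m' z = u" "Comp \<T> D Z' B h' z = v"
      using gr g by blast
    have "Comp \<T> D Z' Z \<phi> z \<in> Hom \<T> D Z"
      using T.Comp_in_Hom[OF D _ _ z(1) \<phi>(1)] T(1)[OF st(1)] T(1)[OF st(2)] by blast
    moreover have "Comp \<T> D Z A m (Comp \<T> D Z' Z \<phi> z) = u"
      using T.Comp_assoc[OF D _ _ A z(1) \<phi>(1), of m] T(1)[OF st(1)] T(1)[OF st(2)] \<phi>(2) z(2) by metis
    moreover have "Comp \<T> D Z B h (Comp \<T> D Z' Z \<phi> z) = v"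
      using T.Comp_assoc[OF D _ _ B z(1) \<phi>(1), of h] T(1)[OF st(1)] T(1)[OF st(2)] \<phi>(3) z(3) by metis
    ultimately show ?thesis using D g by blast
  qed
  have graph_eq: "graph (?y u) = graph (?y (Z, m, h))" if u: "((Z, m, h), u) \<in> span_iso \<T> A B" for u
  proof -
    obtain Z' m' h' where u': "u = (Z', m', h')" by (metis prod_cases3)
    obtain \<phi> \<psi> where u_span: "(Z', m', h') \<in> spans \<T> A B" and \<phi>: "\<phi> \<in> Hom \<T> Z Z'"
        "Comp \<T> Z Z' A m' \<phi> = m" "Comp \<T> Z Z' B h' \<phi> = h"
      and \<psi>: "\<psi> \<in> Hom \<T> Z' Z" "Comp \<T> Z' Z Z' \<phi> \<psi> = Id \<T> Z'"
      using u unfolding u' span_iso_def is_iso_def by blast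
    note Z = T(1)[OF s] and Z' = T(1)[OF u_span]
    have "Comp \<T> Z' Z A m \<psi> = m'"
      using T.Comp_assoc[of Z' Z Z' A \<psi> \<phi> m'] Z Z' A \<phi> \<psi> T.Comp_Id_right[of Z' A m'] by metis
    moreover have "Comp \<T> Z' Z B h \<psi> = h'"
      using T.Comp_assoc[of Z' Z Z' B \<psi> \<phi> h'] Z Z' B \<phi> \<psi> T.Comp_Id_right[of Z' B h'] by metis
    ultimately have "graph (?y (Z', m', h')) D v w \<longleftrightarrow> graph (?y (Z, m, h)) D v w" for D v w
      using graph_le[OF s u_span \<psi>(1)] graph_le[OF u_span s \<phi>] by blast
    then show ?thesis unfolding u' by (intro ext)
  qed
  have "is_iso \<T> Z Z (Id \<T> Z)"
    unfolding is_iso_def using T(1)[OF s] T.Id_in_Hom[of Z] T.Comp_Id_left[of Z Z] by blast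
  then have refl: "((Z, m, h), (Z, m, h)) \<in> span_iso \<T> A B"
    using s T(1)[OF s] T.Comp_Id_right[of Z A m] T.Comp_Id_right[of Z B h] A B
    unfolding span_iso_def by blast
  show t: "?t \<in> spans PM (representable \<T> A) (representable \<T> B)" by (rule T(2)[OF s])
  let ?S = "span_iso PM (representable \<T> A) (representable \<T> B) `` {?t}"
  have "FMap (Par_func PM (yoneda \<T>)) A B (span_iso \<T> A B `` {(Z, m, h)}) =
      span_iso PM (representable \<T> A) (representable \<T> B) `` (?y ` (span_iso \<T> A B `` {(Z, m, h)}))"
    by (rule trans[OF _ arg_cong[where f = "\<lambda>U. span_iso PM (representable \<T> A) (representable \<T> B) `` U"]])
      (force simp: Par_func_def yoneda_def)+
  also have "\<dots> = ?S"
  proof (rule class_eq_if_graph[OF rA rB class_in_Hom_Par[OF t]])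
    show "?y ` (span_iso \<T> A B `` {(Z, m, h)}) \<noteq> {}" using refl by blast
    fix v assume "v \<in> ?y ` (span_iso \<T> A B `` {(Z, m, h)})"
    then obtain u where u: "v = ?y u" "((Z, m, h), u) \<in> span_iso \<T> A B" by blast
    then have "u \<in> spans \<T> A B" by (auto simp: span_iso_def)
    then have "v \<in> spans PM (representable \<T> A) (representable \<T> B)"
      using T(2) u(1) by (metis prod_cases3)
    then show "v \<in> spans PM (representable \<T> A) (representable \<T> B) \<and> graph v = par_graph ?S"
      using graph_eq[OF u(2)] u(1) par_graph_class[OF rA rB t] by simp
  qed
  finally show "FMap (Par_func PM (yoneda \<T>)) A B (span_iso \<T> A B `` {(Z, m, h)}) = ?S" .
qed

text \<open>
  The splitting \<open>m r\<close> of the restriction of \<open>f\<close> that occurs in \<open>\<Lambda>\<close> leaves no trace. The restriction of \<open>g\<close>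
  to the domain of \<open>f g\<close> is fixed by the restriction of \<open>f\<close> and hence factors through \<open>m\<close>. No larger
  restriction of \<open>g\<close> does so, because \<open>f m\<close> is total.
\<close>

lemma on_partial_elements_Lambda:
  assumes A: "A \<in> Ob X" and B: "B \<in> Ob X" and f: "f \<in> Hom X A B"
    and D: "D \<in> Ob X" "idem D e" and g: "g \<in> Hom X D A" "Rst X D A g = e"
  shows "FMap (Lambda small X) A B f \<in> Hom (Par PM) (representable \<T> (A, Id X A))
      (representable \<T> (B, Id X B))"
    and "on_partial_elements (representable \<T> (A, Id X A)) (representable \<T> (B, Id X B))
        (FMap (Lambda small X) A B f) D (pairing (e, g))
      = pairing (Rst X D B (Comp X D A B f g), Comp X D A B f g)"
proof -
  let ?A = "(A, Id X A)" and ?B = "(B, Id X B)" and ?f = "Rst X A B f"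
  have iA: "idem A (Id X A)" and iB: "idem B (Id X B)"
    using A B by (simp_all add: restriction_idempotent_Id)
  have AT: "?A \<in> Ob \<T>" "?B \<in> Ob \<T>" using A B iA iB by simp_all
  have fi: "idem A ?f" using A B f by (rule restriction_idempotent_Rst)
  have ri: "restriction_idempotent (K\<^sub>r X) ?A ?f"
    using fi A iA by (simp add: Kr_idempotent_iff Kr_Hom_iff)
  have "splitting (K\<^sub>r X) ?A ?f (A, ?f) ?f ?f"
    using fi A iA unfolding splitting_def by (simp add: Kr_simps Kr_Hom_iff)
  then have ex: "\<exists>t. case t of (Z, m, r) \<Rightarrow> splitting (K\<^sub>r X) ?A (Rst (K\<^sub>r X) ?A ?B f) Z m r"
    by (auto simp: K\<^sub>r_def)
  obtain Z m r where Zmr: "(SOME (Z, m, r). splitting (K\<^sub>r X) ?A (Rst (K\<^sub>r X) ?A ?B f) Z m r) = (Z, m, r)"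
    by (metis prod_cases3)
  then have s: "splitting (K\<^sub>r X) ?A ?f Z m r"
    using someI_ex[OF ex] by (simp add: K\<^sub>r_def)
  obtain N c where Z: "Z = (N, c)" by (metis surj_pair)
  note sp = splitting_in_Kr[OF A iA s[unfolded Z]]
  have mX: "m \<in> Hom X N A" "Rst X N A m = c" using sp(5) sp(1,2) A iA by simp_all
  have mM: "m \<in> Mon \<T> Z ?A" using ri s by (auto simp: MTotal_def restriction_monic_def)
  have "Comp X N A A ?f m = m"
    using Comp_assoc[of N A N A m r m] sp mX A by (metis R1)
  then have fmr: "Rst X N B (Comp X N A B f m) = c"
    using Rst_Rst_Comp[of N A B m f] A B f sp(1) mX by simp
  have h: "Comp X N A B f m \<in> Hom \<T> Z ?B" using fmr sp(1,2) A B f iB mX Z by simp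
  have span: "(Z, m, Comp X N A B f m) \<in> spans \<T> ?A ?B"
    using mM h Z sp(1,2) by (simp add: spans_def)
  let ?t = "yoneda_span ?A ?B (Z, m, Comp X N A B f m)"
  let ?S = "FMap (Lambda small X) A B f"
  have "?S = FMap (Par_func PM (yoneda \<T>)) ?A ?B (span_iso \<T> ?A ?B `` {(Z, m, Comp X N A B f m)})"
    using Zmr by (simp add: Lambda_def comp_func_def J_func_def Phi_func_def Z Kr_simps)
  then have S: "?S = span_iso PM (representable \<T> ?A) (representable \<T> ?B) `` {?t}"
    using Par_func_yoneda(2)[OF AT span] by simp
  have t: "?t \<in> spans PM (representable \<T> ?A) (representable \<T> ?B)" by (rule Par_func_yoneda(1)[OF AT span])
  show SH: "?S \<in> Hom (Par PM) (representable \<T> ?A) (representable \<T> ?B)"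
    unfolding S by (rule class_in_Hom_Par[OF t])
  have rA: "representable \<T> ?A \<in> Ob T.Psh" and rB: "representable \<T> ?B \<in> Ob T.Psh" using AT by simp_all
  have graph_iff: "par_graph ?S (K, k) x y \<longleftrightarrow>
      (\<exists>z\<in>Hom \<T> (K, k) (N, c). Comp X K N A m z = x \<and> Comp X K N B (Comp X N A B f m) z = y)"
    if K: "(K, k) \<in> Ob \<T>" for K k x y
    using K unfolding S par_graph_class[OF rA rB t] by (simp add: Z)
  let ?fg = "Comp X D A B f g"
  let ?c = "Rst X D B ?fg"
  have fg: "?fg \<in> Hom X D B" using A B f D g by simp
  have ci: "idem D ?c" using fg B D by (simp add: restriction_idempotent_Rst)
  have gT: "g \<in> FOb (representable \<T> ?A) (D, e)" using A iA D g by simp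
  obtain e' y where *: "on_partial_elements (representable \<T> ?A) (representable \<T> ?B)
      ?S D (pairing (e, g)) = pairing (e', y)"
        "domain_at (representable \<T> ?A) (dom_of ?S) D e g e'"
        "par_graph ?S (D, e') (act (representable \<T> ?A) (D, e') (D, e) g e') y"
        "idem D e'" "Comp X D D D e e' = e'" "Comp X D D D e' e = e'"
        "e' \<in> Hom \<T> (D, e') (D, e)" "y \<in> FOb (representable \<T> ?B) (D, e')"
    by (rule on_partial_elements_cases[OF rA rB SH D gT])
  have act_g: "act (representable \<T> ?A) (D, k) (D, e) g k = Comp X D D A g k"
    if "idem D k" "k \<in> Hom \<T> (D, k) (D, e)" for k
    using T.act_representable[of "(D, e)" "(D, k)" k g ?A] that gT D by simp
  obtain z where z: "z \<in> Hom \<T> (D, e') (N, c)" "Comp X D N A m z = Comp X D D A g e'"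
      "Comp X D N B (Comp X N A B f m) z = y"
    using *(3) graph_iff[of D e'] act_g[OF *(4,7)] *(4) D by auto
  have zX: "z \<in> Hom X D N" using z(1) D *(4) sp(1,2) by simp
  have y: "y = Comp X D D B ?fg e'"
  proof -
    have "y = Comp X D A B f (Comp X D N A m z)"
      using z(3) Comp_assoc[OF D(1) sp(1) A B zX mX(1) f] by simp
    also have "\<dots> = Comp X D D B ?fg e'"
      using z(2) Comp_assoc[OF D(1) D(1) A B _ g(1) f, of e'] *(4) by simp
    finally show ?thesis .
  qed
  have "Rst X D B y = e'" using *(4,8) D B iB by simp
  then have ce': "Comp X D D D ?c e' = e'"
    using y Rst_Comp_idempotent[OF D(1) B fg *(4)] by simp
  have ec: "Comp X D D D e ?c = ?c"
    using Rst_Comp_Rst[OF D(1) A B g(1) f] restriction_idempotent_commute[OF D(1) ci D(2)] g(2) by simp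
  have cT: "?c \<in> Hom \<T> (D, ?c) (D, e)" using ci D ec by simp
  have gc: "Comp X D D A g ?c \<in> Hom \<T> (D, ?c) ?A"
    using T.Comp_in_Hom[of "(D, ?c)" "(D, e)" ?A ?c g] ci cT D AT gT by simp
  have fgc: "Comp X D A A ?f g = Comp X D D A g ?c" by (rule R4[OF D(1) A B g(1) f])
  have "Comp X D A A ?f (Comp X D D A g ?c) = Comp X D D A g ?c"
    using Comp_assoc[of D A A A g ?f ?f] fi A D g(1) fgc by simp
  then have "Comp X D D A g ?c \<in> Comp X D N A m ` Hom \<T> (D, ?c) (N, c)"
    using factors_iff_idempotent[OF A iA sp(1-6) _ gc] sp(7) ci D by simp
  then obtain w where "Comp X D D A g ?c = Comp X D N A m w" "w \<in> Hom \<T> (D, ?c) (N, c)"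
    by (rule imageE)
  moreover have "(D, ?c) \<in> Ob \<T>" using ci D by simp
  ultimately have "dom_of ?S (D, ?c) (act (representable \<T> ?A) (D, ?c) (D, e) g ?c)"
    unfolding act_g[OF ci cT] using graph_iff[of D ?c] by metis
  then have "Comp X D D D e' ?c = ?c"
    using domain_atD(6)[OF D *(2), of D ?c ?c] ci cT D by simp
  then have "e' = ?c" using ce' restriction_idempotent_commute[OF D(1) ci *(4)] by simp
  moreover have "Comp X D D B ?fg ?c = ?fg" using D B fg by simp
  ultimately show "on_partial_elements (representable \<T> ?A) (representable \<T> ?B)
      ?S D (pairing (e, g)) = pairing (?c, ?fg)"
    using *(1) y by simp
qed

lemma E_Lambda_iso_yoneda\<^sub>r: "restriction_iso X RP (\<E> \<circ>\<^sub>F Lambda small X) (yoneda\<^sub>r X)"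
proof -
  let ?y = "yoneda\<^sub>r X" and ?L = "\<E> \<circ>\<^sub>F Lambda small X"
  have FL: "FOb ?L A = restriction_presheaf_of (fibres (FOb ?y A))" if "A \<in> Ob X" for A
    using fibres_yoneda\<^sub>r[OF that]
    by (simp add: comp_func_def Lambda_def Par_func_def Phi_func_def J_func_def yoneda_def)
  have "restriction_functor X RP ?L \<and> restriction_iso X RP ?L ?y"
  proof (rule restriction_functor_conjugate[OF restriction_functor_yoneda\<^sub>r,
        where i = "\<lambda>A. from_fibres (FOb ?y A)" and j = "\<lambda>A. to_fibres (FOb ?y A)"])
    fix A assume A: "A \<in> Ob X"
    note yA = yoneda\<^sub>r_in_Ob[OF A]
    show "FOb ?L A \<in> Ob RP" using FL[OF A] yA by simp
    show "from_fibres (FOb ?y A) \<in> Hom RP (FOb ?L A) (FOb ?y A)"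
      "to_fibres (FOb ?y A) \<in> Hom RP (FOb ?y A) (FOb ?L A)"
      using from_fibres_in_Hom[OF yA] to_fibres_in_Hom[OF yA] FL[OF A] by (simp_all add: RP_simps)
    show "Comp RP (FOb ?L A) (FOb ?y A) (FOb ?L A) (to_fibres (FOb ?y A)) (from_fibres (FOb ?y A))
        = Id RP (FOb ?L A)"
      "Comp RP (FOb ?y A) (FOb ?L A) (FOb ?y A) (from_fibres (FOb ?y A)) (to_fibres (FOb ?y A))
        = Id RP (FOb ?y A)"
      using fibres_inverse[OF yA] FL[OF A] by (simp_all add: RP_simps)
    fix B f assume B: "B \<in> Ob X" and f: "f \<in> Hom X A B"
    note yB = yoneda\<^sub>r_in_Ob[OF B]
    let ?rA = "representable \<T> (A, Id X A)" and ?rB = "representable \<T> (B, Id X B)"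
    let ?g = "Comp RP (FOb ?L A) (FOb ?y B) (FOb ?L B) (to_fibres (FOb ?y B))
        (Comp RP (FOb ?L A) (FOb ?y A) (FOb ?y B) (FMap ?y A B f) (from_fibres (FOb ?y A)))"
    have FM: "FMap ?L A B f = on_partial_elements ?rA ?rB (FMap (Lambda small X) A B f)"
      by (simp add: comp_func_def Lambda_def Par_func_def Phi_func_def J_func_def yoneda_def)
    have rA: "?rA \<in> Ob T.Psh" "?rB \<in> Ob T.Psh" using A B by (simp_all add: restriction_idempotent_Id)
    have LH: "FMap (Lambda small X) A B f \<in> Hom (Par PM) ?rA ?rB"
      using on_partial_elements_Lambda(1)[OF A B f A restriction_idempotent_Id[OF A], of "Id X A"] A by simp
    show "FMap ?L A B f = ?g"
      unfolding FM
    proof (rule X.nat_eqI[OF _ _ on_partial_elements_in_Hom[OF rA LH]])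
      show "?g \<in> Hom X.Psh (partial_elements ?rA) (partial_elements ?rB)"
        using from_fibres_in_Hom[OF yA] to_fibres_in_Hom[OF yB] FL A B f yA yB fibres_yoneda\<^sub>r rA
        by (simp add: RP_simps)
      fix D t assume D: "D \<in> Ob X" and t': "t \<in> FOb (partial_elements ?rA) D"
      obtain g where t: "t = pairing (Rst X D A g, g)" and g: "g \<in> Hom X D A"
        using partial_elements_fibres_cases[OF yA D, of t] t' fibres_yoneda\<^sub>r[OF A] D by force
      have "?g D t = to_fibres (FOb ?y B) D (FMap ?y A B f D (from_fibres (FOb ?y A) D t))"
        using D t' FL[OF A] fibres_yoneda\<^sub>r[OF A] by (simp add: RP_simps)
      also have "from_fibres (FOb ?y A) D t = g"
        using from_fibres_app[of D "FOb ?y A" g] D g A t by (simp add: restriction_idempotent_Rst)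
      also have "to_fibres (FOb ?y B) D (FMap ?y A B f D g)
          = pairing (Rst X D B (Comp X D A B f g), Comp X D A B f g)"
        using A B D f g by simp
      finally show "on_partial_elements ?rA ?rB (FMap (Lambda small X) A B f) D t = ?g D t"
        using on_partial_elements_Lambda(2)[OF A B f D restriction_idempotent_Rst[OF D A g] g] t by simp
    qed (use rA in simp_all)
  qed
  then show ?thesis by blast
qed

end

theorem theorem34:
  fixes small :: "'u set \<Rightarrow> bool" and X :: "('o, 'u) rcategory"
  assumes "set_universe small"
    and "restriction_category X"
    and "locally_small small X"
  shows "restriction_equivalent (PSh\<^sub>r small X) (Par (PSh\<^sub>M small (MTotal (K\<^sub>r X)))) \<and>
    (\<exists>E. restriction_equivalence (Par (PSh\<^sub>M small (MTotal (K\<^sub>r X)))) (PSh\<^sub>r small X) E \<and>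
         restriction_iso X (PSh\<^sub>r small X) (E \<circ>\<^sub>F Lambda small X) (yoneda\<^sub>r X))"
proof -
  interpret small_restriction_category X small
    using assms by (intro small_restriction_category.intro small_restriction_category_axioms.intro)
  show ?thesis
    unfolding restriction_equivalent_def
    using transport.equivalence E_Lambda_iso_yoneda\<^sub>r by blast
qed

end
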